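(* The $C$-function $C_f(s,T)$ is $T$-adic entire in $s$. As a consequence, the $L$-function $L_f(s,T)$ is $T$-adic meromorphic in $s$.
   Context: Let $p$ be a prime, $a\ge 1$ an integer, $q=p^a$. For $k\ge1$ let $\mathbb{Q}_{q^k}$ be the unramified extension of $\mathbb{Q}_p$ (inside a fixed algebraic closure $\overline{\mathbb{Q}}_p$) with residue field $\mathbb{F}_{q^k}$, and $\mathbb{Z}_{q^k}$ its ring of integers; $\mu_r$ denotes the group of $r$-th roots of unity in $\overline{\mathbb{Q}}_p$. Fix $n\ge 1$ and a Laurent polynomial $f(x)=\sum_u a_ux^u\in\mathbb{Z}_q[x_1^{\pm1},\dots,x_n^{\pm1}]$ (finite sum over $u\in\mathbb{Z}^n$, $x^u=x_1^{u_1}\cdots x_n^{u_n}$) all of whose non-zero coefficients $a_u$ lie in $\mu_{q-1}$. For $k\ge 1$ put $S_f(k,T)=\sum_{x\in\mu_{q^k-1}^n}(1+T)^{\mathrm{Tr}_{\mathbb{Q}_{q^k}/\mathbb{Q}_p}(f(x))}\in\mathbb{Z}_p[[T]]$, where $(1+T)^\beta=\sum_{i\ge 0}\binom{\beta}{i}T^i$ for $\beta\in\mathbb{Z}_p$. Put $$L_f(s,T)=\exp\Big(\sum_{k\ge1}S_f(k,T)\frac{s^k}{k}\Big),\qquad C_f(s,T)=\exp\Big(\sum_{k\ge1}-(q^k-1)^{-n}S_f(k,T)\frac{s^k}{k}\Big),$$ viewed as power series in $s$ with coefficients in the complete discrete valuation ring $\mathbb{Q}_p[[T]]$ with uniformizer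 $T$ (the coefficients in fact lie in $\mathbb{Z}_p[[T]]$). A power series $\sum_k c_k s^k$ with $c_k\in\mathbb{Q}_p[[T]]$ is $T$-adic entire if $\mathrm{ord}_T(c_k)/k\to\infty$ as $k\to\infty$; a power series is $T$-adic meromorphic if it is a quotient of two $T$-adic entire power series. *)

theory Defs
  imports
    "HOL-Analysis.Analysis"
    "HOL-Algebra.Algebraic_Closure_Type"
    "HOL-Computational_Algebra.Computational_Algebra"
    "HOL-Library.Poly_Mapping"
    "Berlekamp_Zassenhaus.Finite_Field"
begin

section \<open>The field of $p$-adic numbers and its algebraic closure\<close>

text \<open>
  The prime is \<open>p = CARD('p)\<close> for a type \<open>'p\<close> of prime cardinality, and
  \<open>'p padic_int\<close> is the inverse limit of the rings \<open>\<int>/p\<^sup>n\<close>: the \<open>n\<close>-th component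
  of an element is the canonical representative of its residue class modulo \<open>p\<^sup>n\<close>.
\<close>

typedef ('p :: prime_card) padic_int =
  "{x :: nat \<Rightarrow> int. (\<forall>n. x n \<in> {0..<int CARD('p) ^ n}) \<and>
                    (\<forall>n. x (Suc n) mod int CARD('p) ^ n = x n)}"
  by (rule exI[of _ "\<lambda>_. 0"]) (use prime_card_int[where 'a = 'p] in \<open>auto simp: prime_gt_0_int\<close>)

setup_lifting type_definition_padic_int

lemma padic_coherent:
  fixes x :: "nat \<Rightarrow> int"
  assumes "P > 0" and "\<And>n. P ^ n dvd x (Suc n) - x n"
  shows "(\<forall>n. x n mod P ^ n \<in> {0..<P ^ n}) \<and>
         (\<forall>n. (x (Suc n) mod P ^ Suc n) mod P ^ n = x n mod P ^ n)"
proof -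
  have "(a mod P ^ Suc n) mod P ^ n = a mod P ^ n" for a n
    by (rule mod_mod_cancel) simp
  moreover have "x (Suc n) mod P ^ n = x n mod P ^ n" for n
    using assms(2) by (simp add: mod_eq_dvd_iff)
  ultimately show ?thesis
    using assms(1) by (simp del: power_Suc)
qed

lemma CARD_prime_pos: "0 < int CARD('p :: prime_card)"
  using prime_card_int[where 'a = 'p] by (simp add: prime_gt_0_int)

lemma padic_coherent_dvd:
  fixes x :: "nat \<Rightarrow> int"
  assumes "(\<forall>n. x n \<in> {0..<P ^ n}) \<and> (\<forall>n. x (Suc n) mod P ^ n = x n)"
  shows "P ^ n dvd x (Suc n) - x n"
  using assms by (metis mod_eq_dvd_iff mod_mod_trivial)

instantiation padic_int :: (prime_card) comm_ring_1
begin

lift_definition zero_padic_int :: "'a padic_int" is "\<lambda>n. 0 mod int CARD('a) ^ n"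
  by (rule padic_coherent[OF CARD_prime_pos]) simp

lift_definition one_padic_int :: "'a padic_int" is "\<lambda>n. 1 mod int CARD('a) ^ n"
  by (rule padic_coherent[OF CARD_prime_pos]) simp

lift_definition plus_padic_int :: "'a padic_int \<Rightarrow> 'a padic_int \<Rightarrow> 'a padic_int"
  is "\<lambda>x y n. (x n + y n) mod int CARD('a) ^ n"
proof (rule padic_coherent[OF CARD_prime_pos], goal_cases)
  case (1 x y n)
  show ?case
    using dvd_add[OF padic_coherent_dvd[OF 1(1)] padic_coherent_dvd[OF 1(2)], of n]
    by (simp add: algebra_simps)
qed

lift_definition minus_padic_int :: "'a padic_int \<Rightarrow> 'a padic_int \<Rightarrow> 'a padic_int"
  is "\<lambda>x y n. (x n - y n) mod int CARD('a) ^ n"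
proof (rule padic_coherent[OF CARD_prime_pos], goal_cases)
  case (1 x y n)
  show ?case
    using dvd_diff[OF padic_coherent_dvd[OF 1(1)] padic_coherent_dvd[OF 1(2)], of n]
    by (simp add: algebra_simps)
qed

lift_definition uminus_padic_int :: "'a padic_int \<Rightarrow> 'a padic_int"
  is "\<lambda>x n. (- x n) mod int CARD('a) ^ n"
proof (rule padic_coherent[OF CARD_prime_pos], goal_cases)
  case (1 x n)
  show ?case
    using padic_coherent_dvd[OF 1, of n] by (metis dvd_minus_iff minus_diff_commute minus_diff_minus)
qed

lift_definition times_padic_int :: "'a padic_int \<Rightarrow> 'a padic_int \<Rightarrow> 'a padic_int"
  is "\<lambda>x y n. (x n * y n) mod int CARD('a) ^ n"
proof (rule padic_coherent[OF CARD_prime_pos], goal_cases)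
  case (1 x y n)
  have "x (Suc n) * y (Suc n) - x n * y n =
          (x (Suc n) - x n) * y (Suc n) + x n * (y (Suc n) - y n)"
    by (simp add: algebra_simps)
  then show ?case
    using padic_coherent_dvd[OF 1(1), of n] padic_coherent_dvd[OF 1(2), of n] by simp
qed

instance
proof
  fix a b c :: "'a padic_int"
  show "a + b + c = a + (b + c)" by transfer (auto simp: mod_simps algebra_simps)
  show "a + b = b + a" by transfer (auto simp: algebra_simps)
  show "0 + a = a" by transfer auto
  show "- a + a = 0" by transfer (auto simp: mod_simps)
  show "a - b = a + - b" by transfer (auto simp: mod_simps)
  show "a * b * c = a * (b * c)" by transfer (auto simp: mod_simps algebra_simps)
  show "a * b = b * a" by transfer (auto simp: algebra_simps)
  show "1 * a = a" by transfer (auto simp: mod_simps)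
  show "(a + b) * c = a * c + b * c" by transfer (auto simp: mod_simps algebra_simps)
  have "0 mod int CARD('a) ^ 1 \<noteq> 1 mod int CARD('a) ^ 1"
    using prime_gt_1_int[OF prime_card_int[where 'a = 'a]] by simp
  then show "(0 :: 'a padic_int) \<noteq> 1" by transfer metis
qed

end


lemma padic_int_component_mod:
  assumes "n \<le> N"
  shows "Rep_padic_int (x :: 'p :: prime_card padic_int) N mod int CARD('p) ^ n = Rep_padic_int x n"
  using assms
proof (induction N rule: dec_induct)
  case base
  show ?case using Rep_padic_int[of x] by simp
next
  case (step N)
  have "Rep_padic_int x (Suc N) mod int CARD('p) ^ N = Rep_padic_int x N"
    using Rep_padic_int[of x] by blast
  moreover have "Rep_padic_int x (Suc N) mod int CARD('p) ^ N mod int CARD('p) ^ n =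
                   Rep_padic_int x (Suc N) mod int CARD('p) ^ n"
    by (rule mod_mod_cancel) (use step.hyps in \<open>simp add: le_imp_power_dvd\<close>)
  ultimately show ?case using step.IH by simp
qed

lemma padic_int_eq_0_iff:
  "x = 0 \<longleftrightarrow> (\<forall>n. int CARD('p) ^ n dvd Rep_padic_int (x :: 'p :: prime_card padic_int) n)"
proof
  assume dvd: "\<forall>n. int CARD('p) ^ n dvd Rep_padic_int x n"
  have "Rep_padic_int x n = 0" for n
    using dvd padic_int_component_mod[of n n x] by (metis dvd_imp_mod_0 le_refl)
  then have "Rep_padic_int x = Rep_padic_int (0 :: 'p padic_int)"
    by (auto simp: zero_padic_int.rep_eq)
  then show "x = 0" by (simp only: Rep_padic_int_inject)
qed (simp add: zero_padic_int.rep_eq)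

instance padic_int :: (prime_card) idom
proof
  fix x y :: "'a padic_int"
  let ?p = "int CARD('a)"
  assume "x \<noteq> 0" "y \<noteq> 0"
  then obtain m l where m: "\<not> ?p ^ m dvd Rep_padic_int x m" and l: "\<not> ?p ^ l dvd Rep_padic_int y l"
    by (auto simp: padic_int_eq_0_iff)
  have "\<not> ?p ^ m dvd Rep_padic_int x (m + l)"
    using m padic_int_component_mod[of m "m + l" x]
    by (metis dvd_imp_mod_0 dvd_0_right le_add1)
  moreover have "\<not> ?p ^ l dvd Rep_padic_int y (m + l)"
    using l padic_int_component_mod[of l "m + l" y]
    by (metis dvd_imp_mod_0 dvd_0_right le_add2)
  moreover have "?p ^ m dvd a \<or> ?p ^ l dvd b" if "?p ^ (m + l) dvd a * b" for a b
  proof (rule prime_elem_power_dvd_cases[of ?p "m + l - 1"])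
    show "?p ^ (m + l - 1) dvd a * b"
      using that by (rule power_le_dvd) simp
    show "m + l = Suc (m + l - 1)"
      using m by (cases m) auto
    show "prime_elem ?p"
      using prime_card_int[where 'a = 'a] by blast
  qed
  ultimately have "\<not> ?p ^ (m + l) dvd Rep_padic_int x (m + l) * Rep_padic_int y (m + l)"
    by blast
  then have "\<not> ?p ^ (m + l) dvd Rep_padic_int (x * y) (m + l)"
    by (simp add: times_padic_int.rep_eq dvd_mod_iff)
  then show "x * y \<noteq> 0"
    by (auto simp: padic_int_eq_0_iff)
qed

lemma Rep_padic_int_of_nat:
  "Rep_padic_int (of_nat k :: 'p :: prime_card padic_int) n = int k mod int CARD('p) ^ n"
  by (induction k)
     (simp_all add: zero_padic_int.rep_eq one_padic_int.rep_eq plus_padic_int.rep_eq mod_simps)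

instance padic_int :: (prime_card) ring_char_0
proof
  show "inj (of_nat :: nat \<Rightarrow> 'a padic_int)"
  proof (rule injI)
    fix i j :: nat
    assume eq: "(of_nat i :: 'a padic_int) = of_nat j"
    let ?n = "i + j"
    have "1 < CARD('a)"
      using prime_card[where 'a = 'a] by (rule prime_gt_1_nat)
    then have "?n < CARD('a) ^ ?n"
      using power_gt_expt[of "CARD('a)" ?n] by simp
    then have "int i < int CARD('a) ^ ?n" "int j < int CARD('a) ^ ?n"
      by (simp_all flip: of_nat_power)
    moreover have "int i mod int CARD('a) ^ ?n = int j mod int CARD('a) ^ ?n"
      using arg_cong[OF eq, of "\<lambda>x. Rep_padic_int x ?n"] by (simp add: Rep_padic_int_of_nat)
    ultimately show "i = j" by simp
  qed
qed

instance fract :: ("{idom, ring_char_0}") field_char_0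
proof
  show "inj (of_nat :: nat \<Rightarrow> 'a fract)"
    by (rule injI) (simp add: of_nat_fract eq_fract)
qed

type_synonym 'p padic = "'p padic_int fract"

type_synonym 'p padic_closure = "'p padic alg_closure"

definition zp_embed :: "'p :: prime_card padic_int \<Rightarrow> 'p padic_closure" where
  "zp_embed c = to_ac (Fract c 1)"

interpretation padic_vs: vector_space "\<lambda>(c :: 'p :: prime_card padic) (x :: 'p padic_closure). to_ac c * x"
  by unfold_locales (simp_all add: algebra_simps)


section \<open>Finite extensions inside the algebraic closure\<close>

definition finite_extension :: "'p :: prime_card padic_closure set \<Rightarrow> bool" where
  "finite_extension K \<longleftrightarrow>
     range to_ac \<subseteq> K \<and>
     (\<forall>x\<in>K. \<forall>y\<in>K. x + y \<in> K \<and> x * y \<in> K) \<and>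
     (\<forall>x\<in>K. - x \<in> K \<and> inverse x \<in> K) \<and>
     (\<exists>B. finite B \<and> padic_vs.span B = K)"

definition integral_over_zp :: "'p :: prime_card padic_closure \<Rightarrow> bool" where
  "integral_over_zp x \<longleftrightarrow>
     (\<exists>g :: 'p padic_int poly. Polynomial.lead_coeff g = 1 \<and> poly (map_poly zp_embed g) x = 0)"

definition ring_of_integers :: "'p :: prime_card padic_closure set \<Rightarrow> 'p padic_closure set" where
  "ring_of_integers K = {x \<in> K. integral_over_zp x}"

text \<open>The non-units of the ring of integers, which is a local ring.\<close>

definition integers_max_ideal :: "'p :: prime_card padic_closure set \<Rightarrow> 'p padic_closure set" where
  "integers_max_ideal K =
     {x \<in> ring_of_integers K. \<not> (\<exists>y \<in> ring_of_integers K. x * y = 1)}"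

definition residue_field :: "'p :: prime_card padic_closure set \<Rightarrow> 'p padic_closure set set" where
  "residue_field K =
     ring_of_integers K //
       {(x, y). x \<in> ring_of_integers K \<and> y \<in> ring_of_integers K \<and> x - y \<in> integers_max_ideal K}"

text \<open>
  Ramification index one: \<open>p\<close> generates the maximal ideal. Separability of the residue
  extension is automatic because the residue fields are finite.
\<close>

definition unramified :: "'p :: prime_card padic_closure set \<Rightarrow> bool" where
  "unramified K \<longleftrightarrow> finite_extension K \<and>
     integers_max_ideal K = (\<lambda>x. of_nat CARD('p) * x) ` ring_of_integers K"

text \<open>
  \<open>Q_unram r\<close> is $\mathbb{Q}_r$ for a power \<open>r\<close> of \<open>p\<close>: the unramified extension with residue
  field $\mathbb{F}_r$, a finite field being determined by its cardinality.
\<close>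

definition Q_unram :: "nat \<Rightarrow> 'p :: prime_card padic_closure set" where
  "Q_unram r = (THE K. unramified K \<and> card (residue_field K) = r)"

definition Z_unram :: "nat \<Rightarrow> 'p :: prime_card padic_closure set" where
  "Z_unram r = ring_of_integers (Q_unram r)"

text \<open>
  The trace of the $\mathbb{Q}_p$-linear endomorphism of \<open>K\<close> given by multiplication by \<open>x\<close>,
  as the sum of the diagonal entries of its matrix in some basis.
\<close>

definition field_trace :: "'p :: prime_card padic_closure set \<Rightarrow> 'p padic_closure \<Rightarrow> 'p padic" where
  "field_trace K x =
     (let B = (SOME B. padic_vs.independent B \<and> padic_vs.span B = K)
      in \<Sum>b\<in>B. padic_vs.representation B (x * b) b)"

definition roots_of_unity :: "nat \<Rightarrow> 'p :: prime_card padic_closure set" where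
  "roots_of_unity r = {z. z ^ r = 1}"


section \<open>$T$-adic exponential sums\<close>

text \<open>
  A Laurent polynomial in the variables indexed by \<open>'n\<close> is a finitely supported function on
  the exponent group \<open>int ^ 'n\<close>.
\<close>

definition laurent_eval :: "(int ^ 'n \<Rightarrow>\<^sub>0 'a :: field) \<Rightarrow> 'a ^ 'n \<Rightarrow> 'a" where
  "laurent_eval f x =
     (\<Sum>u\<in>Poly_Mapping.keys f. Poly_Mapping.lookup f u * (\<Prod>i\<in>UNIV. (x $ i) powi (u $ i)))"

text \<open>The variable of the type \<open>'p padic fps\<close> is \<open>T\<close>.\<close>

definition S_sum ::
  "nat \<Rightarrow> (int ^ 'n \<Rightarrow>\<^sub>0 'p :: prime_card padic_closure) \<Rightarrow> nat \<Rightarrow> 'p padic fps" where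
  "S_sum q f k =
     (\<Sum>x | \<forall>i. x $ i \<in> roots_of_unity (q ^ k - 1).
        fps_binomial (field_trace (Q_unram (q ^ k)) (laurent_eval f x)))"

text \<open>
  In \<open>'p padic fps fps\<close> the outer variable is \<open>s\<close>. The library's \<open>fps_exp\<close> requires coefficients
  in a field, whence the explicit exponential series. It is only meaningful for series without
  constant term.
\<close>

definition exp_series :: "'a :: field_char_0 fps fps \<Rightarrow> 'a fps fps" where
  "exp_series F = Abs_fps (\<lambda>i. fps_const (1 / fact i)) oo F"

definition L_function ::
  "nat \<Rightarrow> (int ^ 'n \<Rightarrow>\<^sub>0 'p :: prime_card padic_closure) \<Rightarrow> 'p padic fps fps" where
  "L_function q f = exp_series (Abs_fps (\<lambda>k.
     if k = 0 then 0 else fps_const (1 / of_nat k) * S_sum q f k))"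

definition C_function ::
  "nat \<Rightarrow> (int ^ 'n \<Rightarrow>\<^sub>0 'p :: prime_card padic_closure) \<Rightarrow> 'p padic fps fps" where
  "C_function q f = exp_series (Abs_fps (\<lambda>k.
     if k = 0 then 0
     else fps_const (- 1 / (of_nat q ^ k - 1) ^ CARD('n) / of_nat k) * S_sum q f k))"


section \<open>$T$-adic entire and meromorphic series\<close>

text \<open>\<open>subdegree 0 = 0\<close>, but the order of vanishing of the zero series is infinite.\<close>

definition ord_T :: "'a :: zero fps \<Rightarrow> ereal" where
  "ord_T c = (if c = 0 then \<infinity> else ereal (real (subdegree c)))"

definition T_adic_entire :: "'a :: zero fps fps \<Rightarrow> bool" where
  "T_adic_entire F \<longleftrightarrow> (\<lambda>k. ord_T (fps_nth F k) / ereal (real k)) \<longlonglongrightarrow> \<infinity>"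

definition T_adic_meromorphic :: "'a :: field fps fps \<Rightarrow> bool" where
  "T_adic_meromorphic F \<longleftrightarrow>
     (\<exists>G H. T_adic_entire G \<and> T_adic_entire H \<and> H \<noteq> 0 \<and> F * H = G)"

end

(*
A root of unity of order prime to p is determined by its residue, and Teichmueller lifting shows that
an unramified extension with residue field of r = p^m elements is the span of the (r-1)-th roots of
unity; the conjugates of such a root z over Q_p are the z^(p^i), so the trace of f(x) is the sum over
i < m of the Frobenius twists of f at x^(p^i).  Writing (1+T)^g(x) = sum_v G_v x^v, where g collects
the first a twists, the binomial expansion gives ord_T G_v >= |v|/D.  Dwork's trace formula identifies
(q^k-1)^(-n) S_f(k,T) with the trace of the k-th power of the matrix (G_{q w' - w})_{w,w'}, so that
C_f(s,T) = det(1 - s G).  The coefficient of s^k is a sum over permutations of k-element sets of lattice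
points, and |q w' - w| >= q|w'| - |w| makes its order at least (q-1)/D times the least possible sum of |w|
over such a set, which grows faster than linearly in k.  Modulo a fixed power of T only finitely many w matter,
so only finite determinants are needed.  Finally (q^k-1)^n = sum_j (-1)^(n-j) binom(n,j) q^(kj)
expresses L_f as a quotient of products of the series C_f(q^j s,T).
*)
theory Submission
  imports Defs "Jordan_Normal_Form.Char_Poly"
begin

section \<open>The ring of $p$-adic integers\<close>

text \<open>Integrality over Z_p takes the place of a valuation on the closure: \<open>1 / p\<close>
  is not integral, an integral element divisible by all powers of \<open>p\<close> is
  \<open>0\<close>, and finitely generated Z_p-modules are complete. \<open>Q_unram\<close> is a
  definite description, so existence and uniqueness of the unramified extension are both at stake;
  the same Teichmueller argument, in a finitely generated ring on whose residues the
  \<open>r\<close>-th power map is the identity, serves both. \<open>field_trace\<close> rests on an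
  arbitrarily chosen basis, which is dealt with by diagonalising multiplication over the closure.

  No infinite determinant is formed. For each T-degree \<open>N\<close>, the matrix indexed by the
  lattice points of sup-norm at most \<open>D N\<close> has the right traces of powers through
  \<open>T^N\<close>; the box suffices because \<open>q \<ge> 2\<close> pulls exponents back into
  it. The finite determinant and \<open>C_f\<close> are compared through logarithmic derivatives, a
  recursion that respects truncation in \<open>T\<close>. The resulting bound does not depend on the
  size of the box, so \<open>N\<close> may vary. The determinant argument runs over the closure,
  where the roots of unity live, and returns to Q_p because \<open>to_ac\<close> is
  injective.\<close>

lemma Rep_padic_int_bounds: "0 \<le> Rep_padic_int (x :: 'p :: prime_card padic_int) n" 
    "Rep_padic_int (x :: 'p padic_int) n < int CARD('p) ^ n"
  using Rep_padic_int[of x] by auto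

lemma Rep_padic_int_mod [simp]:
  "Rep_padic_int (x :: 'p :: prime_card padic_int) n mod int CARD('p) ^ n = Rep_padic_int x n"
  using padic_int_component_mod[of n n x] by simp

lemma Rep_padic_int_of_int:
  "Rep_padic_int (of_int k :: 'p :: prime_card padic_int) n = k mod int CARD('p) ^ n"
proof (cases k rule: int_cases2)
  case (nonpos m)
  then show ?thesis
    by (simp add: uminus_padic_int.rep_eq Rep_padic_int_of_nat mod_simps)
qed (simp add: Rep_padic_int_of_nat)

text \<open>The quotient has to be built from later components: dividing by \<open>p^N\<close> costs
  \<open>N\<close> digits, so component \<open>n\<close> of the quotient comes from component
  \<open>n + N\<close> of \<open>x\<close>.\<close>

lemma padic_power_dvd_iff:
  "of_nat CARD('p) ^ N dvd (x :: 'p :: prime_card padic_int) \<longleftrightarrow> Rep_padic_int x N = 0"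
proof
  assume "of_nat CARD('p) ^ N dvd x"
  then obtain y where "x = of_nat (CARD('p) ^ N) * y" by (auto elim: dvdE)
  then show "Rep_padic_int x N = 0"
    by (simp add: times_padic_int.rep_eq Rep_padic_int_of_nat flip: of_nat_power)
next
  assume x0: "Rep_padic_int x N = 0"
  let ?P = "int CARD('p)"
  have P0: "?P > 0" by (rule CARD_prime_pos)
  define y where "y n = Rep_padic_int x (n + N) div ?P ^ N" for n
  have dvd: "?P ^ N dvd Rep_padic_int x (n + N)" for n
    using padic_int_component_mod[of N "n + N" x] x0 by (auto simp: mod_eq_0_iff_dvd)
  have yN: "?P ^ N * y n = Rep_padic_int x (n + N)" for n
    using dvd[of n] by (simp add: y_def)
  have "y n \<in> {0..<?P ^ n}" for n
  proof -
    have "0 \<le> ?P ^ N * y n" "?P ^ N * y n < ?P ^ N * ?P ^ n"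
      unfolding yN using Rep_padic_int_bounds[of x "n + N"] by (simp_all add: power_add mult.commute)
    then show ?thesis using zero_less_power[OF P0, of N] by (auto simp: zero_le_mult_iff)
  qed
  moreover have "y (Suc n) mod ?P ^ n = y n" for n
  proof -
    have "?P ^ N * (y (Suc n) mod ?P ^ n) = (?P ^ N * y (Suc n)) mod (?P ^ N * ?P ^ n)"
      by (rule mult_mod_right)
    also have "\<dots> = ?P ^ N * y n"
      unfolding yN power_add[symmetric] add.commute[of N n]
      by (rule padic_int_component_mod) simp
    finally show ?thesis using P0 by (metis mult_left_cancel less_irrefl zero_less_power)
  qed
  ultimately have y: "y \<in> {x. (\<forall>n. x n \<in> {0..<?P ^ n}) \<and> (\<forall>n. x (Suc n) mod ?P ^ n = x n)}"
    by blast
  have "Rep_padic_int x = Rep_padic_int (of_nat (CARD('p) ^ N) * Abs_padic_int y :: 'p padic_int)"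
  proof
    fix n
    have "Rep_padic_int (of_nat (CARD('p) ^ N) * Abs_padic_int y :: 'p padic_int) n =
        (?P ^ N mod ?P ^ n) * y n mod ?P ^ n"
      unfolding times_padic_int.rep_eq Rep_padic_int_of_nat Abs_padic_int_inverse[OF y]
      by simp
    also have "\<dots> = (?P ^ N * y n) mod ?P ^ n" by (simp add: mod_simps)
    also have "\<dots> = Rep_padic_int x n"
      unfolding yN using padic_int_component_mod[of n "n + N" x] by simp
    finally show "Rep_padic_int x n = Rep_padic_int (of_nat (CARD('p) ^ N) * Abs_padic_int y :: 'p padic_int) n" ..
  qed
  then have "x = of_nat CARD('p) ^ N * Abs_padic_int y"
    by (simp add: Rep_padic_int_inject)
  then show "of_nat CARD('p) ^ N dvd x" by simp
qed

lemma padic_int_eq_0_if_dvd: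
  assumes "\<And>N. of_nat CARD('p) ^ N dvd (x :: 'p :: prime_card padic_int)"
  shows "x = 0"
  using assms by (simp add: padic_power_dvd_iff padic_int_eq_0_iff)

text \<open>Completeness, in the shape in which limits are taken later: series in powers of
  \<open>p\<close> with arbitrary coefficients. Component \<open>n\<close> of the sum is read off
  from the partial sum with \<open>n\<close> terms, since the later terms vanish modulo
  \<open>p^n\<close>.\<close>

lemma padic_int_series_converges:
  fixes c :: "nat \<Rightarrow> 'p :: prime_card padic_int"
  shows "\<exists>s. \<forall>N. of_nat CARD('p) ^ N dvd s - (\<Sum>k<N. of_nat CARD('p) ^ k * c k)"
proof -
  let ?P = "int CARD('p)"
  let ?t = "\<lambda>N. \<Sum>k<N. of_nat CARD('p) ^ k * c k"
  define y where "y n = Rep_padic_int (?t n) n" for n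
  have "y (Suc n) mod ?P ^ n = y n" for n
  proof -
    have "of_nat CARD('p) ^ n dvd ?t (Suc n) - ?t n" by simp
    then have "?P ^ n dvd (Rep_padic_int (?t (Suc n)) n - Rep_padic_int (?t n) n)"
      unfolding padic_power_dvd_iff minus_padic_int.rep_eq by (simp only: mod_eq_0_iff_dvd)
    then have "Rep_padic_int (?t (Suc n)) n mod ?P ^ n = Rep_padic_int (?t n) n mod ?P ^ n"
      by (simp only: mod_eq_dvd_iff)
    then have "Rep_padic_int (?t (Suc n)) n = y n"
      unfolding y_def by (simp only: Rep_padic_int_mod)
    then show ?thesis
      unfolding y_def using padic_int_component_mod[of n "Suc n" "?t (Suc n)"] by simp
  qed
  moreover have "y n \<in> {0..<?P ^ n}" for n
    unfolding y_def using Rep_padic_int_bounds by auto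
  ultimately have y: "y \<in> {x. (\<forall>n. x n \<in> {0..<?P ^ n}) \<and> (\<forall>n. x (Suc n) mod ?P ^ n = x n)}"
    by blast
  have "of_nat CARD('p) ^ N dvd Abs_padic_int y - ?t N" for N
    unfolding padic_power_dvd_iff minus_padic_int.rep_eq Abs_padic_int_inverse[OF y]
    by (simp add: y_def)
  then show ?thesis by blast
qed

text \<open>The inverse is the geometric series in \<open>- p y\<close>; after \<open>N\<close>
  terms the error is divisible by \<open>p^N\<close>.\<close>

lemma padic_int_one_plus_unit:
  fixes y :: "'p :: prime_card padic_int"
  shows "1 + of_nat CARD('p) * y dvd 1"
proof -
  let ?p = "of_nat CARD('p) :: 'p padic_int"
  obtain s where s: "\<And>N. ?p ^ N dvd s - (\<Sum>k<N. ?p ^ k * (- y) ^ k)"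
    using padic_int_series_converges[of "\<lambda>k. (- y) ^ k"] by blast
  have "(1 + ?p * y) * s - 1 = 0"
  proof (rule padic_int_eq_0_if_dvd)
    fix N
    have "(1 + ?p * y) * (\<Sum>k<N. ?p ^ k * (- y) ^ k) = 1 - (- (?p * y)) ^ N"
      unfolding power_mult_distrib[symmetric]
      by (metis one_diff_power_eq diff_minus_eq_add mult_minus_right)
    then have "(1 + ?p * y) * s - 1 =
        (1 + ?p * y) * (s - (\<Sum>k<N. ?p ^ k * (- y) ^ k)) - (- (?p * y)) ^ N"
      by (simp add: algebra_simps)
    moreover have "?p ^ N dvd (- (?p * y)) ^ N"
      by (metis dvd_triv_left mult_minus_right power_mult_distrib)
    ultimately show "?p ^ N dvd (1 + ?p * y) * s - 1"
      by (simp only:) (intro dvd_diff dvd_mult s)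
  qed
  then have "1 = (1 + ?p * y) * s" by simp
  then show ?thesis by (rule dvdI)
qed

text \<open>Bezout inverts the residue modulo \<open>p\<close>; multiplying by the integer
  \<open>v\<close> so obtained moves \<open>x\<close> to the form \<open>1 + p y\<close>.\<close>

lemma padic_int_unit_if_not_dvd:
  fixes x :: "'p :: prime_card padic_int"
  assumes "\<not> of_nat CARD('p) dvd x"
  shows "x dvd 1"
proof -
  let ?p = "of_nat CARD('p) :: 'p padic_int"
  let ?c = "Rep_padic_int x 1"
  have "?c \<noteq> 0" using assms padic_power_dvd_iff[of 1 x] by simp
  then have "\<not> int CARD('p) dvd ?c"
    using Rep_padic_int_bounds[of x 1] by (simp add: zdvd_not_zless)
  then have "coprime (int CARD('p)) ?c"
    using prime_card_int[where 'a = 'p] by (simp add: prime_imp_coprime)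
  then obtain u v where uv: "u * int CARD('p) + v * ?c = 1"
    using bezout_int[of "int CARD('p)" ?c] by auto
  then have "v * ?c mod int CARD('p) = 1 mod int CARD('p)"
    by (metis mod_mult_self1 add.commute mult.commute)
  then have "Rep_padic_int (of_int v * x - 1) 1 = 0"
    unfolding minus_padic_int.rep_eq times_padic_int.rep_eq one_padic_int.rep_eq
        Rep_padic_int_of_int power_one_right by (simp only: mod_simps diff_self mod_0)
  then have "?p dvd of_int v * x - 1"
    using padic_power_dvd_iff[of 1 "of_int v * x - 1"] by simp
  then obtain y where "of_int v * x - 1 = ?p * y" by (auto elim: dvdE)
  then have "of_int v * x = 1 + ?p * y" by (simp add: algebra_simps)
  then have "of_int v * x dvd 1" using padic_int_one_plus_unit by metis
  then show ?thesis by (rule dvd_mult_right)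
qed

text \<open>\<open>k\<close> is the valuation of \<open>x\<close>, one less than the first exponent
  whose power of \<open>p\<close> does not divide \<open>x\<close>; the cofactor is then a unit with
  inverse \<open>v\<close>.\<close>

lemma padic_int_factor:
  fixes x :: "'p :: prime_card padic_int"
  assumes "x \<noteq> 0"
  obtains k u v where "x = of_nat CARD('p) ^ k * u" "u * v = 1"
proof -
  let ?p = "of_nat CARD('p) :: 'p padic_int"
  have ex: "\<exists>N. \<not> ?p ^ N dvd x" using assms padic_int_eq_0_if_dvd by blast
  define N where "N = (LEAST N. \<not> ?p ^ N dvd x)"
  have N: "\<not> ?p ^ N dvd x" unfolding N_def by (rule LeastI_ex[OF ex])
  then obtain k where k: "N = Suc k" by (cases N) auto
  have "?p ^ k dvd x" using not_less_Least[of k "\<lambda>N. \<not> ?p ^ N dvd x"] k N_def by auto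
  then obtain u where u: "x = ?p ^ k * u" by (auto elim: dvdE)
  have "\<not> ?p dvd u" using N u k by (auto simp: mult.commute intro: mult_dvd_mono)
  then obtain v where "1 = u * v" using padic_int_unit_if_not_dvd by (metis dvdE)
  then show ?thesis using that u by metis
qed

lemma padic_int_prime_not_unit: "\<not> of_nat CARD('p) dvd (1 :: 'p :: prime_card padic_int)"
proof -
  have "Rep_padic_int (1 :: 'p padic_int) 1 = 1"
    using prime_gt_1_int[OF prime_card_int[where 'a = 'p]] by (simp add: one_padic_int.rep_eq)
  then show ?thesis using padic_power_dvd_iff[of 1 "1 :: 'p padic_int"] by simp
qed

lemma padic_int_residue:
  fixes x :: "'p :: prime_card padic_int"
  obtains c where "c < CARD('p)" "of_nat CARD('p) dvd x - of_nat c"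
proof
  show "nat (Rep_padic_int x 1) < CARD('p)" using Rep_padic_int_bounds[of x 1] by auto
  have "Rep_padic_int (x - of_nat (nat (Rep_padic_int x 1))) 1 = 0"
    by (simp only: minus_padic_int.rep_eq Rep_padic_int_of_nat nat_0_le Rep_padic_int_bounds
        Rep_padic_int_mod diff_self mod_0)
  then show "of_nat CARD('p) dvd x - of_nat (nat (Rep_padic_int x 1))"
    using padic_power_dvd_iff[of 1 "x - of_nat (nat (Rep_padic_int x 1))"] by simp
qed

lemma padic_int_dvd_of_nat_iff:
  "(of_nat CARD('p) :: 'p :: prime_card padic_int) dvd of_int c \<longleftrightarrow> int CARD('p) dvd c"
  using padic_power_dvd_iff[of 1 "of_int c :: 'p padic_int"]
  by (simp only: Rep_padic_int_of_int power_one_right mod_eq_0_iff_dvd)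

section \<open>Integral elements\<close>

lemma zp_embed_0 [simp]: "zp_embed 0 = 0"
  and zp_embed_1 [simp]: "zp_embed 1 = 1"
  and zp_embed_add: "zp_embed (x + y) = zp_embed x + zp_embed y"
  and zp_embed_mult: "zp_embed (x * y) = zp_embed x * zp_embed y"
  by (simp_all add: zp_embed_def Zero_fract_def[symmetric] One_fract_def[symmetric]
      flip: to_ac_add to_ac_mult)

lemma zp_embed_eq_0_iff [simp]: "zp_embed x = 0 \<longleftrightarrow> x = 0"
  by (simp add: zp_embed_def Zero_fract_def eq_fract)

interpretation zp_embed: inj_idom_hom "zp_embed :: 'p :: prime_card padic_int \<Rightarrow> 'p padic_closure"
  by unfold_locales (simp_all add: zp_embed_add zp_embed_mult)

lemma zp_embed_of_nat [simp]: "zp_embed (of_nat n) = of_nat n"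
  by (induction n) (simp_all add: zp_embed_add)

lemma zp_embed_uminus: "zp_embed (- x) = - zp_embed x"
  by (metis add.right_inverse eq_neg_iff_add_eq_0 zp_embed_0 zp_embed_add add.commute)

text \<open>A denominator is \<open>p^k\<close> times a unit, and the unit can be moved into the
  numerator. Hence powers of \<open>p\<close> suffice to clear denominators.\<close>

lemma padic_denominator:
  fixes c :: "'p :: prime_card padic"
  obtains k z where "of_nat CARD('p) ^ k * to_ac c = zp_embed z"
proof -
  obtain a b where ab: "c = Fract a b" "b \<noteq> 0" by (cases c) auto
  obtain k u v where uv: "b = of_nat CARD('p) ^ k * u" "u * v = 1"
    using padic_int_factor[OF ab(2)] by metis
  have "Fract (of_nat CARD('p) ^ k) 1 * c = Fract (a * v) 1"
    using ab uv by (simp add: eq_fract) (simp add: mult.commute[of v u])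
  then have "to_ac (Fract (of_nat CARD('p) ^ k) 1 * c) = zp_embed (a * v)"
    by (simp only: zp_embed_def)
  moreover have "to_ac (Fract (of_nat CARD('p) ^ k) 1) = (of_nat CARD('p) ^ k :: 'p padic_closure)"
    using zp_embed.hom_power[of "of_nat CARD('p) :: 'p padic_int" k]
    by (simp only: zp_embed_of_nat) (simp only: zp_embed_def)
  ultimately show ?thesis using that by (metis to_ac_mult)
qed

interpretation zp_mod: Modules.module "\<lambda>(c :: 'p :: prime_card padic_int) (x :: 'p padic_closure). zp_embed c * x"
  by unfold_locales (simp_all add: zp_embed_add zp_embed_mult algebra_simps)

lemma integral_over_zp_relation:
  fixes x :: "'p :: prime_card padic_closure"
  shows "integral_over_zp x \<longleftrightarrow> (\<exists>n c. x ^ n = (\<Sum>i<n. zp_embed (c i) * x ^ i))"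
proof
  assume "integral_over_zp x"
  then obtain g :: "'p padic_int poly"
    where g: "Polynomial.lead_coeff g = 1" "poly (map_poly zp_embed g) x = 0"
    by (auto simp: integral_over_zp_def)
  let ?n = "Polynomial.degree g"
  have "poly (map_poly zp_embed g) x = (\<Sum>i\<le>?n. zp_embed (poly.coeff g i) * x ^ i)"
    by (subst poly_altdef) (simp add: coeff_map_poly zp_embed.degree_map_poly_hom)
  also have "\<dots> = (\<Sum>i<?n. zp_embed (poly.coeff g i) * x ^ i) + x ^ ?n"
    using g(1) by (simp add: lessThan_Suc_atMost[symmetric])
  finally have "x ^ ?n = (\<Sum>i<?n. zp_embed (- poly.coeff g i) * x ^ i)"
    using g(2) by (simp add: zp_embed_uminus sum_negf eq_neg_iff_add_eq_0 add.commute)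
  then show "\<exists>n c. x ^ n = (\<Sum>i<n. zp_embed (c i) * x ^ i)" by (intro exI)
next
  assume "\<exists>n c. x ^ n = (\<Sum>i<n. zp_embed (c i) * x ^ i)"
  then obtain n c where nc: "x ^ n = (\<Sum>i<n. zp_embed (c i) * x ^ i)" by blast
  define h :: "'p padic_int poly" where "h = (\<Sum>i<n. Polynomial.monom (- c i) i)"
  define g where "g = Polynomial.monom 1 n + h"
  have h: "poly.coeff h i = (if i < n then - c i else 0)" for i
    by (simp add: h_def coeff_sum)
  have cg: "poly.coeff g i = (if i < n then - c i else if i = n then 1 else 0)" for i
    by (simp add: g_def h)
  have deg: "Polynomial.degree g = n"
    by (rule antisym, rule degree_le, simp add: cg, rule le_degree, simp add: cg)
  have "poly (map_poly zp_embed g) x = (\<Sum>i\<le>n. zp_embed (poly.coeff g i) * x ^ i)"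
    by (subst poly_altdef) (simp add: coeff_map_poly zp_embed.degree_map_poly_hom deg)
  also have "\<dots> = (\<Sum>i<n. zp_embed (poly.coeff g i) * x ^ i) + x ^ n"
    by (simp add: lessThan_Suc_atMost[symmetric] cg)
  also have "(\<Sum>i<n. zp_embed (poly.coeff g i) * x ^ i) = - (\<Sum>i<n. zp_embed (c i) * x ^ i)"
    by (simp add: cg zp_embed_uminus sum_negf)
  finally have "poly (map_poly zp_embed g) x = 0" using nc by simp
  moreover have "Polynomial.lead_coeff g = 1" by (simp add: deg cg)
  ultimately show "integral_over_zp x" unfolding integral_over_zp_def by blast
qed

text \<open>The determinant trick: \<open>x\<close> is an eigenvalue of an integral matrix.\<close>

lemma integral_over_zpI_span:
  fixes x :: "'p :: prime_card padic_closure"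
  assumes S: "finite S" "v \<in> S" "v \<noteq> 0" and x: "\<And>s. s \<in> S \<Longrightarrow> x * s \<in> zp_mod.span S"
  shows "integral_over_zp x"
proof -
  have "\<exists>u. x * s = (\<Sum>t\<in>S. zp_embed (u t) * t)" if "s \<in> S" for s
    using x[OF that] unfolding zp_mod.span_finite[OF S(1)] by auto
  then have "\<forall>s\<in>S. \<exists>u. x * s = (\<Sum>t\<in>S. zp_embed (u t) * t)" by blast
  then obtain u where u: "\<forall>s\<in>S. x * s = (\<Sum>t\<in>S. zp_embed (u s t) * t)" by (rule bchoice[THEN exE])
  obtain h where h: "bij_betw h {0..<card S} S" using ex_bij_betw_nat_finite[OF S(1)] by blast
  let ?n = "card S"
  define M where "M = mat ?n ?n (\<lambda>(i, j). u (h i) (h j))"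
  have M: "M \<in> carrier_mat ?n ?n" by (simp add: M_def)
  have "eigenvector (map_mat zp_embed M) (vec ?n h) x"
    unfolding eigenvector_def
  proof (intro conjI)
    show "vec ?n h \<in> carrier_vec (dim_row (map_mat zp_embed M))" using M by simp
    have "v \<in> h ` {0..<?n}" using bij_betw_imp_surj_on[OF h] S(2) by simp
    then obtain i where "i < ?n" "h i = v" by auto
    then show "vec ?n h \<noteq> 0\<^sub>v (dim_row (map_mat zp_embed M))"
      using S(3) M by (auto dest: arg_cong[of _ _ "\<lambda>w. vec_index w i"])
    show "map_mat zp_embed M *\<^sub>v vec ?n h = x \<cdot>\<^sub>v vec ?n h"
    proof (rule eq_vecI)
      fix i assume "i < dim_vec (x \<cdot>\<^sub>v vec ?n h)"
      then have i: "i < ?n" by simp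
      have hi: "h i \<in> S" using h i by (auto dest: bij_betwE)
      have "vec_index (map_mat zp_embed M *\<^sub>v vec ?n h) i = (\<Sum>j = 0..<?n. zp_embed (u (h i) (h j)) * h j)"
        using i M by (simp add: scalar_prod_def M_def)
      also have "\<dots> = (\<Sum>t\<in>S. zp_embed (u (h i) t) * t)"
        by (rule sum.reindex_bij_betw[OF h])
      also have "\<dots> = x * h i" using u hi by simp
      finally show "vec_index (map_mat zp_embed M *\<^sub>v vec ?n h) i = vec_index (x \<cdot>\<^sub>v vec ?n h) i" using i by simp
    qed (use M in simp)
  qed
  then have "poly (char_poly (map_mat zp_embed M)) x = 0"
    using eigenvalue_root_char_poly[of "map_mat zp_embed M" ?n x] M by (auto simp: eigenvalue_def)
  then have "poly (map_poly zp_embed (char_poly M)) x = 0"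
    by (simp add: zp_embed.char_poly_hom[OF M])
  moreover have "Polynomial.lead_coeff (char_poly M) = 1"
    using degree_monic_char_poly[OF M] by simp
  ultimately show ?thesis unfolding integral_over_zp_def by blast
qed

text \<open>Bilinearity, by nested induction over the two spans. Three generating sets are allowed
  so that one statement covers the powers of two integral elements as well as a group of roots of
  unity.\<close>

lemma zp_span_mult:
  fixes x y :: "'p :: prime_card padic_closure"
  assumes "x \<in> zp_mod.span S" "y \<in> zp_mod.span T" "\<And>s t. s \<in> S \<Longrightarrow> t \<in> T \<Longrightarrow> s * t \<in> zp_mod.span U"
  shows "x * y \<in> zp_mod.span U"
  using assms(1)
proof (induction rule: zp_mod.span_induct_alt)
  case base
  then show ?case by (simp add: zp_mod.span_zero)
next
  case (step c s z)
  have "s * y \<in> zp_mod.span U"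
    using assms(2)
  proof (induction rule: zp_mod.span_induct_alt)
    case base
    then show ?case by (simp add: zp_mod.span_zero)
  next
    case (step d t w)
    have "s * (zp_embed d * t + w) = zp_embed d * (s * t) + s * w" by (simp add: algebra_simps)
    then show ?case
      using step assms(3) \<open>s \<in> S\<close> by (simp add: zp_mod.span_add zp_mod.span_scale)
  qed
  moreover have "(zp_embed c * s + z) * y = zp_embed c * (s * y) + z * y" by (simp add: algebra_simps)
  ultimately show ?case using step by (simp add: zp_mod.span_add zp_mod.span_scale)
qed

lemma integral_power_in_span:
  fixes x :: "'p :: prime_card padic_closure"
  assumes "x ^ n = (\<Sum>i<n. zp_embed (c i) * x ^ i)"
  shows "x ^ m \<in> zp_mod.span ((\<lambda>i. x ^ i) ` {..<n})"
proof (induction m rule: less_induct)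
  case (less m)
  show ?case
  proof (cases "m < n")
    case True
    then show ?thesis by (auto intro!: zp_mod.span_base)
  next
    case False
    then have "x ^ m = x ^ (m - n) * x ^ n" by (simp flip: power_add)
    also have "\<dots> = (\<Sum>i<n. zp_embed (c i) * x ^ (m - n + i))"
      unfolding assms by (simp add: sum_distrib_left power_add ac_simps)
    also have "\<dots> \<in> zp_mod.span ((\<lambda>i. x ^ i) ` {..<n})"
      using less False by (intro zp_mod.span_sum zp_mod.span_scale) auto
    finally show ?thesis .
  qed
qed

text \<open>The products \<open>x^i y^j\<close> with \<open>i < n\<close> and \<open>j < m\<close>
  span a finitely generated module that contains \<open>1\<close> and is stable under multiplication
  by \<open>x\<close> and by \<open>y\<close>, so the determinant trick applies to the sum and to
  the product.\<close>

lemma integral_over_zp_ring: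
  fixes x y :: "'p :: prime_card padic_closure"
  assumes "integral_over_zp x" "integral_over_zp y"
  shows "integral_over_zp (x + y)" "integral_over_zp (x * y)"
proof -
  obtain n c where c: "x ^ n = (\<Sum>i<n. zp_embed (c i) * x ^ i)"
    using assms integral_over_zp_relation by blast
  obtain m d where d: "y ^ m = (\<Sum>i<m. zp_embed (d i) * y ^ i)"
    using assms integral_over_zp_relation by blast
  have n0: "n > 0" using c by (cases n) auto
  have m0: "m > 0" using d by (cases m) auto
  define S where "S = (\<lambda>(i, j). x ^ i * y ^ j) ` ({..<n} \<times> {..<m})"
  have fin: "finite S" by (simp add: S_def)
  have "1 \<in> S" unfolding S_def using n0 m0 by (intro image_eqI[of _ _ "(0, 0)"]) auto
  have S: "x ^ i * y ^ j \<in> zp_mod.span S" for i j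
    by (rule zp_span_mult[OF integral_power_in_span[OF c, of i] integral_power_in_span[OF d, of j]])
       (auto simp: S_def intro!: zp_mod.span_base)
  have "(x + y) * s \<in> zp_mod.span S" "(x * y) * s \<in> zp_mod.span S" if s_in: "s \<in> S" for s
  proof -
    obtain ij where "s = (\<lambda>(i, j). x ^ i * y ^ j) ij" using s_in unfolding S_def by blast
    then have s: "s = x ^ fst ij * y ^ snd ij" by (simp add: case_prod_beta)
    have "(x + y) * s = x ^ Suc (fst ij) * y ^ snd ij + x ^ fst ij * y ^ Suc (snd ij)"
      by (simp add: s algebra_simps)
    then show "(x + y) * s \<in> zp_mod.span S" using S zp_mod.span_add by metis
    have "(x * y) * s = x ^ Suc (fst ij) * y ^ Suc (snd ij)" by (simp add: s algebra_simps)
    then show "(x * y) * s \<in> zp_mod.span S" using S by metis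
  qed
  then show "integral_over_zp (x + y)" "integral_over_zp (x * y)"
    using integral_over_zpI_span[OF fin \<open>1 \<in> S\<close>] by auto
qed

lemma integral_over_zp_embed [simp]: "integral_over_zp (zp_embed c)"
  unfolding integral_over_zp_relation by (intro exI[of _ 1] exI[of _ "\<lambda>_. c"]) simp

lemma integral_over_zp_0 [simp]: "integral_over_zp 0"
  and integral_over_zp_1 [simp]: "integral_over_zp 1"
  using integral_over_zp_embed[of 0] integral_over_zp_embed[of 1] by simp_all

lemma integral_over_zp_of_nat [simp]: "integral_over_zp (of_nat n)"
  using integral_over_zp_embed[of "of_nat n"] by simp

lemma integral_over_zp_uminus: "integral_over_zp x \<Longrightarrow> integral_over_zp (- x)"
  using integral_over_zp_ring(2)[OF integral_over_zp_embed[of "- 1"], of x] by (simp add: zp_embed_uminus)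

lemma integral_over_zp_power: "integral_over_zp x \<Longrightarrow> integral_over_zp (x ^ n)"
  by (induction n) (simp_all add: integral_over_zp_ring)

lemma integral_over_zp_sum:
  "(\<And>i. i \<in> I \<Longrightarrow> integral_over_zp (g i)) \<Longrightarrow> integral_over_zp (sum g I)"
  by (induction I rule: infinite_finite_induct) (simp_all add: integral_over_zp_ring)

text \<open>Multiplying an integral relation of degree \<open>n\<close> for \<open>1 / p\<close> by
  \<open>p^n\<close> exhibits \<open>1\<close> as a multiple of \<open>p\<close> in Z_p. This keeps
  \<open>p\<close> a non-unit in every ring of integral elements.\<close>

lemma inverse_prime_not_integral:
  fixes x :: "'p :: prime_card padic_closure"
  assumes "of_nat CARD('p) * x = 1"
  shows "\<not> integral_over_zp x"
proof
  assume "integral_over_zp x"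
  then obtain n c where c: "x ^ n = (\<Sum>i<n. zp_embed (c i) * x ^ i)"
    unfolding integral_over_zp_relation by blast
  let ?p = "of_nat CARD('p) :: 'p padic_int"
  have px: "zp_embed (?p ^ k) * x ^ k = 1" for k
    using assms by (simp only: zp_embed.hom_power zp_embed_of_nat power_mult_distrib[symmetric] power_one)
  have "1 = zp_embed (?p ^ n) * x ^ n" by (simp add: px)
  also have "\<dots> = (\<Sum>i<n. zp_embed (?p ^ (n - i) * c i))"
    unfolding c sum_distrib_left
  proof (rule sum.cong)
    fix i assume "i \<in> {..<n}"
    then have "?p ^ n = ?p ^ (n - i) * ?p ^ i" by (simp flip: power_add)
    then have "zp_embed (?p ^ n) * (zp_embed (c i) * x ^ i) =
        zp_embed (?p ^ (n - i) * c i) * (zp_embed (?p ^ i) * x ^ i)"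
      by (simp add: zp_embed_mult algebra_simps)
    then show "zp_embed (?p ^ n) * (zp_embed (c i) * x ^ i) = zp_embed (?p ^ (n - i) * c i)"
      unfolding px by simp
  qed simp
  also have "\<dots> = zp_embed (\<Sum>i<n. ?p ^ (n - i) * c i)"
    by (simp add: zp_embed.hom_sum)
  finally have "1 = (\<Sum>i<n. ?p ^ (n - i) * c i)"
    using zp_embed.eq_iff zp_embed_1 by metis
  moreover have "?p dvd (\<Sum>i<n. ?p ^ (n - i) * c i)"
    by (intro dvd_sum dvd_mult2 dvd_power) auto
  ultimately show False using padic_int_prime_not_unit by metis
qed

lemma padic_algebraic_relation:
  fixes x :: "'p :: prime_card padic_closure"
  obtains g :: "'p padic_int poly" where "g \<noteq> 0" "poly (map_poly zp_embed g) x = 0"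
proof -
  obtain h :: "'p padic poly" where h: "h \<noteq> 0" "poly (map_poly to_ac h) x = 0"
    using alg_closure_algebraic by blast
  have "\<exists>k z. of_nat CARD('p) ^ k * to_ac (poly.coeff h i) = zp_embed z" for i
    using padic_denominator by metis
  then obtain k z where kz: "\<And>i. of_nat CARD('p) ^ k i * to_ac (poly.coeff h i) = zp_embed (z i)"
    by metis
  let ?n = "Polynomial.degree h"
  define K where "K = (\<Sum>i\<le>?n. k i)"
  define g where "g = (\<Sum>i\<le>?n. Polynomial.monom (of_nat CARD('p) ^ (K - k i) * z i) i)"
  have cg: "zp_embed (poly.coeff g i) = of_nat CARD('p) ^ K * to_ac (poly.coeff h i)" for i
  proof (cases "i \<le> ?n")
    case True
    then have "k i \<le> K" unfolding K_def by (intro member_le_sum) auto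
    have "poly.coeff g i = of_nat CARD('p) ^ (K - k i) * z i"
      using True by (simp add: g_def coeff_sum)
    then have "zp_embed (poly.coeff g i) = of_nat CARD('p) ^ (K - k i) * zp_embed (z i)"
      by (simp add: zp_embed_mult zp_embed.hom_power)
    also have "\<dots> = of_nat CARD('p) ^ K * to_ac (poly.coeff h i)"
      unfolding kz[symmetric] using \<open>k i \<le> K\<close> by (simp flip: mult.assoc power_add)
    finally show ?thesis .
  next
    case False
    then show ?thesis by (simp add: g_def coeff_sum coeff_eq_0)
  qed
  then have "map_poly zp_embed g = Polynomial.smult (of_nat CARD('p) ^ K) (map_poly to_ac h)"
    by (intro poly_eqI) (simp add: coeff_map_poly)
  then have "poly (map_poly zp_embed g) x = 0" using h(2) by simp
  moreover have "g \<noteq> 0"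
  proof
    assume "g = 0"
    then have "to_ac (poly.coeff h ?n) = 0" using cg[of ?n] by simp
    then show False using h(1) by simp
  qed
  ultimately show ?thesis using that by blast
qed

text \<open>Classically, the leading coefficient times \<open>x\<close> is integral. Up to a unit
  that coefficient is a power of \<open>p\<close>.\<close>

lemma integral_multiple:
  fixes x :: "'p :: prime_card padic_closure"
  obtains k where "integral_over_zp (of_nat CARD('p) ^ k * x)"
proof -
  let ?p = "of_nat CARD('p) :: 'p padic_int"
  obtain g :: "'p padic_int poly" where g: "g \<noteq> 0" "poly (map_poly zp_embed g) x = 0"
    using padic_algebraic_relation by blast
  let ?n = "Polynomial.degree g" and ?a = "poly.coeff g"
  have "?a ?n \<noteq> 0" using g(1) by simp
  then obtain k u v where uv: "?a ?n = ?p ^ k * u" "u * v = 1" using padic_int_factor by metis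
  define y where "y = zp_embed (?p ^ k) * x"
  have "0 = (\<Sum>i\<le>?n. zp_embed (?a i) * x ^ i)"
    using g(2) by (subst (asm) poly_altdef) (simp add: coeff_map_poly zp_embed.degree_map_poly_hom)
  also have "\<dots> = (\<Sum>i<?n. zp_embed (?a i) * x ^ i) + zp_embed (?a ?n) * x ^ ?n"
    by (simp add: lessThan_Suc_atMost[symmetric])
  finally have *: "zp_embed (?a ?n) * x ^ ?n = - (\<Sum>i<?n. zp_embed (?a i) * x ^ i)"
    by (simp add: eq_neg_iff_add_eq_0 add.commute)
  show ?thesis
  proof (cases "?n = 0")
    case True
    then show ?thesis using * \<open>?a ?n \<noteq> 0\<close> by simp
  next
    case False
    define q where "q = zp_embed (?p ^ k)"
    \<comment> \<open>The relation for \<open>x\<close> is multiplied by \<open>q^(n - 1)\<close>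
      and by the inverse \<open>v\<close> of the unit part, which turns the leading term into
      \<open>(q x)^n\<close>; the powers of \<open>q\<close> are then distributed over the lower
      terms.\<close>
    have "y ^ ?n = q ^ (?n - 1) * zp_embed v * (zp_embed (?a ?n) * x ^ ?n)"
    proof -
      have "zp_embed v * zp_embed (?a ?n) = q"
        unfolding uv(1) q_def using uv(2) by (simp flip: zp_embed_mult) (metis mult.commute mult.left_commute mult.right_neutral)
      moreover have "y ^ ?n = q ^ (?n - 1) * q * x ^ ?n"
        using False by (simp only: y_def q_def[symmetric] power_mult_distrib power_minus_mult)
      moreover have "q ^ (?n - 1) * zp_embed v * (zp_embed (?a ?n) * x ^ ?n) =
          q ^ (?n - 1) * (zp_embed v * zp_embed (?a ?n)) * x ^ ?n" by (simp only: mult.assoc)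
      ultimately show ?thesis by (simp only:)
    qed
    also have "\<dots> = (\<Sum>i<?n. - (q ^ (?n - 1) * zp_embed v * (zp_embed (?a i) * x ^ i)))"
      unfolding * by (simp only: mult_minus_right sum_distrib_left sum_negf)
    finally have rel: "y ^ ?n = (\<Sum>i<?n. - (q ^ (?n - 1) * zp_embed v * (zp_embed (?a i) * x ^ i)))" .
    have eq: "- (q ^ (?n - 1) * zp_embed v * (zp_embed (?a i) * x ^ i)) =
        zp_embed (- ((?p ^ k) ^ (?n - 1 - i) * v * ?a i)) * y ^ i" if "i < ?n" for i
    proof -
      have "q ^ (?n - 1) = q ^ (?n - 1 - i) * q ^ i" using that by (simp flip: power_add)
      moreover have "y ^ i = q ^ i * x ^ i" by (simp only: y_def q_def power_mult_distrib)
      moreover have "zp_embed (- ((?p ^ k) ^ (?n - 1 - i) * v * ?a i)) =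
          - (q ^ (?n - 1 - i) * zp_embed v * zp_embed (?a i))"
        by (simp only: zp_embed_uminus zp_embed_mult zp_embed.hom_power q_def)
      ultimately show ?thesis by (simp only: mult_minus_left) (simp only: ac_simps)
    qed
    have rel: "y ^ ?n = (\<Sum>i<?n. zp_embed (- ((?p ^ k) ^ (?n - 1 - i) * v * ?a i)) * y ^ i)"
      unfolding rel by (rule sum.cong[OF refl]) (rule eq, simp only: lessThan_iff)
    have "\<exists>c. y ^ ?n = (\<Sum>i<?n. zp_embed (c i) * y ^ i)"
      by (rule exI[of _ "\<lambda>i. - ((?p ^ k) ^ (?n - 1 - i) * v * ?a i)"]) (rule rel)
    then have "integral_over_zp y"
      by (subst integral_over_zp_relation) (rule exI[of _ ?n])
    then show ?thesis using that[of k] by (simp add: y_def zp_embed.hom_power)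
  qed
qed

text \<open>If \<open>x\<close> were non-zero, dividing the constant term of an integral relation for \<open>x\<close> by
  arbitrary powers of \<open>p\<close> would make \<open>1 / p\<close> integral.\<close>

lemma integral_separated:
  fixes x :: "'p :: prime_card padic_closure"
  assumes "\<And>N. \<exists>y. integral_over_zp y \<and> x = of_nat CARD('p) ^ N * y"
  shows "x = 0"
proof (rule ccontr)
  assume x0: "x \<noteq> 0"
  let ?p = "of_nat CARD('p) :: 'p padic_closure"
  obtain g :: "'p padic_int poly" where g: "g \<noteq> 0" "poly (map_poly zp_embed g) x = 0"
    using padic_algebraic_relation by blast
  have "\<exists>h :: 'p padic_int poly. poly.coeff h 0 \<noteq> 0 \<and> poly (map_poly zp_embed h) x = 0"
    using g
  proof (induction "Polynomial.degree g" arbitrary: g rule: less_induct)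
    case less
    show ?case
    proof (cases "poly.coeff g 0 = 0")
      case True
      then obtain h where h: "g = pCons 0 h" by (cases g) auto
      then have "h \<noteq> 0" "poly (map_poly zp_embed h) x = 0"
        using less.prems x0 by (auto simp: zp_embed.map_poly_pCons_hom)
      moreover have "Polynomial.degree h < Polynomial.degree g" using h \<open>h \<noteq> 0\<close> by simp
      ultimately show ?thesis using less.hyps by blast
    qed (use less.prems in blast)
  qed
  then obtain h :: "'p padic_int poly"
    where h0: "poly.coeff h 0 \<noteq> 0" and h: "poly (map_poly zp_embed h) x = 0" by blast
  obtain a g' where hg: "h = pCons a g'" by (cases h) auto
  have a0: "a \<noteq> 0" using h0 hg by simp
  have ax: "zp_embed a = - x * poly (map_poly zp_embed g') x"
    using h hg by (simp add: zp_embed.map_poly_pCons_hom eq_neg_iff_add_eq_0)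
  have intx: "integral_over_zp x" using assms[of 0] by auto
  have intg: "integral_over_zp (poly (map_poly zp_embed g') x)"
    by (subst poly_altdef)
       (auto simp: coeff_map_poly intro!: integral_over_zp_sum integral_over_zp_ring integral_over_zp_power intx)
  obtain k u v where uv: "a = of_nat CARD('p) ^ k * u" "u * v = 1" using padic_int_factor[OF a0] by metis
  obtain y where y: "integral_over_zp y" "x = ?p ^ Suc k * y" using assms by blast
  define w where "w = - (y * poly (map_poly zp_embed g') x * zp_embed v)"
  have "?p ^ k = zp_embed (a * v)"
    using uv by (simp add: mult.assoc zp_embed.hom_power)
  also have "\<dots> = ?p ^ k * (?p * w)"
    unfolding zp_embed_mult ax w_def using y(2) by (simp add: algebra_simps)
  finally have "?p * w = 1" by simp
  moreover have "integral_over_zp w"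
    unfolding w_def by (intro integral_over_zp_uminus integral_over_zp_ring y intg integral_over_zp_embed)
  ultimately show False using inverse_prime_not_integral by blast
qed

text \<open>Completeness of a finitely generated module, coordinate by coordinate. The remainders
  lie in the module again, which is what congruences relative to a subring of the closure
  require.\<close>

lemma zp_span_complete:
  fixes c :: "nat \<Rightarrow> 'p :: prime_card padic_closure"
  assumes S: "finite S" and c: "\<And>k. c k \<in> zp_mod.span S"
  obtains s where "s \<in> zp_mod.span S"
    "\<And>N. \<exists>z \<in> zp_mod.span S. s - (\<Sum>k<N. of_nat CARD('p) ^ k * c k) = of_nat CARD('p) ^ N * z"
proof -
  let ?p = "of_nat CARD('p) :: 'p padic_int"
  have "\<exists>u. c k = (\<Sum>t\<in>S. zp_embed (u t) * t)" for k
    using c[of k] unfolding zp_mod.span_finite[OF S] by auto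
  then have "\<forall>k. \<exists>u. c k = (\<Sum>t\<in>S. zp_embed (u t) * t)" by blast
  then obtain u where u: "\<forall>k. c k = (\<Sum>t\<in>S. zp_embed (u k t) * t)" by (rule choice[THEN exE])
  have "\<exists>s. \<forall>N. \<exists>z. s - (\<Sum>k<N. ?p ^ k * u k t) = ?p ^ N * z" for t
    using padic_int_series_converges[of "\<lambda>k. u k t"] unfolding dvd_def by (simp only:)
  then obtain s z where sz: "\<And>t N. s t - (\<Sum>k<N. ?p ^ k * u k t) = ?p ^ N * z t N" by metis
  show ?thesis
  proof
    show "(\<Sum>t\<in>S. zp_embed (s t) * t) \<in> zp_mod.span S"
      by (intro zp_mod.span_sum zp_mod.span_scale zp_mod.span_base)
    fix N
    have "(\<Sum>k<N. of_nat CARD('p) ^ k * c k) = (\<Sum>t\<in>S. zp_embed (\<Sum>k<N. ?p ^ k * u k t) * t)"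
      unfolding u[rule_format] zp_embed.hom_sum sum_distrib_left sum_distrib_right
      by (subst sum.swap) (simp add: zp_embed_mult zp_embed.hom_power mult.assoc)
    then have "(\<Sum>t\<in>S. zp_embed (s t) * t) - (\<Sum>k<N. of_nat CARD('p) ^ k * c k) =
        (\<Sum>t\<in>S. zp_embed (s t - (\<Sum>k<N. ?p ^ k * u k t)) * t)"
      by (simp add: zp_embed.hom_minus left_diff_distrib sum_subtractf)
    also have "\<dots> = of_nat CARD('p) ^ N * (\<Sum>t\<in>S. zp_embed (z t N) * t)"
      by (simp add: sz zp_embed_mult zp_embed.hom_power sum_distrib_left mult.assoc)
    finally show "\<exists>y \<in> zp_mod.span S. (\<Sum>t\<in>S. zp_embed (s t) * t) - (\<Sum>k<N. of_nat CARD('p) ^ k * c k) =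
        of_nat CARD('p) ^ N * y"
      by (rule bexI) (intro zp_mod.span_sum zp_mod.span_scale zp_mod.span_base)
  qed
qed

section \<open>Roots of unity\<close>

lemma roots_of_unity_iff: "z \<in> roots_of_unity n \<longleftrightarrow> z ^ n = 1"
  by (simp add: roots_of_unity_def)

lemma roots_of_unity_nonzero: "z \<in> roots_of_unity n \<Longrightarrow> n > 0 \<Longrightarrow> z \<noteq> 0"
  by (auto simp: roots_of_unity_iff power_0_left)

text \<open>\<open>X^n - 1\<close> splits over the closure and shares no root with its derivative
  \<open>n X^(n - 1)\<close>, so its \<open>n\<close> roots counted with multiplicity are
  distinct.\<close>

lemma card_roots_of_unity:
  fixes n :: nat
  assumes "n > 0"
  shows "card (roots_of_unity n :: 'p :: prime_card padic_closure set) = n"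
    and "finite (roots_of_unity n :: 'p :: prime_card padic_closure set)"
proof -
  define P :: "'p padic_closure poly" where "P = Polynomial.monom 1 n - 1"
  have cP: "poly.coeff P i = (if i = n then 1 else 0) - (if i = 0 then 1 else 0)" for i
    by (simp add: P_def)
  have dP: "Polynomial.degree P = n"
    by (rule antisym, rule degree_le, use assms in \<open>simp add: cP\<close>, rule le_degree, use assms in \<open>simp add: cP\<close>)
  then have P0: "P \<noteq> 0" using assms by auto
  have evalP: "poly P x = x ^ n - 1" for x by (simp add: P_def poly_monom)
  have roots: "{x. poly P x = 0} = roots_of_unity n"
    by (auto simp: evalP roots_of_unity_def)
  then show fin: "finite (roots_of_unity n :: 'p padic_closure set)"
    using poly_roots_finite[OF P0] by simp
  have "rsquarefree P"
    unfolding rsquarefree_roots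
  proof safe
    fix x assume x: "poly P x = 0" "poly (pderiv P) x = 0"
    have "pderiv P = Polynomial.monom (of_nat n) (n - 1)"
      by (simp add: P_def pderiv_diff pderiv_monom)
    then have "x ^ (n - 1) = 0" using x(2) assms by (simp add: poly_monom)
    then have "x ^ n = 0" using assms by (metis power_minus_mult mult_zero_left)
    then show False using x(1) unfolding evalP by (simp only:) simp
  qed
  then have one: "Polynomial.order x P = 1" if "poly P x = 0" for x
    using that P0 by (rule rsquarefree_root_order)
  obtain A where A: "size A = Polynomial.degree P"
    "P = Polynomial.smult (Polynomial.lead_coeff P) (\<Prod>x\<in>#A. [:- x, 1:])"
    using alg_closed_imp_factorization[OF P0] by blast
  have "Polynomial.lead_coeff P = 1" using assms by (simp add: dP cP)
  then have A2: "P = (\<Prod>x\<in>#A. [:- x, 1:])" using A(2) by simp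
  have "proots (\<Prod>x\<in>#A. [:- x, 1:]) = A"
  proof (induction A)
    case (add x A)
    have "(\<Prod>x\<in>#A. [:- x, 1:]) \<noteq> 0" by (auto simp: prod_mset_zero_iff)
    then have "proots ([:- x, 1:] * (\<Prod>x\<in>#A. [:- x, 1:])) = {#x#} + A"
      using add by (subst proots_mult) auto
    then show ?case by (simp only: image_mset_add_mset prod_mset.add_mset) simp
  qed simp
  then have "proots P = A" using A2 by simp
  then have size: "size (proots P) = n" using A(1) dP by simp
  have "size (proots P) = (\<Sum>x\<in>set_mset (proots P). count (proots P) x)"
    by (simp add: size_multiset_overloaded_eq)
  also have "\<dots> = (\<Sum>x\<in>{x. poly P x = 0}. 1)"
    by (rule sum.cong) (use P0 one in simp_all)
  also have "\<dots> = (\<Sum>x\<in>(roots_of_unity n :: 'p padic_closure set). 1)"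
    by (simp only: roots)
  finally show "card (roots_of_unity n :: 'p padic_closure set) = n" using size by simp
qed

section \<open>Congruences modulo powers of $p$\<close>

text \<open>Any ring between Z_p and the integral elements of the closure. Finite generation is left
  to \<open>zp_order\<close>, because for the integers of a given extension it has to be proved.
  Congruence modulo \<open>p^N\<close> asks for a quotient inside \<open>R\<close>.\<close>

locale zp_ring =
  fixes R :: "'p :: prime_card padic_closure set"
  assumes embed_in: "zp_embed c \<in> R"
    and add_in: "x \<in> R \<Longrightarrow> y \<in> R \<Longrightarrow> x + y \<in> R"
    and mult_in: "x \<in> R \<Longrightarrow> y \<in> R \<Longrightarrow> x * y \<in> R"
    and integral: "x \<in> R \<Longrightarrow> integral_over_zp x"
begin

abbreviation P :: "'p padic_closure" where "P \<equiv> of_nat CARD('p)"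

lemma zero_in [simp]: "0 \<in> R" using embed_in[of 0] by simp
lemma one_in [simp]: "1 \<in> R" using embed_in[of 1] by simp
lemma of_nat_in [simp]: "of_nat n \<in> R" using embed_in[of "of_nat n"] by simp
lemma uminus_in: "x \<in> R \<Longrightarrow> - x \<in> R"
  using mult_in[OF embed_in[of "- 1"], of x] by (simp add: zp_embed_uminus)
lemma diff_in: "x \<in> R \<Longrightarrow> y \<in> R \<Longrightarrow> x - y \<in> R"
  using add_in[OF _ uminus_in, of x y] by simp
lemma power_in: "x \<in> R \<Longrightarrow> x ^ n \<in> R"
  by (induction n) (auto intro: mult_in)
lemma sum_in: "(\<And>i. i \<in> I \<Longrightarrow> g i \<in> R) \<Longrightarrow> sum g I \<in> R"
  by (induction I rule: infinite_finite_induct) (auto intro: add_in)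
lemma prod_in: "(\<And>i. i \<in> I \<Longrightarrow> g i \<in> R) \<Longrightarrow> prod g I \<in> R"
  by (induction I rule: infinite_finite_induct) (auto intro: mult_in)

lemma zp_span_in:
  assumes "x \<in> zp_mod.span S" "S \<subseteq> R"
  shows "x \<in> R"
  using assms(1) by (induction rule: zp_mod.span_induct_alt) (use assms(2) in \<open>auto intro!: add_in mult_in embed_in\<close>)

definition pcong :: "nat \<Rightarrow> 'p padic_closure \<Rightarrow> 'p padic_closure \<Rightarrow> bool" where
  "pcong N x y \<longleftrightarrow> (\<exists>z\<in>R. x - y = P ^ N * z)"

lemma pcongI: "z \<in> R \<Longrightarrow> x - y = P ^ N * z \<Longrightarrow> pcong N x y"
  unfolding pcong_def by blast

lemma pcongE: "pcong N x y \<Longrightarrow> (\<And>z. z \<in> R \<Longrightarrow> x = y + P ^ N * z \<Longrightarrow> thesis) \<Longrightarrow> thesis"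
  unfolding pcong_def by (auto simp: algebra_simps)

lemma pcong_refl [simp]: "pcong N x x"
  by (rule pcongI[of 0]) auto

lemma pcong_sym: "pcong N x y \<Longrightarrow> pcong N y x"
  by (elim pcongE, rule pcongI[OF uminus_in]) auto

lemma pcong_add: "pcong N x y \<Longrightarrow> pcong N x' y' \<Longrightarrow> pcong N (x + x') (y + y')"
  by (elim pcongE, rule pcongI[OF add_in]) (auto simp: algebra_simps)

lemma pcong_trans: "pcong N x y \<Longrightarrow> pcong N y z \<Longrightarrow> pcong N x z"
  using pcong_add[of N x y y z] unfolding pcong_def by (simp add: algebra_simps)

lemma pcong_uminus: "pcong N x y \<Longrightarrow> pcong N (- x) (- y)"
  by (elim pcongE, rule pcongI[OF uminus_in]) auto

lemma pcong_diff: "pcong N x y \<Longrightarrow> pcong N x' y' \<Longrightarrow> pcong N (x - x') (y - y')"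
  using pcong_add[OF _ pcong_uminus, of N x y x' y'] by simp

lemma pcong_mult_left:
  assumes "z \<in> R" "pcong N x y"
  shows "pcong N (z * x) (z * y)"
proof -
  obtain w where "w \<in> R" "x - y = P ^ N * w" using assms(2) unfolding pcong_def by blast
  then show ?thesis
    by (intro pcongI[OF mult_in[OF assms(1)], of w]) (simp_all add: algebra_simps flip: right_diff_distrib)
qed

lemma pcong_mult:
  assumes "pcong N x y" "pcong N x' y'" "y \<in> R" "x' \<in> R"
  shows "pcong N (x * x') (y * y')"
  using pcong_trans[OF pcong_mult_left[OF assms(4,1)] pcong_mult_left[OF assms(3,2), unfolded mult.commute[of y x']]]
  by (simp add: mult.commute)

lemma pcong_power: "pcong N x y \<Longrightarrow> x \<in> R \<Longrightarrow> y \<in> R \<Longrightarrow> pcong N (x ^ n) (y ^ n)"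
  by (induction n) (auto intro!: pcong_mult power_in)

lemma pcong_sum: "(\<And>i. i \<in> I \<Longrightarrow> pcong N (g i) (h i)) \<Longrightarrow> pcong N (sum g I) (sum h I)"
  by (induction I rule: infinite_finite_induct) (auto intro: pcong_add)

lemma pcong_prod:
  "(\<And>i. i \<in> I \<Longrightarrow> pcong N (g i) (h i) \<and> g i \<in> R \<and> h i \<in> R) \<Longrightarrow> pcong N (prod g I) (prod h I)"
  by (induction I rule: infinite_finite_induct) (auto intro!: pcong_mult prod_in)

lemma pcong_mono:
  assumes "pcong N x y" "M \<le> N" shows "pcong M x y"
proof -
  obtain z where z: "z \<in> R" "x - y = P ^ N * z" using assms(1) unfolding pcong_def by blast
  have "P ^ N = P ^ M * P ^ (N - M)" using assms(2) by (simp flip: power_add)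
  then show ?thesis using z by (intro pcongI[of "P ^ (N - M) * z"]) (auto intro!: mult_in power_in)
qed

lemma pcong_multiple: "z \<in> R \<Longrightarrow> pcong 1 (P * z) 0"
  by (rule pcongI[of z]) auto

text \<open>Quotients in \<open>R\<close> are integral, so separatedness of the integral elements of
  the closure applies.\<close>

lemma eq_if_pcong:
  assumes "\<And>N. pcong N x y" shows "x = y"
proof -
  have "x - y = 0"
  proof (rule integral_separated)
    fix N show "\<exists>z. integral_over_zp z \<and> x - y = P ^ N * z"
      using assms[of N] integral unfolding pcong_def by blast
  qed
  then show ?thesis by simp
qed

lemma prime_not_unit: "y \<in> R \<Longrightarrow> P * y \<noteq> 1"
  using inverse_prime_not_integral integral by blast

lemma not_pcong_one_zero: "\<not> pcong 1 1 0"
  using prime_not_unit unfolding pcong_def by auto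

lemma pcong_freshman_prime:
  assumes "x \<in> R" "y \<in> R"
  shows "pcong 1 ((x + y) ^ CARD('p)) (x ^ CARD('p) + y ^ CARD('p))"
proof -
  let ?p = "CARD('p)"
  note p = prime_card[where 'a = 'p]
  have p0: "0 < ?p" using p by (rule prime_gt_0_nat)
  let ?t = "\<lambda>k. of_nat (?p choose k) * x ^ k * y ^ (?p - k)"
  have "(x + y) ^ ?p = (\<Sum>k\<le>?p. ?t k)" by (rule binomial_ring)
  also have "{..?p} = insert 0 (insert ?p {0<..<?p})" using p0 by auto
  also have "(\<Sum>k\<in>insert 0 (insert ?p {0<..<?p}). ?t k) = y ^ ?p + (x ^ ?p + (\<Sum>k\<in>{0<..<?p}. ?t k))"
    using p0 by simp
  finally have eq: "(x + y) ^ ?p = x ^ ?p + y ^ ?p + (\<Sum>k\<in>{0<..<?p}. ?t k)" by simp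
  have "pcong 1 (\<Sum>k\<in>{0<..<?p}. ?t k) (\<Sum>k\<in>{0<..<?p}. 0)"
  proof (rule pcong_sum)
    fix k assume k: "k \<in> {0<..<?p}"
    then have "?p dvd ?p choose k" using p by (intro dvd_choose_prime) auto
    then obtain c where "?p choose k = ?p * c" by (elim dvdE)
    then have "?t k = P * (of_nat c * (x ^ k * y ^ (?p - k)))" by (simp add: mult.assoc)
    moreover have "of_nat c * (x ^ k * y ^ (?p - k)) \<in> R"
      by (intro mult_in power_in assms of_nat_in)
    ultimately show "pcong 1 (?t k) 0" using pcong_multiple by (simp only:)
  qed
  then have "pcong 1 (x ^ ?p + y ^ ?p + (\<Sum>k\<in>{0<..<?p}. ?t k)) (x ^ ?p + y ^ ?p + 0)"
    by (intro pcong_add pcong_refl) simp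
  then show ?thesis unfolding eq by simp
qed

lemma pcong_freshman:
  assumes "x \<in> R" "y \<in> R"
  shows "pcong 1 ((x + y) ^ (CARD('p) ^ m)) (x ^ (CARD('p) ^ m) + y ^ (CARD('p) ^ m))"
proof (induction m)
  case (Suc m)
  let ?r = "CARD('p) ^ m"
  have R: "x ^ ?r \<in> R" "y ^ ?r \<in> R" "(x + y) ^ ?r \<in> R" "x ^ ?r + y ^ ?r \<in> R"
    using assms by (auto intro!: power_in add_in)
  have "pcong 1 (((x + y) ^ ?r) ^ CARD('p)) ((x ^ ?r + y ^ ?r) ^ CARD('p))"
    by (rule pcong_power[OF Suc R(3,4)])
  then have "pcong 1 (((x + y) ^ ?r) ^ CARD('p)) ((x ^ ?r) ^ CARD('p) + (y ^ ?r) ^ CARD('p))"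
    using pcong_freshman_prime[OF R(1,2)] pcong_trans by blast
  then show ?case by (simp add: power_mult[symmetric] mult.commute)
qed simp

lemma pcong_of_nat_frobenius: "pcong 1 (of_nat n ^ (CARD('p) ^ m)) (of_nat n)"
proof (induction n)
  case 0
  then show ?case using prime_gt_0_nat[OF prime_card[where 'a = 'p]] by (simp add: power_0_left)
next
  case (Suc n)
  have "pcong 1 ((1 + of_nat n) ^ (CARD('p) ^ m)) (1 ^ (CARD('p) ^ m) + of_nat n ^ (CARD('p) ^ m))"
    by (rule pcong_freshman) auto
  moreover have "pcong 1 (1 ^ (CARD('p) ^ m) + of_nat n ^ (CARD('p) ^ m)) (1 + of_nat n)"
    using Suc by (intro pcong_add) auto
  ultimately show ?case using pcong_trans unfolding of_nat_Suc by blast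
qed

lemma embed_pcong_of_nat:
  obtains n where "n < CARD('p)" "pcong 1 (zp_embed c) (of_nat n)"
proof -
  obtain n where n: "n < CARD('p)" "of_nat CARD('p) dvd c - of_nat n" using padic_int_residue by blast
  then obtain d where "c - of_nat n = of_nat CARD('p) * d" by (elim dvdE)
  then have "zp_embed (c - of_nat n) = zp_embed (of_nat CARD('p) * d)" by (rule arg_cong)
  then have "zp_embed c - of_nat n = P ^ 1 * zp_embed d"
    by (simp only: zp_embed.hom_minus zp_embed_mult zp_embed_of_nat power_one_right)
  then show ?thesis using that n(1) pcongI[OF embed_in] by blast
qed

lemma pcong_embed_frobenius: "pcong 1 (zp_embed c ^ (CARD('p) ^ m)) (zp_embed c)"
proof -
  obtain n where n: "pcong 1 (zp_embed c) (of_nat n)" using embed_pcong_of_nat by blast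
  have "pcong 1 (zp_embed c ^ (CARD('p) ^ m)) (of_nat n ^ (CARD('p) ^ m))"
    by (rule pcong_power[OF n embed_in of_nat_in])
  then show ?thesis using pcong_of_nat_frobenius[of n m] pcong_sym[OF n] pcong_trans by blast
qed

text \<open>Of the two factors of \<open>x^r - y^r\<close>, one is \<open>x - y\<close> and the
  other is congruent to \<open>r y^(r - 1)\<close>, hence divisible by \<open>p\<close>. The power
  of \<open>p\<close> gained at each step is what makes \<open>x^(r^N)\<close> converge.\<close>

lemma pcong_lift_power:
  assumes "pcong N x y" "x \<in> R" "y \<in> R" "N > 0" "CARD('p) dvd r" "r > 0"
  shows "pcong (Suc N) (x ^ r) (y ^ r)"
proof -
  obtain z where z: "z \<in> R" "x - y = P ^ N * z" using assms(1) unfolding pcong_def by blast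
  let ?s = "\<Sum>i<r. y ^ (r - Suc i) * x ^ i"
  have "pcong 1 ?s (\<Sum>i<r. y ^ (r - 1))"
  proof (rule pcong_sum)
    fix i assume "i \<in> {..<r}"
    then have "r - 1 = r - Suc i + i" by simp
    then have "y ^ (r - 1) = y ^ (r - Suc i) * y ^ i" by (simp only: power_add)
    moreover have "pcong 1 x y" using pcong_mono[OF assms(1)] assms(4) by simp
    ultimately show "pcong 1 (y ^ (r - Suc i) * x ^ i) (y ^ (r - 1))"
      using assms(2,3) by (simp only:) (intro pcong_mult_left pcong_power power_in)
  qed
  moreover have "pcong 1 (\<Sum>i<r. y ^ (r - 1)) 0"
  proof -
    obtain c where "r = CARD('p) * c" using assms(5) by (elim dvdE)
    then have "of_nat r = P * of_nat c" by (simp only: of_nat_mult)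
    then have "(\<Sum>i<r. y ^ (r - 1)) = P * (of_nat c * y ^ (r - 1))"
      by (simp only: sum_constant card_lessThan mult.assoc)
    then show ?thesis
      using pcong_multiple[OF mult_in[OF of_nat_in power_in[OF assms(3)]]] by (simp only:)
  qed
  ultimately have "pcong 1 ?s 0" using pcong_trans by blast
  then obtain w where w: "w \<in> R" "?s = P * w" unfolding pcong_def by auto
  have "x ^ r - y ^ r = (x - y) * ?s" by (rule power_diff_sumr2)
  also have "\<dots> = P ^ Suc N * (z * w)" unfolding z(2) w(2) by (simp add: algebra_simps)
  finally show ?thesis by (rule pcongI[OF mult_in[OF z(1) w(1)]])
qed

end

text \<open>The largest such ring. Incongruence of roots of unity is proved here once and pulled
  back to smaller rings, as congruence in \<open>R\<close> implies congruence here.\<close>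

interpretation integers: zp_ring "{x :: 'p :: prime_card padic_closure. integral_over_zp x}"
  by unfold_locales (auto intro: integral_over_zp_ring)

text \<open>If two roots of unity agree modulo \<open>p\<close>, their quotient \<open>\<eta>\<close> is a non-trivial root of unity
  with $0 = \sum_{i<n} \eta^i \equiv n$.\<close>

lemma roots_of_unity_incongruent:
  fixes w w' :: "'p :: prime_card padic_closure"
  assumes n: "CARD('p) dvd Suc n" "n > 0" and w: "w \<in> roots_of_unity n" "w' \<in> roots_of_unity n"
    and ne: "w \<noteq> w'"
  shows "\<not> integers.pcong 1 w w'"
proof
  assume c: "integers.pcong 1 w w'"
  have int: "integral_over_zp v" if "v \<in> roots_of_unity n" for v :: "'p padic_closure"
  proof -
    have "v ^ n = zp_embed 1 * v ^ 0" using that by (simp add: roots_of_unity_iff)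
    also have "\<dots> = (\<Sum>i<n. zp_embed (if i = 0 then 1 else 0) * v ^ i)"
      using n(2) by (subst sum.remove[of _ 0]) auto
    finally show ?thesis
      unfolding integral_over_zp_relation by (intro exI[of _ n] exI[of _ "\<lambda>i. if i = 0 then 1 else 0"])
  qed
  have w0: "w \<noteq> 0" "w' \<noteq> 0" using w n(2) roots_of_unity_nonzero by auto
  define \<eta> where "\<eta> = w * w' ^ (n - 1)"
  have w'1: "w' * w' ^ (n - 1) = 1" using w(2) n(2) by (simp add: roots_of_unity_iff flip: power_Suc)
  have "\<eta> ^ n = 1"
    using w by (simp add: \<eta>_def roots_of_unity_iff power_mult_distrib)
       (metis mult.commute power_mult power_one)
  moreover have "\<eta> \<noteq> 1"
    using ne w'1 w0 unfolding \<eta>_def by (metis mult_cancel_right mult_zero_right zero_neq_one)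
  ultimately have sum0: "(\<Sum>i<n. \<eta> ^ i) = 0"
    using power_diff_1_eq[of \<eta> n] by simp
  have \<eta>int: "integral_over_zp \<eta>" unfolding \<eta>_def using w int by (simp add: integral_over_zp_ring integral_over_zp_power)
  have "integers.pcong 1 (w' ^ (n - 1) * w) (w' ^ (n - 1) * w')"
    using c w int by (intro integers.pcong_mult_left) (auto simp: integral_over_zp_power)
  then have "integers.pcong 1 \<eta> 1" using w'1 by (simp add: \<eta>_def mult.commute)
  then have "integers.pcong 1 (\<Sum>i<n. \<eta> ^ i) (\<Sum>i<n. 1 ^ i)"
    using \<eta>int by (intro integers.pcong_sum integers.pcong_power) auto
  then have "integers.pcong 1 (0 :: 'p padic_closure) (of_nat n)" by (simp add: sum0)
  \<comment> \<open>Since \<open>p\<close> divides \<open>n + 1\<close>, adding \<open>1\<close>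
    turns the congruence of \<open>0\<close> and \<open>n\<close> into one of \<open>1\<close> and
    \<open>0\<close>.\<close>
  then have "integers.pcong 1 (0 + 1 :: 'p padic_closure) (of_nat n + 1)"
    by (intro integers.pcong_add) auto
  moreover have "integers.pcong 1 (of_nat n + 1 :: 'p padic_closure) 0"
  proof -
    obtain d where "Suc n = CARD('p) * d" using n(1) by (elim dvdE)
    then have "of_nat (Suc n) = (of_nat (CARD('p) * d) :: 'p padic_closure)" by (rule arg_cong)
    then have "(of_nat n + 1 :: 'p padic_closure) = of_nat CARD('p) * of_nat d"
      by (simp only: of_nat_Suc of_nat_mult add.commute)
    then show ?thesis using integers.pcong_multiple[of "of_nat d"] by simp
  qed
  ultimately have "integers.pcong 1 (1 :: 'p padic_closure) 0"
    using integers.pcong_trans by force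
  then show False using integers.not_pcong_one_zero by blast
qed

lemma (in zp_ring) pcong_integers: "pcong N x y \<Longrightarrow> integers.pcong N x y"
  unfolding pcong_def integers.pcong_def using integral by auto

section \<open>Orders with Frobenius congruence\<close>

text \<open>\<open>frobenius\<close> says that the \<open>r\<close>-th power map is the identity on
  residues: the field with \<open>r\<close> elements enters without forming a quotient. The ring
  generated by the roots of unity and the integers of an unramified extension with \<open>r\<close>
  residue classes are both instances, so existence and uniqueness share what follows.\<close>

locale zp_order = zp_ring R for R :: "'p :: prime_card padic_closure set" +
  fixes S :: "'p padic_closure set" and m r :: nat
  assumes finite_generators: "finite S" and span_generators: "R = zp_mod.span S"
    and m_pos: "m > 0" and r_eq: "r = CARD('p) ^ m"
    and frobenius: "x \<in> R \<Longrightarrow> pcong 1 (x ^ r) x"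
begin

lemma r_dvd: "CARD('p) dvd r" using m_pos r_eq by simp

lemma r_gt_1: "r > 1"
  using prime_gt_1_nat[OF prime_card[where 'a = 'p]] m_pos unfolding r_eq by (intro one_less_power)

lemma limit:
  assumes "\<And>k. c k \<in> R"
  obtains s where "s \<in> R" "\<And>N. pcong N s (\<Sum>k<N. P ^ k * c k)"
proof -
  obtain s where s: "s \<in> zp_mod.span S"
    "\<And>N. \<exists>z \<in> zp_mod.span S. s - (\<Sum>k<N. P ^ k * c k) = P ^ N * z"
    using zp_span_complete[OF finite_generators, of c] assms unfolding span_generators by blast
  show ?thesis
  proof (rule that)
    show "s \<in> R" using s(1) span_generators by simp
    fix N show "pcong N s (\<Sum>k<N. P ^ k * c k)"
      using s(2)[of N] by (simp only: pcong_def, simp only: span_generators)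
  qed
qed

lemma unit_if_pcong_1:
  assumes "u \<in> R" "pcong 1 u 1"
  obtains v where "v \<in> R" "u * v = 1"
proof -
  obtain z where z: "z \<in> R" "u = 1 + P * z" using assms(2) by (auto elim: pcongE)
  obtain s where s: "s \<in> R" "\<And>N. pcong N s (\<Sum>k<N. P ^ k * (- z) ^ k)"
    using limit[of "\<lambda>k. (- z) ^ k"] power_in[OF uminus_in[OF z(1)]] by blast
  have "u * s = 1"
  proof (rule eq_if_pcong)
    fix N
    have "(\<Sum>k<N. P ^ k * (- z) ^ k) = (\<Sum>k<N. (1 - u) ^ k)"
      by (simp add: z(2) power_mult_distrib[symmetric])
    moreover have "u * (\<Sum>k<N. (1 - u) ^ k) = 1 - (1 - u) ^ N"
      using one_diff_power_eq[of "1 - u" N] by simp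
    ultimately have eq: "u * (\<Sum>k<N. P ^ k * (- z) ^ k) = 1 - P ^ N * (- z) ^ N"
      by (simp add: z(2) power_mult_distrib[symmetric])
    have "pcong N (1 - P ^ N * (- z) ^ N) 1"
      by (rule pcongI[OF uminus_in[OF power_in[OF uminus_in[OF z(1)], of N]]]) simp
    then show "pcong N (u * s) 1"
      using pcong_mult_left[OF assms(1) s(2)[of N]] unfolding eq using pcong_trans by blast
  qed
  then show ?thesis using that s(1) by blast
qed

text \<open>\<open>w\<close> is the limit of \<open>x^(r^N)\<close>: the \<open>r\<close>-th power
  of \<open>x\<close> is congruent to \<open>x\<close> modulo \<open>p\<close>, and each further
  \<open>r\<close>-th power improves the congruence by one.\<close>

lemma teichmueller:
  assumes x: "x \<in> R"
  obtains w where "w \<in> R" "w ^ r = w" "pcong 1 x w"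
proof -
  have pow: "pcong (Suc N) (x ^ (r ^ Suc N)) (x ^ (r ^ N))" for N
  proof (induction N)
    case 0
    then show ?case using frobenius[OF x] by simp
  next
    case (Suc N)
    have "pcong (Suc (Suc N)) ((x ^ (r ^ Suc N)) ^ r) ((x ^ (r ^ N)) ^ r)"
      using Suc r_dvd r_gt_1 by (intro pcong_lift_power) (auto intro: power_in[OF x])
    then show ?case by (simp only: power_mult[symmetric] power_Suc mult.commute)
  qed
  then have "\<forall>N. \<exists>z\<in>R. x ^ (r ^ Suc N) - x ^ (r ^ N) = P ^ Suc N * z"
    unfolding pcong_def by blast
  then obtain z where z: "\<And>N. z N \<in> R" "\<And>N. x ^ (r ^ Suc N) - x ^ (r ^ N) = P ^ Suc N * z N"
    by metis
  \<comment> \<open>The sequence becomes a series in powers of \<open>p\<close>: first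
    \<open>x\<close>, then the successive differences. The partial sum with \<open>N + 1\<close>
    terms is \<open>x^(r^N)\<close>.\<close>
  define c where "c k = (case k of 0 \<Rightarrow> x | Suc j \<Rightarrow> z j)" for k
  have "c k \<in> R" for k by (cases k) (auto simp: c_def x z)
  then obtain w where w: "w \<in> R" "\<And>N. pcong N w (\<Sum>k<N. P ^ k * c k)" using limit[of c] by blast
  have part: "(\<Sum>k<Suc N. P ^ k * c k) = x ^ (r ^ N)" for N
  proof (induction N)
    case (Suc N)
    have "(\<Sum>k<Suc (Suc N). P ^ k * c k) = x ^ (r ^ N) + P ^ Suc N * c (Suc N)"
      using Suc by (simp only: sum.lessThan_Suc)
    then show ?case using z(2)[of N] by (simp add: c_def algebra_simps)
  qed (simp add: c_def)
  have wN: "pcong (Suc N) w (x ^ (r ^ N))" for N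
    using w(2)[of "Suc N"] unfolding part .
  have "w ^ r = w"
  proof (rule eq_if_pcong)
    fix N
    have "pcong (Suc N) (w ^ r) ((x ^ (r ^ N)) ^ r)"
      by (rule pcong_power[OF wN w(1) power_in[OF x]])
    moreover have "(x ^ (r ^ N)) ^ r = x ^ (r ^ Suc N)"
      by (simp only: power_mult[symmetric] power_Suc mult.commute)
    moreover have "pcong (Suc N) w (x ^ (r ^ Suc N))"
      using pcong_mono[OF wN[of "Suc N"], of "Suc N"] by simp
    ultimately have "pcong (Suc N) (w ^ r) w" using pcong_trans pcong_sym by metis
    then show "pcong N (w ^ r) w" using pcong_mono[of "Suc N" _ _ N] by simp
  qed
  moreover have "pcong 1 x w" using pcong_sym wN[of 0] by simp
  ultimately show ?thesis using that w(1) by blast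
qed

lemma root_of_unity_if_fixed: "w ^ r = w \<Longrightarrow> w \<noteq> 0 \<Longrightarrow> w \<in> roots_of_unity (r - 1)"
  using r_gt_1 power_minus_mult[of r w] by (simp add: roots_of_unity_iff)

text \<open>The Teichmueller representative of a non-zero residue is an \<open>(r - 1)\<close>-th
  root of unity with inverse \<open>w^(r - 2)\<close>. Multiplying by that inverse brings
  \<open>x\<close> into the class of \<open>1\<close>, where the geometric series inverts.\<close>

lemma residue_unit:
  assumes "x \<in> R" "\<not> pcong 1 x 0"
  obtains v where "v \<in> R" "x * v = 1"
proof -
  obtain w where w: "w \<in> R" "w ^ r = w" "pcong 1 x w" using teichmueller[OF assms(1)] by blast
  then have "w \<noteq> 0" using assms(2) by auto
  then have "w ^ (r - 1) = 1" using root_of_unity_if_fixed[OF w(2)] by (simp add: roots_of_unity_iff)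
  then have ww: "w ^ (r - 2) * w = 1"
    using r_gt_1 by (metis One_nat_def Suc_diff_Suc numeral_2_eq_2 power_Suc2)
  have wR: "w ^ (r - 2) \<in> R" by (rule power_in[OF w(1)])
  have "pcong 1 (w ^ (r - 2) * x) 1" using pcong_mult_left[OF wR w(3)] ww by simp
  then obtain v where "v \<in> R" "w ^ (r - 2) * x * v = 1"
    using unit_if_pcong_1 mult_in[OF wR assms(1)] by metis
  then show ?thesis using that[of "w ^ (r - 2) * v"] mult_in[OF wR] by (simp add: ac_simps)
qed

lemma unit_iff:
  assumes "x \<in> R"
  shows "(\<exists>v\<in>R. x * v = 1) \<longleftrightarrow> \<not> pcong 1 x 0"
proof
  assume "\<exists>v\<in>R. x * v = 1"
  then obtain v where v: "v \<in> R" "x * v = 1" by blast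
  show "\<not> pcong 1 x 0"
  proof
    assume "pcong 1 x 0"
    then have "pcong 1 (v * x) (v * 0)" by (rule pcong_mult_left[OF v(1)])
    then show False using v(2) not_pcong_one_zero by (simp add: mult.commute)
  qed
next
  assume "\<not> pcong 1 x 0"
  then show "\<exists>v\<in>R. x * v = 1" using residue_unit[OF assms] by metis
qed

text \<open>This makes \<open>p\<close> a uniformizer of \<open>R\<close>. The exponent exists by
  separatedness, and the cofactor is a unit because its residue is non-zero.\<close>

lemma factor:
  assumes "x \<in> R" "x \<noteq> 0"
  obtains k y v where "x = P ^ k * y" "y \<in> R" "v \<in> R" "y * v = 1"
proof -
  have ex: "\<exists>N. \<not> pcong N x 0" using eq_if_pcong[of x 0] assms(2) by blast
  define N where "N = (LEAST N. \<not> pcong N x 0)"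
  have N: "\<not> pcong N x 0" unfolding N_def by (rule LeastI_ex[OF ex])
  have "pcong 0 x 0" by (rule pcongI[OF assms(1)]) simp
  then obtain k where k: "N = Suc k" using N by (cases N) auto
  have "pcong k x 0" using not_less_Least[of k "\<lambda>N. \<not> pcong N x 0"] k N_def by auto
  then obtain y where y: "y \<in> R" "x = P ^ k * y" by (auto elim: pcongE)
  have "\<not> pcong 1 y 0"
  proof
    assume "pcong 1 y 0"
    then obtain z where "z \<in> R" "y = P * z" by (auto elim: pcongE)
    then have "pcong N x 0" using y(2) k by (intro pcongI[of z]) auto
    then show False using N by blast
  qed
  then show ?thesis using residue_unit[OF y(1)] y that by metis
qed

end

text \<open>Successive approximation: a finitely generated submodule that meets every residue class is
  the whole ring.\<close>

lemma (in zp_ring) span_if_residues: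
  assumes T: "finite T" "T \<subseteq> R" and res: "\<And>x. x \<in> R \<Longrightarrow> \<exists>t\<in>zp_mod.span T. pcong 1 x t"
  shows "R = zp_mod.span T"
proof
  show "zp_mod.span T \<subseteq> R" using zp_span_in T(2) by blast
  show "R \<subseteq> zp_mod.span T"
  proof
    fix x assume x: "x \<in> R"
    have "\<forall>x\<in>R. \<exists>y. fst y \<in> zp_mod.span T \<and> snd y \<in> R \<and> x = fst y + P * snd y"
    proof
      fix x assume "x \<in> R"
      then obtain t where "t \<in> zp_mod.span T" "pcong 1 x t" using res by blast
      then show "\<exists>y. fst y \<in> zp_mod.span T \<and> snd y \<in> R \<and> x = fst y + P * snd y"
        by (auto elim!: pcongE)
    qed
    then obtain h where h: "\<forall>x\<in>R. fst (h x) \<in> zp_mod.span T \<and> snd (h x) \<in> R \<and> x = fst (h x) + P * snd (h x)"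
      by (rule bchoice[THEN exE])
    define rem where "rem = rec_nat x (\<lambda>_ y. snd (h y))"
    have rem_in: "rem k \<in> R" for k by (induction k) (use x h in \<open>auto simp: rem_def\<close>)
    have rem_step: "rem k = fst (h (rem k)) + P * rem (Suc k)" for k
    proof -
      have "rem (Suc k) = snd (h (rem k))" by (simp add: rem_def)
      then show ?thesis using h rem_in[of k] by simp
    qed
    have exp: "x = (\<Sum>k<N. P ^ k * fst (h (rem k))) + P ^ N * rem N" for N
    proof (induction N)
      case (Suc N)
      have "P ^ N * rem N = P ^ N * fst (h (rem N)) + P ^ Suc N * rem (Suc N)"
        using arg_cong[OF rem_step[of N], of "\<lambda>v. P ^ N * v"]
        by (simp only: distrib_left power_Suc2 mult.assoc)
      then show ?case using Suc by (simp add: add.assoc)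
    qed (simp add: rem_def)
    have "fst (h (rem k)) \<in> zp_mod.span T" for k using h rem_in by blast
    then obtain s where s: "s \<in> zp_mod.span T"
      "\<And>N. \<exists>z \<in> zp_mod.span T. s - (\<Sum>k<N. P ^ k * fst (h (rem k))) = P ^ N * z"
      using zp_span_complete[OF T(1), of "\<lambda>k. fst (h (rem k))"] by blast
    have "x = s"
    proof (rule eq_if_pcong)
      fix N
      obtain z where z: "z \<in> zp_mod.span T" "s - (\<Sum>k<N. P ^ k * fst (h (rem k))) = P ^ N * z"
        using s(2) by blast
      have "x - s = P ^ N * rem N - P ^ N * z"
        using exp[of N] z(2) by (simp add: algebra_simps)
      then have "x - s = P ^ N * (rem N - z)" by (simp only: right_diff_distrib)
      moreover have "rem N - z \<in> R" by (rule diff_in[OF rem_in zp_span_in[OF z(1) T(2)]])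
      ultimately show "pcong N x s" by (intro pcongI)
    qed
    then show "x \<in> zp_mod.span T" using s(1) by simp
  qed
qed

section \<open>The ring generated by the roots of unity\<close>

text \<open>The roots of unity are closed under multiplication, so their Z_p-span is already the
  ring they generate.\<close>

definition mu_ring :: "nat \<Rightarrow> 'p :: prime_card padic_closure set" where
  "mu_ring m = zp_mod.span (roots_of_unity (CARD('p) ^ m - 1))"

definition mu_field :: "nat \<Rightarrow> 'p :: prime_card padic_closure set" where
  "mu_field m = padic_vs.span (roots_of_unity (CARD('p) ^ m - 1))"

lemma CARD_power_minus_1_pos: "m > 0 \<Longrightarrow> CARD('p :: prime_card) ^ m - 1 > 0"
  using prime_gt_1_nat[OF prime_card[where 'a = 'p]] one_less_power[of "CARD('p)" m] by simp

lemma roots_of_unity_integral: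
  assumes "n > 0" "w \<in> roots_of_unity n"
  shows "integral_over_zp w"
proof -
  have "w ^ n = zp_embed 1 * w ^ 0" using assms(2) by (simp add: roots_of_unity_iff)
  also have "\<dots> = (\<Sum>i<n. zp_embed (if i = 0 then 1 else 0) * w ^ i)"
    using assms(1) by (subst sum.remove[of _ 0]) auto
  finally show ?thesis
    unfolding integral_over_zp_relation by (intro exI[of _ n] exI[of _ "\<lambda>i. if i = 0 then 1 else 0"])
qed

lemma roots_of_unity_mult:
  "x \<in> roots_of_unity n \<Longrightarrow> y \<in> roots_of_unity n \<Longrightarrow> x * y \<in> roots_of_unity n"
  by (simp add: roots_of_unity_iff power_mult_distrib)

lemma roots_of_unity_1: "1 \<in> roots_of_unity n"
  by (simp add: roots_of_unity_iff)

lemma roots_of_unity_power: "x \<in> roots_of_unity n \<Longrightarrow> x ^ k \<in> roots_of_unity n"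
  by (induction k) (simp_all add: roots_of_unity_1 roots_of_unity_mult)

lemma mu_ring_zp_ring:
  assumes "m > 0"
  shows "zp_ring (mu_ring m :: 'p :: prime_card padic_closure set)"
proof
  let ?mu = "roots_of_unity (CARD('p) ^ m - 1) :: 'p padic_closure set"
  fix c and x y :: "'p padic_closure"
  have "zp_embed c * 1 \<in> zp_mod.span ?mu"
    by (intro zp_mod.span_scale zp_mod.span_base roots_of_unity_1)
  then show "zp_embed c \<in> mu_ring m" by (simp add: mu_ring_def)
  assume x: "x \<in> mu_ring m"
  show "integral_over_zp x"
    using integers.zp_span_in[OF x[unfolded mu_ring_def]] roots_of_unity_integral
      CARD_power_minus_1_pos[OF assms, where 'p = 'p] by blast
  assume y: "y \<in> mu_ring m"
  show "x + y \<in> mu_ring m" using x y unfolding mu_ring_def by (rule zp_mod.span_add)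
  show "x * y \<in> mu_ring m"
    using zp_span_mult[OF x[unfolded mu_ring_def] y[unfolded mu_ring_def]]
      zp_mod.span_base roots_of_unity_mult unfolding mu_ring_def by blast
qed

lemma roots_of_unity_frobenius:
  assumes "m > 0" "(w :: 'p :: prime_card padic_closure) \<in> roots_of_unity (CARD('p) ^ m - 1)"
  shows "w ^ (CARD('p) ^ m) = w"
proof -
  have "w ^ (CARD('p) ^ m - 1) * w = w ^ (CARD('p) ^ m)"
    by (rule power_minus_mult) (use CARD_power_minus_1_pos[OF assms(1), where 'p = 'p] in simp)
  moreover have "w ^ (CARD('p) ^ m - 1) = 1" using assms(2) by (simp only: roots_of_unity_iff)
  ultimately show ?thesis by (simp only: mult_1)
qed

text \<open>The Frobenius congruence holds with equality on the generators and by Fermat on Z_p;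
  additivity of \<open>p\<close>-power maps modulo \<open>p\<close> extends it to the span.\<close>

lemma mu_ring_zp_order:
  assumes "m > 0"
  shows "zp_order (mu_ring m :: 'p :: prime_card padic_closure set) (roots_of_unity (CARD('p) ^ m - 1))
    m (CARD('p) ^ m)"
proof -
  interpret zp_ring "mu_ring m :: 'p padic_closure set" by (rule mu_ring_zp_ring[OF assms])
  let ?mu = "roots_of_unity (CARD('p) ^ m - 1) :: 'p padic_closure set"
  let ?r = "CARD('p) ^ m"
  show ?thesis
  proof
    show "finite ?mu" by (rule card_roots_of_unity(2)[OF CARD_power_minus_1_pos[OF assms]])
    show "mu_ring m = zp_mod.span ?mu" by (rule mu_ring_def)
    show "m > 0" "CARD('p) ^ m = CARD('p) ^ m" by (rule assms, rule refl)
    fix x :: "'p padic_closure" assume "x \<in> mu_ring m"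
    then have "x \<in> zp_mod.span ?mu" by (simp add: mu_ring_def)
    then have "x \<in> mu_ring m \<and> pcong 1 (x ^ ?r) x"
    proof (induction rule: zp_mod.span_induct_alt)
      case base
      have "(0 :: 'p padic_closure) ^ ?r = 0"
        using CARD_power_minus_1_pos[OF assms, where 'p = 'p] by (intro zero_power) simp
      then show ?case by (simp only: pcong_refl zero_in)
    next
      case (step c s z)
      have s: "s \<in> mu_ring m" unfolding mu_ring_def by (rule zp_mod.span_base[OF step.hyps(1)])
      have z: "z \<in> mu_ring m" using step.IH by blast
      have cs: "zp_embed c * s \<in> mu_ring m" by (rule mult_in[OF embed_in s])
      have "(zp_embed c * s) ^ ?r = s * zp_embed c ^ ?r"
        using roots_of_unity_frobenius[OF assms step.hyps(1)] by (simp add: power_mult_distrib)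
      moreover have "pcong 1 (s * zp_embed c ^ ?r) (s * zp_embed c)"
        by (rule pcong_mult_left[OF s pcong_embed_frobenius])
      ultimately have "pcong 1 ((zp_embed c * s) ^ ?r) (zp_embed c * s)" by (simp add: mult.commute)
      then have "pcong 1 ((zp_embed c * s) ^ ?r + z ^ ?r) (zp_embed c * s + z)"
        using step.IH by (intro pcong_add) blast+
      then show ?case using pcong_freshman[OF cs z] pcong_trans add_in[OF cs z] by blast
    qed
    then show "pcong 1 (x ^ ?r) x" ..
  qed
qed

section \<open>Unramified extensions\<close>

lemma to_ac_Fract_1 [simp]: "to_ac (Fract c 1) = zp_embed c"
  by (simp add: zp_embed_def)

lemma zp_span_subset_padic_span: "zp_mod.span S \<subseteq> padic_vs.span S"
proof
  fix x :: "'a padic_closure" assume "x \<in> zp_mod.span S"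
  then show "x \<in> padic_vs.span S"
  proof (induction rule: zp_mod.span_induct_alt)
    case base
    then show ?case by (rule padic_vs.span_zero)
  next
    case (step c s z)
    have "to_ac (Fract c 1) * s \<in> padic_vs.span S"
      by (rule padic_vs.span_scale[OF padic_vs.span_base[OF step.hyps(1)]])
    then show ?case using step.IH by (simp add: padic_vs.span_add)
  qed
qed

lemma to_ac_inverse_p_power:
  "to_ac (inverse (of_nat CARD('p) ^ k)) * (of_nat CARD('p) ^ k * x) = (x :: 'p :: prime_card padic_closure)"
proof -
  have "inverse (of_nat CARD('p) ^ k) * (of_nat CARD('p) ^ k * x) = x"
    by (subst mult.assoc[symmetric]) simp
  then show ?thesis by (simp only: to_ac_inverse to_ac_power to_ac_of_nat)
qed

lemma padic_span_iff:
  fixes x :: "'p :: prime_card padic_closure"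
  shows "x \<in> padic_vs.span S \<longleftrightarrow> (\<exists>k. of_nat CARD('p) ^ k * x \<in> zp_mod.span S)"
proof
  assume "x \<in> padic_vs.span S"
  then show "\<exists>k. of_nat CARD('p) ^ k * x \<in> zp_mod.span S"
  proof (induction rule: padic_vs.span_induct_alt)
    case base
    have "of_nat CARD('p) ^ 0 * (0 :: 'p padic_closure) \<in> zp_mod.span S"
      by (simp add: zp_mod.span_zero)
    then show ?case by blast
  next
    case (step c s z)
    obtain k where k: "of_nat CARD('p) ^ k * z \<in> zp_mod.span S" using step.IH by blast
    obtain j e where e: "of_nat CARD('p) ^ j * to_ac c = zp_embed e" using padic_denominator by blast
    have "of_nat CARD('p) ^ (j + k) * (to_ac c * s + z) =
        zp_embed (of_nat CARD('p) ^ k * e) * s + zp_embed (of_nat CARD('p) ^ j) * (of_nat CARD('p) ^ k * z)"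
      unfolding zp_embed_mult e[symmetric] zp_embed.hom_power zp_embed_of_nat
      by (simp only: power_add distrib_left ac_simps)
    also have "\<dots> \<in> zp_mod.span S"
      by (intro zp_mod.span_add zp_mod.span_scale k zp_mod.span_base step.hyps)
    finally show ?case by blast
  qed
next
  assume "\<exists>k. of_nat CARD('p) ^ k * x \<in> zp_mod.span S"
  then obtain k where k: "of_nat CARD('p) ^ k * x \<in> zp_mod.span S" by blast
  then have "of_nat CARD('p) ^ k * x \<in> padic_vs.span S" using zp_span_subset_padic_span by blast
  then have "to_ac (inverse (of_nat CARD('p) ^ k)) * (of_nat CARD('p) ^ k * x) \<in> padic_vs.span S"
    by (rule padic_vs.span_scale)
  then show "x \<in> padic_vs.span S" unfolding to_ac_inverse_p_power .
qed

lemma mu_field_iff: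
  "(x :: 'p :: prime_card padic_closure) \<in> mu_field m \<longleftrightarrow> (\<exists>k. of_nat CARD('p) ^ k * x \<in> mu_ring m)"
  unfolding mu_field_def mu_ring_def by (rule padic_span_iff)

lemma mu_field_finite_extension:
  assumes "m > 0"
  shows "finite_extension (mu_field m :: 'p :: prime_card padic_closure set)"
proof -
  interpret zp_order "mu_ring m :: 'p padic_closure set" "roots_of_unity (CARD('p) ^ m - 1)" m "CARD('p) ^ m"
    by (rule mu_ring_zp_order[OF assms])
  let ?K = "mu_field m :: 'p padic_closure set"
  have "to_ac c * 1 \<in> ?K" for c
    unfolding mu_field_def by (intro padic_vs.span_scale padic_vs.span_base roots_of_unity_1)
  then have "range to_ac \<subseteq> ?K" by auto
  moreover have "x + y \<in> ?K" if "x \<in> ?K" "y \<in> ?K" for x y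
    using that unfolding mu_field_def by (rule padic_vs.span_add)
  moreover have "x * y \<in> ?K" if "x \<in> ?K" "y \<in> ?K" for x y
  proof -
    obtain k j where "P ^ k * x \<in> mu_ring m" "P ^ j * y \<in> mu_ring m" using \<open>x \<in> ?K\<close> \<open>y \<in> ?K\<close> mu_field_iff by blast
    then have "(P ^ k * x) * (P ^ j * y) \<in> mu_ring m" by (rule mult_in)
    then have "P ^ (k + j) * (x * y) \<in> mu_ring m" by (simp only: power_add ac_simps)
    then show ?thesis using mu_field_iff by blast
  qed
  moreover have "- x \<in> ?K" if "x \<in> ?K" for x
    using that unfolding mu_field_def by (rule padic_vs.span_neg)
  \<comment> \<open>Here \<open>p^k x\<close> equals \<open>p^j y\<close> with
    \<open>y v = 1\<close>, so \<open>p^k v\<close> is \<open>p^j\<close> times the inverse of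
    \<open>x\<close>.\<close>
  moreover have "inverse x \<in> ?K" if x_in: "x \<in> ?K" for x
  proof (cases "x = 0")
    case False
    obtain k where k: "P ^ k * x \<in> mu_ring m" using x_in mu_field_iff by blast
    have "P ^ k * x \<noteq> 0" using False by simp
    from factor[OF k this] obtain j y v where jy: "P ^ k * x = P ^ j * y" "v \<in> mu_ring m" "y * v = 1" .
    have "x * (P ^ k * v) = P ^ k * x * v" by (simp only: ac_simps)
    also have "\<dots> = P ^ j" unfolding jy(1) using jy(3) by (simp add: mult.assoc)
    finally have eq: "x * (P ^ k * v) = P ^ j" .
    have "P ^ k * v = inverse x * (x * (P ^ k * v))" using False by simp
    also have "\<dots> = P ^ j * inverse x" unfolding eq by (rule mult.commute)
    finally have "P ^ k * v = P ^ j * inverse x" .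
    moreover have "P ^ k * v \<in> mu_ring m" by (intro mult_in power_in of_nat_in jy)
    ultimately have "P ^ j * inverse x \<in> mu_ring m" by (simp only:)
    then show ?thesis using mu_field_iff by blast
  qed (use x_in in simp)
  moreover have "\<exists>B. finite B \<and> padic_vs.span B = ?K"
    by (rule exI, rule conjI[OF finite_generators]) (rule mu_field_def[symmetric])
  ultimately show ?thesis unfolding finite_extension_def by (intro conjI ballI) simp_all
qed

text \<open>For integral \<open>x\<close> in the field some \<open>p^k x\<close> lies in the ring,
  and factors \<open>p\<close> are removed one at a time: were \<open>p^(k + 1) x\<close> not
  divisible by \<open>p\<close> in the ring, it would be a unit there and \<open>1 / p\<close> would
  be integral.\<close>

lemma ring_of_integers_mu_field:
  assumes "m > 0"
  shows "ring_of_integers (mu_field m :: 'p :: prime_card padic_closure set) = mu_ring m"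
proof -
  interpret zp_order "mu_ring m :: 'p padic_closure set" "roots_of_unity (CARD('p) ^ m - 1)" m "CARD('p) ^ m"
    by (rule mu_ring_zp_order[OF assms])
  show ?thesis
  proof safe
    fix x :: "'p padic_closure" assume "x \<in> mu_ring m"
    then show "x \<in> ring_of_integers (mu_field m)"
      unfolding ring_of_integers_def
      using integral zp_span_subset_padic_span mu_field_def mu_ring_def by blast
  next
    fix x :: "'p padic_closure" assume x: "x \<in> ring_of_integers (mu_field m)"
    then obtain k where k: "P ^ k * x \<in> mu_ring m" "integral_over_zp x"
      unfolding ring_of_integers_def using mu_field_iff by blast
    then show "x \<in> mu_ring m"
    proof (induction k)
      case (Suc k)
      show ?case
      proof (cases "pcong 1 (P ^ Suc k * x) 0")
        case True
        then obtain z where "z \<in> mu_ring m" "P ^ Suc k * x = P * z" by (auto elim: pcongE)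
        then have "P ^ k * x \<in> mu_ring m" by simp
        then show ?thesis using Suc by blast
      next
        case False
        then obtain v where v: "v \<in> mu_ring m" "P ^ Suc k * x * v = 1" using residue_unit Suc.prems(1) by blast
        then have "P * (P ^ k * (x * v)) = 1" by (simp add: mult.assoc)
        moreover have "integral_over_zp (P ^ k * (x * v))"
          by (intro integral_over_zp_ring integral_over_zp_power integral_over_zp_of_nat Suc.prems(2) integral v(1))
        ultimately show ?thesis using inverse_prime_not_integral by blast
      qed
    qed simp
  qed
qed

lemma card_quotient_representatives:
  assumes E: "equiv A E" and T: "T \<subseteq> A" and rep: "\<And>x. x \<in> A \<Longrightarrow> \<exists>t\<in>T. (x, t) \<in> E"
    and inj: "\<And>s t. s \<in> T \<Longrightarrow> t \<in> T \<Longrightarrow> (s, t) \<in> E \<Longrightarrow> s = t"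
  shows "card (A // E) = card T"
proof -
  have "A // E = (\<lambda>t. E `` {t}) ` T"
  proof safe
    fix C assume "C \<in> A // E"
    then obtain x where x: "x \<in> A" "C = E `` {x}" by (auto elim: quotientE)
    then obtain t where t: "t \<in> T" "(x, t) \<in> E" using rep by blast
    then show "C \<in> (\<lambda>t. E `` {t}) ` T" using x equiv_class_eq[OF E t(2)] by auto
  next
    fix t assume "t \<in> T"
    then show "E `` {t} \<in> A // E" using T by (auto intro: quotientI)
  qed
  moreover have "inj_on (\<lambda>t. E `` {t}) T"
    using inj eq_equiv_class[OF _ E] T by (auto intro!: inj_onI)
  ultimately show ?thesis by (simp add: card_image)
qed

lemma (in zp_ring) pcong_equiv: "equiv R {(x, y). x \<in> R \<and> y \<in> R \<and> pcong N x y}"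
proof (rule equivI)
  show "sym {(x, y). x \<in> R \<and> y \<in> R \<and> pcong N x y}" using pcong_sym by (auto intro!: symI)
  show "trans {(x, y). x \<in> R \<and> y \<in> R \<and> pcong N x y}"
    by (rule transI) (use pcong_trans in blast)
qed (auto simp: refl_on_def)

lemma (in zp_ring) residue_classes:
  assumes R: "ring_of_integers K = R" and M: "integers_max_ideal K = (\<lambda>x. P * x) ` R"
  shows "residue_field K = R // {(x, y). x \<in> R \<and> y \<in> R \<and> pcong 1 x y}"
proof -
  have "(x - y \<in> (\<lambda>x. P * x) ` R) \<longleftrightarrow> pcong 1 x y" for x y
    unfolding pcong_def by auto
  then show ?thesis unfolding residue_field_def R M by simp
qed

lemma mu_field_max_ideal:
  assumes "m > 0"
  shows "integers_max_ideal (mu_field m :: 'p :: prime_card padic_closure set) =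
    (\<lambda>x. of_nat CARD('p) * x) ` mu_ring m"
proof -
  interpret zp_order "mu_ring m :: 'p padic_closure set" "roots_of_unity (CARD('p) ^ m - 1)" m "CARD('p) ^ m"
    by (rule mu_ring_zp_order[OF assms])
  have "integers_max_ideal (mu_field m :: 'p padic_closure set) =
      {x \<in> mu_ring m. \<not> (\<exists>y\<in>mu_ring m. x * y = 1)}"
    unfolding integers_max_ideal_def ring_of_integers_mu_field[OF assms] by simp
  also have "\<dots> = {x \<in> mu_ring m. pcong 1 x 0}" using unit_iff by blast
  also have "\<dots> = (\<lambda>x. of_nat CARD('p) * x) ` mu_ring m"
    unfolding pcong_def using mult_in[OF of_nat_in] by auto
  finally show ?thesis .
qed

lemma card_insert_0_roots_of_unity:
  assumes "m > 0"
  shows "card (insert 0 (roots_of_unity (CARD('p) ^ m - 1)) :: 'p :: prime_card padic_closure set) = CARD('p) ^ m"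
proof -
  have n: "CARD('p) ^ m - 1 > 0" by (rule CARD_power_minus_1_pos[OF assms])
  have "(0 :: 'p padic_closure) \<notin> roots_of_unity (CARD('p) ^ m - 1)"
    using roots_of_unity_nonzero n by blast
  then show ?thesis
    using card_roots_of_unity[OF n, where 'p = 'p] n by (simp add: card_insert_disjoint)
qed

text \<open>\<open>0\<close> and the roots of unity form a complete system of representatives:
  Teichmueller lifting reaches every class, roots of unity are units, and distinct ones are
  incongruent modulo \<open>p\<close>.\<close>

lemma mu_field_residue_card:
  assumes "m > 0"
  shows "card (residue_field (mu_field m :: 'p :: prime_card padic_closure set)) = CARD('p) ^ m"
proof -
  interpret zp_order "mu_ring m :: 'p padic_closure set" "roots_of_unity (CARD('p) ^ m - 1)" m "CARD('p) ^ m"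
    by (rule mu_ring_zp_order[OF assms])
  let ?mu = "roots_of_unity (CARD('p) ^ m - 1) :: 'p padic_closure set"
  have n: "CARD('p) ^ m - 1 > 0" by (rule CARD_power_minus_1_pos[OF assms])
  have mu_in: "?mu \<subseteq> mu_ring m" unfolding mu_ring_def by (rule zp_mod.span_superset)
  have mu_unit: "\<not> pcong 1 w 0" if "w \<in> ?mu" for w
  proof -
    have "w * w ^ (CARD('p) ^ m - 1 - 1) = 1"
      using that n by (simp only: roots_of_unity_iff power_Suc[symmetric] Suc_diff_1)
    then show ?thesis using unit_iff that mu_in power_in by blast
  qed
  have "card (mu_ring m // {(x, y). x \<in> mu_ring m \<and> y \<in> mu_ring m \<and> pcong 1 x y}) = card (insert 0 ?mu)"
  proof (rule card_quotient_representatives[OF pcong_equiv])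
    show "insert 0 ?mu \<subseteq> mu_ring m" using mu_in by simp
  next
    fix x :: "'p padic_closure" assume x: "x \<in> mu_ring m"
    obtain w where w: "w \<in> mu_ring m" "w ^ (CARD('p) ^ m) = w" "pcong 1 x w" using teichmueller[OF x] by blast
    then have "w \<in> insert 0 ?mu" using root_of_unity_if_fixed by blast
    then show "\<exists>t\<in>insert 0 ?mu. (x, t) \<in> {(x, y). x \<in> mu_ring m \<and> y \<in> mu_ring m \<and> pcong 1 x y}"
      using w x by blast
  next
    fix s t :: "'p padic_closure" assume st: "s \<in> insert 0 ?mu" "t \<in> insert 0 ?mu"
      "(s, t) \<in> {(x, y). x \<in> mu_ring m \<and> y \<in> mu_ring m \<and> pcong 1 x y}"
    then have c: "pcong 1 s t" by blast
    show "s = t"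
    proof (cases "s = 0 \<or> t = 0")
      case True
      then show ?thesis using st c mu_unit pcong_sym by blast
    next
      case False
      have "CARD('p) dvd Suc (CARD('p) ^ m - 1)" using n r_dvd by simp
      then show ?thesis
        using roots_of_unity_incongruent[OF _ n] pcong_integers[OF c] st False by blast
    qed
  qed
  then show ?thesis
    using residue_classes[OF ring_of_integers_mu_field[OF assms] mu_field_max_ideal[OF assms]]
      card_insert_0_roots_of_unity[OF assms, where 'p = 'p] by simp
qed

lemma mu_field_unramified: "m > 0 \<Longrightarrow> unramified (mu_field m)"
  unfolding unramified_def
  by (intro conjI mu_field_finite_extension) (simp_all only: mu_field_max_ideal ring_of_integers_mu_field)

section \<open>Uniqueness of the unramified extension with a given residue field\<close>

lemma finite_extension_add:
  "finite_extension K \<Longrightarrow> x \<in> K \<Longrightarrow> y \<in> K \<Longrightarrow> x + y \<in> K" and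
  finite_extension_mult: "finite_extension K \<Longrightarrow> x \<in> K \<Longrightarrow> y \<in> K \<Longrightarrow> x * y \<in> K" and
  finite_extension_to_ac: "finite_extension K \<Longrightarrow> to_ac c \<in> K"
  unfolding finite_extension_def by auto

lemma ring_of_integers_zp_ring:
  assumes "finite_extension K"
  shows "zp_ring (ring_of_integers K)"
proof
  show "zp_embed c \<in> ring_of_integers K" for c
    unfolding ring_of_integers_def using finite_extension_to_ac[OF assms, of "Fract c 1"] by simp
qed (auto simp: ring_of_integers_def integral_over_zp_ring
      intro: finite_extension_add[OF assms] finite_extension_mult[OF assms])

text \<open>The field is recovered from its ring of integers, so uniqueness may be proved for the
  rings.\<close>

lemma finite_extension_iff_integers:
  fixes x :: "'p :: prime_card padic_closure"
  assumes K: "finite_extension K"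
  shows "x \<in> K \<longleftrightarrow> (\<exists>k. of_nat CARD('p) ^ k * x \<in> ring_of_integers K)"
proof
  assume x: "x \<in> K"
  obtain k where "integral_over_zp (of_nat CARD('p) ^ k * x)" using integral_multiple by blast
  moreover have "to_ac (of_nat CARD('p) ^ k) * x \<in> K"
    by (rule finite_extension_mult[OF K finite_extension_to_ac[OF K] x])
  ultimately show "\<exists>k. of_nat CARD('p) ^ k * x \<in> ring_of_integers K"
    unfolding ring_of_integers_def by auto
next
  assume "\<exists>k. of_nat CARD('p) ^ k * x \<in> ring_of_integers K"
  then obtain k where "of_nat CARD('p) ^ k * x \<in> K" unfolding ring_of_integers_def by auto
  then have "to_ac (inverse (of_nat CARD('p) ^ k)) * (of_nat CARD('p) ^ k * x) \<in> K"
    by (rule finite_extension_mult[OF K finite_extension_to_ac[OF K]])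
  then show "x \<in> K" unfolding to_ac_inverse_p_power .
qed

text \<open>Multiplication by a unit permutes the non-zero residue classes, as in the proof of Fermat's
  little theorem.\<close>

lemma (in zp_ring) frobenius_if_residues:
  assumes T: "T \<subseteq> R" "card T = r" "r > 0"
    and rep: "\<And>x. x \<in> R \<Longrightarrow> \<exists>t\<in>T. pcong 1 x t"
    and inj: "\<And>s t. s \<in> T \<Longrightarrow> t \<in> T \<Longrightarrow> pcong 1 s t \<Longrightarrow> s = t"
    and unit: "\<And>x. x \<in> R \<Longrightarrow> \<not> pcong 1 x 0 \<Longrightarrow> \<exists>v\<in>R. x * v = 1"
    and x: "x \<in> R"
  shows "pcong 1 (x ^ r) x"
proof (cases "pcong 1 x 0")
  case True
  then have "pcong 1 (x ^ (r - 1) * x) (x ^ (r - 1) * 0)"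
    by (rule pcong_mult_left[OF power_in[OF x]])
  moreover have "x ^ (r - 1) * x = x ^ r" by (rule power_minus_mult[OF T(3)])
  ultimately have "pcong 1 (x ^ r) 0" by simp
  then show ?thesis using pcong_sym[OF True] pcong_trans by blast
next
  case False
  have fin: "finite T" using T(2,3) card_ge_0_finite by blast
  have unit_pcong: "\<not> pcong 1 y 0" if "y \<in> R" "v \<in> R" "y * v = 1" for y v
  proof
    assume "pcong 1 y 0"
    then have "pcong 1 (v * y) (v * 0)" by (rule pcong_mult_left[OF that(2)])
    then show False using not_pcong_one_zero that(3) by (simp add: mult.commute)
  qed
  have prod_unit: "\<not> pcong 1 (y * z) 0" if yz: "y \<in> R" "z \<in> R" "\<not> pcong 1 y 0" "\<not> pcong 1 z 0" for y z
  proof -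
    obtain v w where vw: "v \<in> R" "y * v = 1" "w \<in> R" "z * w = 1" using unit yz by blast
    have "(y * z) * (v * w) = (y * v) * (z * w)" by (simp only: ac_simps)
    also have "\<dots> = 1" using vw by simp
    finally show ?thesis by (rule unit_pcong[OF mult_in[OF yz(1,2)] mult_in[OF vw(1,3)]])
  qed
  \<comment> \<open>\<open>t0\<close> represents the class of zero and is discarded;
    \<open>T'\<close> represents the \<open>r - 1\<close> non-zero classes.\<close>
  obtain t0 where t0: "t0 \<in> T" "pcong 1 0 t0" using rep[OF zero_in] by blast
  define T' where "T' = T - {t0}"
  have T': "t \<in> T' \<longleftrightarrow> t \<in> T \<and> \<not> pcong 1 t 0" for t
  proof -
    have "pcong 1 t0 0" by (rule pcong_sym[OF t0(2)])
    moreover have "t = t0" if "t \<in> T" "pcong 1 t 0"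
      using inj[OF that(1) t0(1)] pcong_trans[OF that(2) t0(2)] by blast
    ultimately show ?thesis unfolding T'_def by blast
  qed
  have finT': "finite T'" and cardT': "card T' = r - 1"
    unfolding T'_def using fin t0(1) T(2) by auto
  have T'R: "t \<in> R" if "t \<in> T'" for t using that T' T(1) by blast
  have "\<forall>t\<in>T'. \<exists>s. s \<in> T \<and> pcong 1 (x * t) s" using rep mult_in x T'R by blast
  then obtain h where h: "\<forall>t\<in>T'. h t \<in> T \<and> pcong 1 (x * t) (h t)" by (rule bchoice[THEN exE])
  obtain v where v: "v \<in> R" "x * v = 1" using unit[OF x False] by blast
  have inj_h: "inj_on h T'"
  proof (rule inj_onI)
    fix s t assume st: "s \<in> T'" "t \<in> T'" "h s = h t"
    then have "pcong 1 (x * s) (x * t)" using h pcong_sym pcong_trans by metis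
    then have "pcong 1 (v * (x * s)) (v * (x * t))" by (rule pcong_mult_left[OF v(1)])
    moreover have "v * (x * u) = u" for u
    proof -
      have "v * (x * u) = (x * v) * u" by (simp only: ac_simps)
      then show ?thesis using v(2) by simp
    qed
    ultimately have "pcong 1 s t" by (simp only:)
    then show "s = t" using inj st T' by blast
  qed
  have "h ` T' \<subseteq> T'"
  proof safe
    fix t assume t: "t \<in> T'"
    have "\<not> pcong 1 (x * t) 0" using prod_unit[OF x T'R[OF t] False] t T' by blast
    then have "\<not> pcong 1 (h t) 0" using h t pcong_trans by blast
    then show "h t \<in> T'" using h t T' by blast
  qed
  then have bij: "bij_betw h T' T'"
    using inj_h finT' endo_inj_surj by (simp add: bij_betw_def)
  have "pcong 1 (\<Prod>t\<in>T'. x * t) (\<Prod>t\<in>T'. h t)"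
    using h T'R mult_in x T(1) by (intro pcong_prod) blast
  moreover have "(\<Prod>t\<in>T'. h t) = (\<Prod>t\<in>T'. t)" by (rule prod.reindex_bij_betw[OF bij])
  moreover have "(\<Prod>t\<in>T'. x * t) = x ^ (r - 1) * (\<Prod>t\<in>T'. t)"
    by (simp add: prod.distrib cardT')
  ultimately have c: "pcong 1 (x ^ (r - 1) * (\<Prod>t\<in>T'. t)) (\<Prod>t\<in>T'. t)" by simp
  have "\<not> pcong 1 (\<Prod>t\<in>U. t) 0" if "U \<subseteq> T'" for U
    using finite_subset[OF that finT'] that
  proof (induction U rule: finite_induct)
    case empty
    then show ?case using not_pcong_one_zero by simp
  next
    case (insert t U)
    then have "(\<Prod>t\<in>U. t) \<in> R" using T'R by (intro prod_in) auto
    then have "\<not> pcong 1 (t * (\<Prod>t\<in>U. t)) 0"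
      using prod_unit[OF T'R[of t]] insert T' by blast
    then show ?case using insert by simp
  qed
  then have "\<not> pcong 1 (\<Prod>t\<in>T'. t) 0" by blast
  moreover have PR: "(\<Prod>t\<in>T'. t) \<in> R" using T'R by (rule prod_in)
  ultimately obtain w where w: "w \<in> R" "(\<Prod>t\<in>T'. t) * w = 1" using unit by blast
  \<comment> \<open>Multiplying by \<open>w x\<close> cancels the product of the representatives and
    raises the exponent from \<open>r - 1\<close> to \<open>r\<close>.\<close>
  have "pcong 1 ((w * x) * (x ^ (r - 1) * (\<Prod>t\<in>T'. t))) ((w * x) * (\<Prod>t\<in>T'. t))"
    by (rule pcong_mult_left[OF mult_in[OF w(1) x] c])
  moreover have "(w * x) * (\<Prod>t\<in>T'. t) = x * ((\<Prod>t\<in>T'. t) * w)" by (simp only: ac_simps)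
  moreover have "(w * x) * (x ^ (r - 1) * (\<Prod>t\<in>T'. t)) = x ^ (r - 1) * x * ((\<Prod>t\<in>T'. t) * w)"
    by (simp only: ac_simps)
  moreover have "x ^ (r - 1) * x = x ^ r" by (rule power_minus_mult[OF T(3)])
  ultimately show ?thesis by (simp only: w(2) mult.right_neutral)
qed

text \<open>Finite generation of the integers is part of the claim. One representative per residue
  class is chosen; since \<open>p\<close> generates the maximal ideal, successive approximation
  shows that these span the ring. Their Teichmueller lifts are as many distinct solutions of
  \<open>w^r = w\<close> as there are in the closure, hence all of them. So the ring contains all
  \<open>(r - 1)\<close>-th roots of unity, and these meet every class and span it too.\<close>

lemma unramified_unique:
  fixes K :: "'p :: prime_card padic_closure set"
  assumes m: "m > 0" and K: "unramified K" "card (residue_field K) = CARD('p) ^ m"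
  shows "K = mu_field m"
proof -
  let ?r = "CARD('p) ^ m"
  let ?mu = "roots_of_unity (?r - 1) :: 'p padic_closure set"
  have n: "?r - 1 > 0" by (rule CARD_power_minus_1_pos[OF m])
  have fe: "finite_extension K" and max: "integers_max_ideal K = (\<lambda>x. of_nat CARD('p) * x) ` ring_of_integers K"
    using K(1) unfolding unramified_def by auto
  define R where "R = ring_of_integers K"
  interpret zp_ring R unfolding R_def by (rule ring_of_integers_zp_ring[OF fe])
  have unit: "\<exists>v\<in>R. x * v = 1" if x: "x \<in> R" "\<not> pcong 1 x 0" for x
  proof (rule ccontr)
    assume "\<not> (\<exists>v\<in>R. x * v = 1)"
    then have "x \<in> integers_max_ideal K" using x unfolding integers_max_ideal_def R_def by blast
    then obtain y where "y \<in> R" "x = P * y" unfolding max R_def by blast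
    then show False using x(2) pcong_multiple by simp
  qed
  define E where "E = {(x, y). x \<in> R \<and> y \<in> R \<and> pcong 1 x y}"
  have E: "equiv R E" unfolding E_def by (rule pcong_equiv)
  have cardE: "card (R // E) = ?r"
    using residue_classes[of K] max K(2) unfolding E_def R_def by simp
  define c where "c C = (SOME x. x \<in> C)" for C :: "'p padic_closure set"
  have cC: "c C \<in> C" if C: "C \<in> R // E" for C
    unfolding c_def using in_quotient_imp_non_empty[OF E C] some_in_eq by blast
  define T where "T = c ` (R // E)"
  have TR: "T \<subseteq> R" unfolding T_def using cC in_quotient_imp_subset[OF E] by blast
  have rep: "\<exists>t\<in>T. pcong 1 x t" if x: "x \<in> R" for x
  proof -
    have C: "E `` {x} \<in> R // E" by (rule quotientI[OF x])
    have "c (E `` {x}) \<in> E `` {x}" by (rule cC[OF C])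
    then have "pcong 1 x (c (E `` {x}))" unfolding E_def by blast
    then show ?thesis using C unfolding T_def by blast
  qed
  have inj: "s = t" if st: "s \<in> T" "t \<in> T" "pcong 1 s t" for s t
  proof -
    obtain C D where CD: "C \<in> R // E" "D \<in> R // E" "s = c C" "t = c D" using st unfolding T_def by blast
    have "(s, t) \<in> E" unfolding E_def using st TR by blast
    then have "C = D" using quotient_eqI[OF E CD(1,2)] cC CD by blast
    then show ?thesis using CD by simp
  qed
  have "inj_on c (R // E)"
  proof (rule inj_onI)
    fix C D assume CD: "C \<in> R // E" "D \<in> R // E" "c C = c D"
    have "c C \<in> R" using CD TR unfolding T_def by blast
    then have "(c C, c D) \<in> E" unfolding E_def CD(3) using CD(3) by simp
    then show "C = D" using quotient_eqI[OF E CD(1,2)] cC CD by blast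
  qed
  then have cardT: "card T = ?r" unfolding T_def using cardE by (simp add: card_image)
  have r0: "?r > 0" using n by simp
  have finT: "finite T" using cardT r0 card_ge_0_finite by metis
  have frob: "pcong 1 (x ^ ?r) x" if x: "x \<in> R" for x
    by (rule frobenius_if_residues[OF TR cardT r0 rep inj unit x])
  have RT: "R = zp_mod.span T"
    using rep zp_mod.span_base by (intro span_if_residues[OF finT TR]) blast
  interpret zp_order R T m ?r
    by unfold_locales (rule finT RT m refl frob, assumption?)+
  have "\<exists>w. w \<in> R \<and> w ^ ?r = w \<and> pcong 1 t w" if "t \<in> T" for t
    using teichmueller[of t] that TR by blast
  then obtain w where w: "\<And>t. t \<in> T \<Longrightarrow> w t \<in> R \<and> w t ^ ?r = w t \<and> pcong 1 t (w t)" by metis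
  have "inj_on w T"
  proof (rule inj_onI)
    fix s t assume st: "s \<in> T" "t \<in> T" "w s = w t"
    then have "pcong 1 s t" using w pcong_sym pcong_trans by metis
    then show "s = t" using inj st by blast
  qed
  then have "card (w ` T) = card (insert 0 ?mu)"
    using cardT card_insert_0_roots_of_unity[OF m, where 'p = 'p] by (simp add: card_image)
  moreover have "w ` T \<subseteq> insert 0 ?mu" using w root_of_unity_if_fixed by blast
  moreover have "finite (insert 0 ?mu)" using card_roots_of_unity(2)[OF n] by simp
  ultimately have wT: "w ` T = insert 0 ?mu" using card_subset_eq by blast
  moreover have "w ` T \<subseteq> R" using w by blast
  ultimately have muR: "?mu \<subseteq> R" by simp
  have "R = zp_mod.span ?mu"
  proof (rule span_if_residues[OF card_roots_of_unity(2)[OF n] muR])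
    fix x assume x: "x \<in> R"
    obtain t where t: "t \<in> T" "pcong 1 x t" using rep x by blast
    then have "pcong 1 x (w t)" using w pcong_trans by blast
    moreover have "w t \<in> insert 0 ?mu" using imageI[OF t(1), of w] unfolding wT .
    then have "w t \<in> zp_mod.span ?mu"
      using zp_mod.span_base zp_mod.span_zero by (elim insertE) (simp_all only:)
    ultimately show "\<exists>t\<in>zp_mod.span ?mu. pcong 1 x t" by blast
  qed
  then have R: "ring_of_integers K = mu_ring m" unfolding mu_ring_def R_def .
  show ?thesis
    by (rule Set.set_eqI) (simp only: finite_extension_iff_integers[OF fe] mu_field_iff R)
qed

theorem Q_unram_eq:
  assumes "m > 0"
  shows "Q_unram (CARD('p) ^ m) = (mu_field m :: 'p :: prime_card padic_closure set)"
  unfolding Q_unram_def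
proof (rule the_equality)
  show "unramified (mu_field m :: 'p padic_closure set) \<and> card (residue_field (mu_field m :: 'p padic_closure set)) = CARD('p) ^ m"
    using mu_field_unramified[OF assms] mu_field_residue_card[OF assms] by blast
qed (use unramified_unique[OF assms] in blast)

section \<open>The minimal polynomial of a primitive root of unity\<close>

lemma primitive_root_of_unity_mult:
  fixes z w :: "'a :: field"
  assumes z: "\<And>k. z ^ k = 1 \<longleftrightarrow> a dvd k" and w: "\<And>k. w ^ k = 1 \<longleftrightarrow> b dvd k" and "coprime a b"
  shows "(z * w) ^ k = 1 \<longleftrightarrow> a * b dvd k"
proof
  assume eq: "(z * w) ^ k = 1"
  have "z ^ (k * b) = 1"
  proof -
    have "w ^ (k * b) = 1" using w by simp
    moreover have "(z * w) ^ (k * b) = 1" using eq by (simp add: power_mult)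
    ultimately show ?thesis by (simp add: power_mult_distrib)
  qed
  then have "a dvd k" using z assms(3) coprime_dvd_mult_left_iff by blast
  moreover have "w ^ (k * a) = 1"
  proof -
    have "z ^ (k * a) = 1" using z by simp
    moreover have "(z * w) ^ (k * a) = 1" using eq by (simp add: power_mult)
    ultimately show ?thesis by (simp add: power_mult_distrib)
  qed
  then have "b dvd k" using w assms(3) coprime_dvd_mult_left_iff coprime_commute by blast
  ultimately show "a * b dvd k" using assms(3) by (simp add: divides_mult)
next
  assume "a * b dvd k"
  then have "z ^ k = 1" "w ^ k = 1" using z w dvd_mult_left dvd_mult_right by blast+
  then show "(z * w) ^ k = 1" by (simp add: power_mult_distrib)
qed

lemma power_gcd_eq_1:
  fixes z :: "'a :: field"
  assumes "z ^ a = 1" "z ^ b = 1"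
  shows "z ^ gcd a b = 1"
proof (cases "a = 0")
  case False
  then obtain x y where "a * x = b * y + gcd a b" using bezout_nat by blast
  then have "z ^ (a * x) = z ^ (b * y) * z ^ gcd a b" by (simp add: power_add)
  then show ?thesis using assms by (simp add: power_mult)
qed (use assms in simp)

text \<open>There are more \<open>l^e\<close>-th roots of unity than \<open>l^(e - 1)\<close>-th
  ones. A root in the difference has order exactly \<open>l^e\<close>, because every proper divisor
  of \<open>l^e\<close> divides \<open>l^(e - 1)\<close>.\<close>

lemma primitive_root_of_unity_prime_power:
  assumes l: "Factorial_Ring.prime (l :: nat)"
  obtains z :: "'p :: prime_card padic_closure" where "\<And>k. z ^ k = 1 \<longleftrightarrow> l ^ e dvd k"
proof (cases e)
  case 0
  then show ?thesis using that[of 1] by simp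
next
  case (Suc j)
  have l1: "l > 1" using l by (rule prime_gt_1_nat)
  let ?A = "roots_of_unity (l ^ e) :: 'p padic_closure set" and ?B = "roots_of_unity (l ^ j) :: 'p padic_closure set"
  have "card ?A = l ^ e" "card ?B = l ^ j" "finite ?B"
    using card_roots_of_unity[of "l ^ e", where 'p = 'p] card_roots_of_unity[of "l ^ j", where 'p = 'p] l1 by auto
  moreover have "l ^ j < l ^ e" using l1 Suc by simp
  ultimately have "\<not> ?A \<subseteq> ?B" using card_mono[of ?B ?A] by linarith
  then obtain z where "z \<in> ?A" "z \<notin> ?B" by blast
  then have z: "z ^ (l ^ e) = 1" "z ^ (l ^ j) \<noteq> 1" by (simp_all only: roots_of_unity_iff not_False_eq_True)
  have "z ^ k = 1 \<longleftrightarrow> l ^ e dvd k" for k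
  proof
    assume "z ^ k = 1"
    then have g: "z ^ gcd k (l ^ e) = 1" using z(1) by (rule power_gcd_eq_1)
    obtain i where i: "i \<le> e" "gcd k (l ^ e) = l ^ i"
      using divides_primepow_nat[OF l] gcd_dvd2 by blast
    have "i = e"
    proof (rule ccontr)
      assume "i \<noteq> e"
      then have "l ^ i dvd l ^ j" using i(1) Suc by (intro le_imp_power_dvd) simp
      then obtain c where "l ^ j = l ^ i * c" by (elim dvdE)
      then have "z ^ (l ^ j) = (z ^ (l ^ i)) ^ c" by (simp add: power_mult)
      then show False using g z(2) unfolding i(2) by simp
    qed
    then have "gcd k (l ^ e) = l ^ e" using i(2) by (simp only:)
    then show "l ^ e dvd k" using gcd_dvd1[of k "l ^ e"] by (simp only:)
  next
    assume "l ^ e dvd k"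
    then obtain c where "k = l ^ e * c" by (elim dvdE)
    then show "z ^ k = 1" using z(1) by (simp only: power_mult power_one)
  qed
  then show ?thesis using that by blast
qed

lemma primitive_root_of_unity_exists:
  assumes "n > 0"
  shows "\<exists>z :: 'p :: prime_card padic_closure. \<forall>k. z ^ k = 1 \<longleftrightarrow> n dvd k"
  using assms
proof (induction n rule: less_induct)
  case (less n)
  show ?case
  proof (cases "n = 1")
    case True
    then show ?thesis by (intro exI[of _ 1]) simp
  next
    case False
    then obtain l where l: "Factorial_Ring.prime l" "l dvd n" using prime_factor_nat by blast
    have nu: "\<not> is_unit l" using l(1) by auto
    obtain n' where n': "n = l ^ multiplicity l n * n'" "\<not> l dvd n'"
      using multiplicity_decompose'[of n l] nu less.prems by auto
    have e0: "multiplicity l n > 0" using l n' by (metis gr0I mult_1 power_0)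
    have cop: "coprime (l ^ multiplicity l n) n'"
      using prime_imp_coprime[OF l(1) n'(2)] by simp
    have "n' > 0" using n' less.prems by (metis gr0I mult_0_right less_irrefl)
    moreover have "l ^ multiplicity l n > 1" using e0 prime_gt_1_nat[OF l(1)] by (intro one_less_power)
    ultimately have "n' < n" using n'(1) by (metis mult_1 mult_less_mono1)
    then obtain w :: "'p padic_closure" where w: "\<And>k. w ^ k = 1 \<longleftrightarrow> n' dvd k"
      using less.IH[of n'] \<open>n' > 0\<close> by blast
    obtain z :: "'p padic_closure" where z: "\<And>k. z ^ k = 1 \<longleftrightarrow> l ^ multiplicity l n dvd k"
      using primitive_root_of_unity_prime_power[OF l(1)] by blast
    show ?thesis
      using primitive_root_of_unity_mult[OF z w cop] n'(1) by (intro exI[of _ "z * w"]) simp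
  qed
qed

text \<open>A primitive root makes the extension monogenic, so that conjugates and traces are
  governed by a single minimal polynomial.\<close>

locale mu_generator =
  fixes m :: nat and \<zeta> :: "'p :: prime_card padic_closure"
  assumes m0: "m > 0" and order: "\<zeta> ^ k = 1 \<longleftrightarrow> (CARD('p) ^ m - 1) dvd k"

sublocale mu_generator \<subseteq>
  zp_order "mu_ring m :: 'p padic_closure set" "roots_of_unity (CARD('p) ^ m - 1)" m "CARD('p) ^ m"
  by (rule mu_ring_zp_order[OF m0])

context mu_generator
begin

lemma order_pos: "CARD('p) ^ m - 1 > 0"
  by (rule CARD_power_minus_1_pos[OF m0])

lemma zeta_in_mu: "\<zeta> \<in> roots_of_unity (CARD('p) ^ m - 1)"
  unfolding roots_of_unity_iff order by simp

lemma mu_in: "roots_of_unity (CARD('p) ^ m - 1) \<subseteq> (mu_ring m :: 'p padic_closure set)"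
  unfolding mu_ring_def by (rule zp_mod.span_superset)

lemma zeta_in: "\<zeta> \<in> mu_ring m"
  using zeta_in_mu mu_in by blast

lemma zeta_nonzero: "\<zeta> \<noteq> 0"
  using roots_of_unity_nonzero[OF zeta_in_mu order_pos] .

lemma zeta_power_inj:
  assumes "i \<le> j" "j - i < CARD('p) ^ m - 1" "\<zeta> ^ i = \<zeta> ^ j"
  shows "i = j"
proof -
  have "\<zeta> ^ i * \<zeta> ^ (j - i) = \<zeta> ^ j" using assms(1) by (simp flip: power_add)
  then have "\<zeta> ^ i * \<zeta> ^ (j - i) = \<zeta> ^ i * 1" using assms(3) by simp
  then have "\<zeta> ^ (j - i) = 1" using zeta_nonzero by simp
  then have "(CARD('p) ^ m - 1) dvd (j - i)" by (simp only: order)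
  then have "j - i = 0" using assms(2) by (meson gr0I nat_dvd_not_less)
  then show ?thesis using assms(1) by simp
qed

lemma mu_is_power:
  assumes "w \<in> roots_of_unity (CARD('p) ^ m - 1)"
  obtains i where "i < CARD('p) ^ m - 1" "w = \<zeta> ^ i"
proof -
  let ?n = "CARD('p) ^ m - 1"
  have "inj_on (\<lambda>i. \<zeta> ^ i) {..<?n}"
  proof (rule inj_onI)
    fix i j assume ij: "i \<in> {..<?n}" "j \<in> {..<?n}" "\<zeta> ^ i = \<zeta> ^ j"
    show "i = j"
    proof (cases "i \<le> j")
      case True
      have "j - i < ?n" using ij(2) by (simp only: lessThan_iff less_imp_diff_less)
      then show ?thesis by (rule zeta_power_inj[OF True _ ij(3)])
    next
      case False
      then have "j \<le> i" by simp
      moreover have "i - j < ?n" using ij(1) by (simp only: lessThan_iff less_imp_diff_less)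
      ultimately show ?thesis by (rule zeta_power_inj[OF _ _ ij(3)[symmetric], symmetric])
    qed
  qed
  then have "card ((\<lambda>i. \<zeta> ^ i) ` {..<?n}) = ?n" by (simp add: card_image)
  moreover have "(\<lambda>i. \<zeta> ^ i) ` {..<?n} \<subseteq> roots_of_unity ?n"
    using roots_of_unity_power[OF zeta_in_mu] by blast
  ultimately have "(\<lambda>i. \<zeta> ^ i) ` {..<?n} = roots_of_unity ?n"
    by (intro card_subset_eq[OF card_roots_of_unity(2)[OF order_pos]])
       (simp_all only: card_roots_of_unity(1)[OF order_pos])
  then have "w \<in> (\<lambda>i. \<zeta> ^ i) ` {..<?n}" using assms by simp
  then show ?thesis using that by blast
qed

text \<open>The least such \<open>n\<close>, called \<open>deg\<close> below, is the degree of the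
  residue of \<open>\<zeta>\<close> over the prime field. It is squeezed to \<open>m\<close>:
  counting residues bounds it from above, distinct conjugates from below.\<close>

definition residue_relation :: "nat \<Rightarrow> bool" where
  "residue_relation n \<longleftrightarrow> (\<exists>c. pcong 1 (\<zeta> ^ n) (\<Sum>i<n. zp_embed (c i) * \<zeta> ^ i))"

definition deg :: nat where "deg = (LEAST n. residue_relation n)"

lemma residue_relation_deg: "residue_relation deg"
  unfolding deg_def
proof (rule LeastI)
  let ?n = "CARD('p) ^ m - 1"
  have "\<zeta> ^ ?n = (\<Sum>i<?n. zp_embed (if i = 0 then 1 else 0) * \<zeta> ^ i)"
    using order_pos order[of ?n] by (subst sum.remove[of _ 0]) auto
  then show "residue_relation ?n"
    unfolding residue_relation_def by (intro exI[of _ "\<lambda>i. if i = 0 then 1 else 0"]) simp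
qed

text \<open>A top coefficient not divisible by \<open>p\<close> would be a unit, and solving for the
  top power would give a residue relation below \<open>deg\<close>. Otherwise the top term drops out
  modulo \<open>p\<close> and induction applies.\<close>

lemma residue_independent:
  assumes "n \<le> deg" "pcong 1 (\<Sum>i<n. zp_embed (c i) * \<zeta> ^ i) 0" "i < n"
  shows "of_nat CARD('p) dvd c i"
  using assms
proof (induction n)
  case (Suc n)
  have dvd: "of_nat CARD('p) dvd c n"
  proof (rule ccontr)
    assume "\<not> of_nat CARD('p) dvd c n"
    then have "c n dvd 1" by (rule padic_int_unit_if_not_dvd)
    then obtain v where "1 = c n * v" by (elim dvdE)
    then have "zp_embed (c n * v) = 1" by simp
    then have v: "zp_embed v * zp_embed (c n) = 1" by (simp only: zp_embed_mult mult.commute)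
    let ?s = "\<Sum>i<n. zp_embed (c i) * \<zeta> ^ i"
    have "pcong 1 (zp_embed v * (?s + zp_embed (c n) * \<zeta> ^ n)) (zp_embed v * 0)"
      using Suc.prems(2) by (intro pcong_mult_left[OF embed_in]) simp
    moreover have "zp_embed v * (?s + zp_embed (c n) * \<zeta> ^ n) = zp_embed v * ?s + \<zeta> ^ n"
      using v by (simp add: distrib_left flip: mult.assoc)
    ultimately have "pcong 1 (zp_embed v * ?s + \<zeta> ^ n) 0" by simp
    then have "pcong 1 (zp_embed v * ?s + \<zeta> ^ n - zp_embed v * ?s) (0 - zp_embed v * ?s)"
      by (rule pcong_diff[OF _ pcong_refl])
    moreover have "0 - zp_embed v * ?s = (\<Sum>i<n. zp_embed (- (v * c i)) * \<zeta> ^ i)"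
      by (simp only: diff_0 sum_distrib_left zp_embed_uminus zp_embed_mult mult_minus_left sum_negf mult.assoc)
    ultimately have "pcong 1 (\<zeta> ^ n) (\<Sum>i<n. zp_embed (- (v * c i)) * \<zeta> ^ i)" by simp
    then have "residue_relation n" unfolding residue_relation_def by (rule exI[of _ "\<lambda>i. - (v * c i)"])
    then show False using Suc.prems(1) not_less_Least[of n residue_relation] unfolding deg_def by simp
  qed
  then obtain e where "c n = of_nat CARD('p) * e" by (elim dvdE)
  then have "zp_embed (c n) * \<zeta> ^ n = P * (zp_embed e * \<zeta> ^ n)" by (simp add: zp_embed_mult mult.assoc)
  then have "pcong 1 (zp_embed (c n) * \<zeta> ^ n) 0"
    using pcong_multiple[OF mult_in[OF embed_in power_in[OF zeta_in]]] by (simp only:)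
  then have "pcong 1 ((\<Sum>i<Suc n. zp_embed (c i) * \<zeta> ^ i) - zp_embed (c n) * \<zeta> ^ n) (0 - 0)"
    by (rule pcong_diff[OF Suc.prems(2)])
  then have n: "pcong 1 (\<Sum>i<n. zp_embed (c i) * \<zeta> ^ i) 0" by simp
  show ?case
  proof (cases "i = n")
    case False
    then show ?thesis using Suc.IH[OF _ n] Suc.prems(1,3) by simp
  qed (use dvd in simp)
qed simp

text \<open>Combinations of the \<open>\<zeta>^i\<close>, \<open>i < deg\<close>, with digits below
  \<open>p\<close> are pairwise incongruent, which gives \<open>p^deg\<close> classes among the
  \<open>p^m\<close> available.\<close>

lemma deg_le: "deg \<le> m"
proof -
  let ?V = "insert 0 (roots_of_unity (CARD('p) ^ m - 1)) :: 'p padic_closure set"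
  let ?ev = "\<lambda>c :: nat \<Rightarrow> nat. \<Sum>i<deg. zp_embed (of_nat (c i)) * \<zeta> ^ i"
  let ?C = "PiE {..<deg} (\<lambda>_. {..<CARD('p)})"
  have ev_in: "?ev c \<in> mu_ring m" for c
    by (intro sum_in mult_in embed_in power_in zeta_in)
  have "\<forall>c. \<exists>t. t \<in> ?V \<and> pcong 1 (?ev c) t"
  proof
    fix c
    obtain w where "w ^ (CARD('p) ^ m) = w" "pcong 1 (?ev c) w" using teichmueller[OF ev_in] by blast
    then show "\<exists>t. t \<in> ?V \<and> pcong 1 (?ev c) t" using root_of_unity_if_fixed[of w] by blast
  qed
  then obtain h where "\<forall>c. h c \<in> ?V \<and> pcong 1 (?ev c) (h c)" by (rule choice[THEN exE])
  then have h: "h c \<in> ?V" "pcong 1 (?ev c) (h c)" for c by blast+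
  have "inj_on h ?C"
  proof (rule inj_onI)
    fix c e assume c: "c \<in> ?C" and e: "e \<in> ?C" and eq: "h c = h e"
    have "pcong 1 (?ev c - ?ev e) (h c - h e)" by (rule pcong_diff[OF h(2) h(2)])
    moreover have "?ev c - ?ev e = (\<Sum>i<deg. zp_embed (of_int (int (c i) - int (e i))) * \<zeta> ^ i)"
      by (simp add: sum_subtractf zp_embed.hom_minus left_diff_distrib)
    ultimately have cong: "pcong 1 (\<Sum>i<deg. zp_embed (of_int (int (c i) - int (e i))) * \<zeta> ^ i) 0"
      using eq by simp
    show "c = e"
    proof (rule PiE_ext[OF c e])
      fix i assume i: "i \<in> {..<deg}"
      then have "(of_nat CARD('p) :: 'p padic_int) dvd of_int (int (c i) - int (e i))"
        using residue_independent[OF le_refl cong] by simp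
      then have "int CARD('p) dvd int (c i) - int (e i)" by (simp only: padic_int_dvd_of_nat_iff)
      moreover have "\<bar>int (c i) - int (e i)\<bar> < int CARD('p)"
        using PiE_mem[OF c i] PiE_mem[OF e i] by auto
      ultimately show "c i = e i" using dvd_imp_le_int[of "int (c i) - int (e i)" "int CARD('p)"] by fastforce
    qed
  qed
  moreover have "finite ?V" using card_roots_of_unity(2)[OF order_pos] by simp
  ultimately have "card ?C \<le> card ?V" using card_inj_on_le[of h ?C ?V] h(1) by blast
  then have "CARD('p) ^ deg \<le> CARD('p) ^ m"
    using card_insert_0_roots_of_unity[OF m0, where 'p = 'p] by (simp add: card_PiE)
  then show ?thesis using prime_gt_1_nat[OF prime_card[where 'a = 'p]] power_le_imp_le_exp by blast
qed

abbreviation zeta_powers :: "'p padic_closure set" where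
  "zeta_powers \<equiv> (\<lambda>i. \<zeta> ^ i) ` {..<deg}"

text \<open>By successive approximation it suffices to reach every residue class. The property
  \<open>?A\<close> passes to sums and Z_p-multiples and holds for all powers of
  \<open>\<zeta>\<close> by the relation at \<open>deg\<close>; every root of unity is such a
  power.\<close>

lemma mu_ring_span_powers: "mu_ring m = zp_mod.span zeta_powers"
proof (rule span_if_residues)
  show "finite zeta_powers" by simp
  show "zeta_powers \<subseteq> mu_ring m" using power_in[OF zeta_in] by blast
  let ?A = "\<lambda>x. \<exists>t\<in>zp_mod.span zeta_powers. pcong 1 x t"
  have add: "?A (x + y)" if xy: "?A x" "?A y" for x y
  proof -
    obtain s t where "s \<in> zp_mod.span zeta_powers" "pcong 1 x s"
      "t \<in> zp_mod.span zeta_powers" "pcong 1 y t" using xy by blast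
    then show ?thesis by (intro bexI[of _ "s + t"] pcong_add zp_mod.span_add)
  qed
  have scale: "?A (zp_embed c * x)" if x: "?A x" for c x
  proof -
    obtain t where "t \<in> zp_mod.span zeta_powers" "pcong 1 x t" using x by blast
    then show ?thesis by (intro bexI[of _ "zp_embed c * t"] pcong_mult_left embed_in zp_mod.span_scale)
  qed
  have zero: "?A 0" using zp_mod.span_zero pcong_refl by blast
  have sum: "?A (sum g I)" if "\<And>i. i \<in> I \<Longrightarrow> ?A (g i)" "finite I" for g and I :: "nat set"
    using that(2,1) by (induction I rule: finite_induct) (use zero add in auto)
  have trans: "?A x" if "pcong 1 x y" "?A y" for x y
    using that pcong_trans by blast
  obtain c where c: "pcong 1 (\<zeta> ^ deg) (\<Sum>i<deg. zp_embed (c i) * \<zeta> ^ i)"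
    using residue_relation_deg unfolding residue_relation_def by blast
  have pow: "?A (\<zeta> ^ k)" for k
  proof (induction k rule: less_induct)
    case (less k)
    show ?case
    proof (cases "k < deg")
      case True
      then have "\<zeta> ^ k \<in> zp_mod.span zeta_powers" by (intro zp_mod.span_base) simp
      then show ?thesis using pcong_refl by blast
    next
      case False
      then have "\<zeta> ^ k = \<zeta> ^ (k - deg) * \<zeta> ^ deg" by (simp flip: power_add)
      then have "pcong 1 (\<zeta> ^ k) (\<zeta> ^ (k - deg) * (\<Sum>i<deg. zp_embed (c i) * \<zeta> ^ i))"
        using pcong_mult_left[OF power_in[OF zeta_in] c] by simp
      moreover have "\<zeta> ^ (k - deg) * (\<Sum>i<deg. zp_embed (c i) * \<zeta> ^ i) =
          (\<Sum>i<deg. zp_embed (c i) * \<zeta> ^ (k - deg + i))"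
        unfolding sum_distrib_left power_add by (simp only: ac_simps)
      moreover have "?A (\<Sum>i<deg. zp_embed (c i) * \<zeta> ^ (k - deg + i))"
        by (rule sum, rule scale, rule less) (use False in auto)
      ultimately show ?thesis using trans by simp
    qed
  qed
  fix x assume "x \<in> (mu_ring m :: 'p padic_closure set)"
  then have "x \<in> zp_mod.span (roots_of_unity (CARD('p) ^ m - 1))" unfolding mu_ring_def .
  then show "?A x"
  proof (induction rule: zp_mod.span_induct_alt)
    case (step c s y)
    obtain i where "s = \<zeta> ^ i" using mu_is_power[OF step.hyps(1)] by blast
    then show ?case using add[OF scale[OF pow[of i]] step.IH] by simp
  qed (rule zero)
qed

text \<open>An exact relation is one modulo \<open>p\<close>, so \<open>p\<close> divides all
  coefficients; dividing it out leaves another exact relation, and the process repeats.\<close>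

lemma independent_over_zp:
  assumes "(\<Sum>i<deg. zp_embed (c i) * \<zeta> ^ i) = 0" "i < deg"
  shows "c i = 0"
proof (rule padic_int_eq_0_if_dvd)
  fix N
  have "\<forall>c. (\<Sum>i<deg. zp_embed (c i) * \<zeta> ^ i) = 0 \<longrightarrow> (\<forall>i<deg. of_nat CARD('p) ^ N dvd c i)"
  proof (induction N)
    case (Suc N)
    show ?case
    proof (intro allI impI)
      fix c i assume c: "(\<Sum>i<deg. zp_embed (c i) * \<zeta> ^ i) = 0" and i: "i < deg"
      have "\<forall>i\<in>{..<deg}. \<exists>e. c i = of_nat CARD('p) * e"
        using residue_independent[OF le_refl, of c] c pcong_refl by (auto simp: dvd_def)
      then obtain e where e: "\<forall>i\<in>{..<deg}. c i = of_nat CARD('p) * e i" by (rule bchoice[THEN exE])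
      have "(\<Sum>i<deg. zp_embed (c i) * \<zeta> ^ i) = P * (\<Sum>i<deg. zp_embed (e i) * \<zeta> ^ i)"
        unfolding sum_distrib_left
        by (rule sum.cong[OF refl]) (use e in \<open>simp add: zp_embed_mult mult.assoc\<close>)
      then have "(\<Sum>i<deg. zp_embed (e i) * \<zeta> ^ i) = 0" using c by simp
      then have "of_nat CARD('p) ^ N dvd e i" using Suc i by blast
      then show "of_nat CARD('p) ^ Suc N dvd c i" using e i by (simp add: mult_dvd_mono)
    qed
  qed simp
  then show "of_nat CARD('p) ^ N dvd c i" using assms by blast
qed

end

section \<open>Evaluation of polynomials over Q_p in the closure\<close>

interpretation to_ac_hom: inj_idom_hom "to_ac :: 'a :: field \<Rightarrow> 'a alg_closure"
  by unfold_locales auto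

interpretation to_ac_poly: map_poly_inj_idom_hom "to_ac :: 'a :: field \<Rightarrow> 'a alg_closure" ..

definition ac_eval :: "'a :: field poly \<Rightarrow> 'a alg_closure \<Rightarrow> 'a alg_closure" where
  "ac_eval P y = poly (map_poly to_ac P) y"

lemma ac_eval_0 [simp]: "ac_eval 0 y = 0"
  and ac_eval_1 [simp]: "ac_eval 1 y = 1"
  and ac_eval_add: "ac_eval (P + Q) y = ac_eval P y + ac_eval Q y"
  and ac_eval_diff: "ac_eval (P - Q) y = ac_eval P y - ac_eval Q y"
  and ac_eval_mult: "ac_eval (P * Q) y = ac_eval P y * ac_eval Q y"
  and ac_eval_smult: "ac_eval (Polynomial.smult c P) y = to_ac c * ac_eval P y"
  and ac_eval_monom: "ac_eval (Polynomial.monom c n) y = to_ac c * y ^ n"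
  by (simp_all add: ac_eval_def to_ac_poly.hom_add to_ac_poly.hom_minus to_ac_poly.hom_mult
      to_ac_hom.map_poly_hom_smult poly_monom)

lemma ac_eval_sum: "ac_eval (\<Sum>i\<in>I. F i) y = (\<Sum>i\<in>I. ac_eval (F i) y)"
  by (induction I rule: infinite_finite_induct) (simp_all add: ac_eval_add)

lemma ac_eval_lessThan:
  assumes "\<And>i. i \<ge> n \<Longrightarrow> poly.coeff P i = 0"
  shows "ac_eval P y = (\<Sum>i<n. to_ac (poly.coeff P i) * y ^ i)"
proof -
  have "P = (\<Sum>i<n. Polynomial.monom (poly.coeff P i) i)"
    by (rule poly_eqI) (use assms in \<open>auto simp: coeff_sum not_less\<close>)
  then have "ac_eval P y = ac_eval (\<Sum>i<n. Polynomial.monom (poly.coeff P i) i) y" by simp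
  then show ?thesis by (simp only: ac_eval_sum ac_eval_monom)
qed

lemma (in Modules.module) span_image_sum:
  assumes "finite I" "x \<in> span (f ` I)"
  shows "\<exists>c. x = (\<Sum>i\<in>I. scale (c i) (f i))"
  using assms(2)
proof (induction rule: span_induct_alt)
  case base
  show ?case by (rule exI[of _ "\<lambda>_. 0"]) simp
next
  case (step c v y)
  then obtain e j where j: "j \<in> I" "v = f j" and e: "y = (\<Sum>i\<in>I. scale (e i) (f i))" by blast
  have "scale c v = (\<Sum>i\<in>I. scale (if i = j then c else 0) (f i))"
    using j assms(1) by (subst sum.remove[of _ j]) auto
  then have "scale c v + y = (\<Sum>i\<in>I. scale ((if i = j then c else 0) + e i) (f i))"
    unfolding e by (simp only: scale_left_distrib sum.distrib)
  then show ?case by (rule exI[of _ "\<lambda>i. (if i = j then c else 0) + e i"])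
qed

context mu_generator
begin

definition rel :: "nat \<Rightarrow> 'p padic_int" where
  "rel = (SOME c. \<zeta> ^ deg = (\<Sum>i<deg. zp_embed (c i) * \<zeta> ^ i))"

lemma rel: "\<zeta> ^ deg = (\<Sum>i<deg. zp_embed (rel i) * \<zeta> ^ i)"
proof -
  have "\<zeta> ^ deg \<in> zp_mod.span zeta_powers"
    using power_in[OF zeta_in] unfolding mu_ring_span_powers .
  then have "\<exists>c. \<zeta> ^ deg = (\<Sum>i<deg. zp_embed (c i) * \<zeta> ^ i)"
    by (rule zp_mod.span_image_sum[OF finite_lessThan])
  then show ?thesis unfolding rel_def by (rule someI_ex)
qed

text \<open>The coefficients lie in Z_p, as the Frobenius congruence demands, but are viewed in Q_p,
  where division with remainder is available.\<close>

definition minpoly :: "'p padic poly" where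
  "minpoly = Polynomial.monom 1 deg - (\<Sum>i<deg. Polynomial.monom (Fract (rel i) 1) i)"

lemma coeff_minpoly:
  "poly.coeff minpoly i = (if i < deg then - Fract (rel i) 1 else if i = deg then 1 else 0)"
  by (auto simp: minpoly_def coeff_sum)

lemma degree_minpoly: "Polynomial.degree minpoly = deg"
proof (rule antisym)
  show "Polynomial.degree minpoly \<le> deg" by (rule degree_le) (simp add: coeff_minpoly)
  show "deg \<le> Polynomial.degree minpoly" by (rule le_degree) (simp add: coeff_minpoly)
qed

lemma minpoly_nonzero: "minpoly \<noteq> 0"
proof
  assume "minpoly = 0"
  then show False using coeff_minpoly[of deg] by simp
qed

lemma ac_eval_minpoly: "ac_eval minpoly y = y ^ deg - (\<Sum>i<deg. zp_embed (rel i) * y ^ i)"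
  unfolding minpoly_def ac_eval_diff ac_eval_sum ac_eval_monom to_ac_Fract_1 by simp

lemma eval_zero_small_degree:
  assumes "\<And>i. i \<ge> deg \<Longrightarrow> poly.coeff F i = 0" "ac_eval F \<zeta> = 0"
  shows "F = 0"
proof -
  have "\<forall>i. \<exists>k z. of_nat CARD('p) ^ k * to_ac (poly.coeff F i) = zp_embed z"
    using padic_denominator by metis
  then obtain k where "\<forall>i. \<exists>z. of_nat CARD('p) ^ k i * to_ac (poly.coeff F i) = zp_embed z"
    by (rule choice[THEN exE])
  then obtain z where kz: "\<forall>i. of_nat CARD('p) ^ k i * to_ac (poly.coeff F i) = zp_embed (z i)"
    by (rule choice[THEN exE])
  define K where "K = (\<Sum>i<deg. k i)"
  define e where "e i = of_nat CARD('p) ^ (K - k i) * z i" for i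
  have e: "zp_embed (e i) = of_nat CARD('p) ^ K * to_ac (poly.coeff F i)" if "i < deg" for i
  proof -
    have "k i \<le> K" unfolding K_def by (rule member_le_sum) (use that in auto)
    then have "(of_nat CARD('p) :: 'p padic_closure) ^ K = of_nat CARD('p) ^ (K - k i) * of_nat CARD('p) ^ k i"
      by (simp flip: power_add)
    then have "of_nat CARD('p) ^ K * to_ac (poly.coeff F i) = of_nat CARD('p) ^ (K - k i) * zp_embed (z i)"
      by (simp only: mult.assoc kz[rule_format])
    then show ?thesis unfolding e_def by (simp only: zp_embed_mult zp_embed.hom_power zp_embed_of_nat)
  qed
  have "(\<Sum>i<deg. zp_embed (e i) * \<zeta> ^ i) = of_nat CARD('p) ^ K * (\<Sum>i<deg. to_ac (poly.coeff F i) * \<zeta> ^ i)"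
    unfolding sum_distrib_left by (rule sum.cong[OF refl]) (simp only: e mult.assoc lessThan_iff)
  also have "\<dots> = 0" using ac_eval_lessThan[OF assms(1), of deg] assms(2) by simp
  finally have e0: "e i = 0" if "i < deg" for i using independent_over_zp that by blast
  show "F = 0"
  proof (rule poly_eqI)
    fix i
    show "poly.coeff F i = poly.coeff 0 i"
    proof (cases "i < deg")
      case True
      then have "of_nat CARD('p) ^ K * to_ac (poly.coeff F i) = 0" using e[OF True] e0[OF True] by simp
      then show ?thesis by simp
    qed (use assms(1) in simp)
  qed
qed

lemma minpoly_dvd:
  assumes "ac_eval F \<zeta> = 0"
  shows "minpoly dvd F"
proof -
  have "ac_eval minpoly \<zeta> = 0" unfolding ac_eval_minpoly using rel by simp
  moreover have "F = minpoly * (F div minpoly) + F mod minpoly" by simp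
  ultimately have "ac_eval (F mod minpoly) \<zeta> = 0"
    using assms ac_eval_add[of "minpoly * (F div minpoly)" "F mod minpoly"] by (simp add: ac_eval_mult)
  moreover have "poly.coeff (F mod minpoly) i = 0" if "i \<ge> deg" for i
  proof (cases "F mod minpoly = 0")
    case False
    then have "Polynomial.degree (F mod minpoly) < deg"
      using degree_mod_less[OF minpoly_nonzero, of F] degree_minpoly by simp
    then show ?thesis using that by (intro coeff_eq_0) simp
  qed simp
  ultimately have "F mod minpoly = 0" by (intro eval_zero_small_degree)
  then show ?thesis by (rule mod_0_imp_dvd)
qed

lemma pcong_freshman_sum:
  assumes "finite I" "\<And>i. i \<in> I \<Longrightarrow> F i \<in> mu_ring m"
  shows "pcong 1 ((\<Sum>i\<in>I. F i) ^ CARD('p)) (\<Sum>i\<in>I. F i ^ CARD('p))"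
  using assms
proof (induction I rule: finite_induct)
  case empty
  then show ?case using prime_gt_0_nat[OF prime_card[where 'a = 'p]] by (simp add: power_0_left)
next
  case (insert j I)
  have "pcong 1 ((F j + (\<Sum>i\<in>I. F i)) ^ CARD('p)) (F j ^ CARD('p) + (\<Sum>i\<in>I. F i) ^ CARD('p))"
    using insert.prems by (intro pcong_freshman_prime sum_in) auto
  moreover have "pcong 1 (F j ^ CARD('p) + (\<Sum>i\<in>I. F i) ^ CARD('p)) (F j ^ CARD('p) + (\<Sum>i\<in>I. F i ^ CARD('p)))"
    using insert by (intro pcong_add pcong_refl) simp
  ultimately show ?case using insert.hyps pcong_trans by simp
qed

text \<open>Modulo \<open>p\<close>, the \<open>p\<close>-th power is additive and fixes Z_p, so it
  can be moved from the value to the argument.\<close>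

lemma minpoly_frobenius_pcong:
  assumes y: "y \<in> mu_ring m"
  shows "pcong 1 (ac_eval minpoly y ^ CARD('p)) (ac_eval minpoly (y ^ CARD('p)))"
proof -
  define e where "e i = (if i = deg then 1 else - rel i)" for i
  have ev: "ac_eval minpoly y = (\<Sum>i\<le>deg. zp_embed (e i) * y ^ i)" for y
    unfolding ac_eval_minpoly lessThan_Suc_atMost[symmetric] sum.lessThan_Suc
    by (simp add: e_def zp_embed_uminus sum_negf)
  have "pcong 1 ((\<Sum>i\<le>deg. zp_embed (e i) * y ^ i) ^ CARD('p)) (\<Sum>i\<le>deg. (zp_embed (e i) * y ^ i) ^ CARD('p))"
    by (rule pcong_freshman_sum) (auto intro!: mult_in embed_in power_in y)
  moreover have "pcong 1 (\<Sum>i\<le>deg. (zp_embed (e i) * y ^ i) ^ CARD('p)) (\<Sum>i\<le>deg. zp_embed (e i) * (y ^ CARD('p)) ^ i)"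
  proof (rule pcong_sum)
    fix i
    have "pcong 1 ((y ^ CARD('p)) ^ i * zp_embed (e i) ^ CARD('p)) ((y ^ CARD('p)) ^ i * zp_embed (e i))"
      using pcong_embed_frobenius[of "e i" 1] by (intro pcong_mult_left power_in y) simp
    moreover have "(zp_embed (e i) * y ^ i) ^ CARD('p) = (y ^ CARD('p)) ^ i * zp_embed (e i) ^ CARD('p)"
      by (simp only: power_mult_distrib power_mult[symmetric] mult.commute)
    ultimately show "pcong 1 ((zp_embed (e i) * y ^ i) ^ CARD('p)) (zp_embed (e i) * (y ^ CARD('p)) ^ i)"
      by (simp only: mult.commute)
  qed
  ultimately show ?thesis unfolding ev using pcong_trans by blast
qed

lemma minpoly_roots_in_mu:
  assumes "ac_eval minpoly x = 0"
  shows "x \<in> roots_of_unity (CARD('p) ^ m - 1)"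
proof -
  let ?n = "CARD('p) ^ m - 1"
  have "ac_eval (Polynomial.monom 1 ?n - 1) \<zeta> = 0"
    using zeta_in_mu by (simp add: ac_eval_diff ac_eval_monom roots_of_unity_iff)
  then have "minpoly dvd Polynomial.monom 1 ?n - 1" by (rule minpoly_dvd)
  then obtain h where "Polynomial.monom 1 ?n - 1 = minpoly * h" by (elim dvdE)
  then have "ac_eval (Polynomial.monom 1 ?n - 1) x = 0" using assms by (simp add: ac_eval_mult)
  then show ?thesis by (simp add: ac_eval_diff ac_eval_monom roots_of_unity_iff)
qed

text \<open>If $y^p$ were not a root, then the value of the minimal polynomial at $y^p$ would be a product
  of differences of incongruent roots of unity, hence a unit; but it is congruent to $0$.\<close>

lemma minpoly_root_frobenius:
  assumes y: "y \<in> roots_of_unity (CARD('p) ^ m - 1)" and root: "ac_eval minpoly y = 0"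
  shows "ac_eval minpoly (y ^ CARD('p)) = 0"
proof (rule ccontr)
  let ?n = "CARD('p) ^ m - 1"
  assume ne: "ac_eval minpoly (y ^ CARD('p)) \<noteq> 0"
  let ?G = "map_poly to_ac minpoly"
  have yp: "y ^ CARD('p) \<in> roots_of_unity ?n" by (rule roots_of_unity_power[OF y])
  have lc: "Polynomial.lead_coeff ?G = 1"
    by (simp add: degree_minpoly coeff_minpoly)
  have "?G \<noteq> 0" using minpoly_nonzero by simp
  then obtain A where A: "?G = Polynomial.smult (Polynomial.lead_coeff ?G) (\<Prod>x\<in>#A. [:- x, 1:])"
    using alg_closed_imp_factorization by blast
  then have A: "?G = (\<Prod>x\<in>#A. [:- x, 1:])" unfolding lc by simp
  have eval: "ac_eval minpoly z = (\<Prod>x\<in>#A. z - x)" for z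
    unfolding ac_eval_def A poly_prod_mset by (simp add: image_mset.compositionality comp_def)
  have unit: "\<not> pcong 1 (y ^ CARD('p) - x) 0 \<and> y ^ CARD('p) - x \<in> mu_ring m" if x: "x \<in># A" for x
  proof -
    have "ac_eval minpoly x = 0" unfolding eval using x by (auto simp: prod_mset_zero_iff)
    then have xm: "x \<in> roots_of_unity ?n" by (rule minpoly_roots_in_mu)
    have "y ^ CARD('p) \<noteq> x" using ne \<open>ac_eval minpoly x = 0\<close> by blast
    moreover have "CARD('p) dvd Suc ?n" using order_pos r_dvd by simp
    ultimately have nc: "\<not> integers.pcong 1 (y ^ CARD('p)) x"
      using roots_of_unity_incongruent[OF _ order_pos yp xm] by blast
    have "\<not> pcong 1 (y ^ CARD('p) - x) 0"
    proof
      assume "pcong 1 (y ^ CARD('p) - x) 0"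
      then have "pcong 1 (y ^ CARD('p)) x" unfolding pcong_def by simp
      then show False using nc pcong_integers by blast
    qed
    then show ?thesis using yp xm mu_in diff_in by blast
  qed
  have "(\<exists>v\<in>mu_ring m. (\<Prod>x\<in>#B. y ^ CARD('p) - x) * v = 1) \<and> (\<Prod>x\<in>#B. y ^ CARD('p) - x) \<in> mu_ring m"
    if "B \<subseteq># A" for B
    using that
  proof (induction B)
    case (add x B)
    have "x \<in># A" using mset_subset_eqD[OF add.prems, of x] by simp
    then obtain u where u: "u \<in> mu_ring m" "(y ^ CARD('p) - x) * u = 1"
      using unit_iff[of "y ^ CARD('p) - x"] unit by blast
    have "B \<subseteq># A" using add.prems by (rule subset_mset.order_trans[rotated]) simp
    then obtain v where v: "v \<in> mu_ring m" "(\<Prod>x\<in>#B. y ^ CARD('p) - x) * v = 1"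
        "(\<Prod>x\<in>#B. y ^ CARD('p) - x) \<in> mu_ring m" using add.IH by blast
    have "(\<Prod>x\<in>#add_mset x B. y ^ CARD('p) - x) * (u * v) =
        ((y ^ CARD('p) - x) * u) * ((\<Prod>x\<in>#B. y ^ CARD('p) - x) * v)"
      by (simp only: image_mset_add_mset prod_mset.add_mset ac_simps)
    also have "\<dots> = 1" unfolding u(2) v(2) by simp
    finally have "(\<Prod>x\<in>#add_mset x B. y ^ CARD('p) - x) * (u * v) = 1" .
    moreover have "u * v \<in> mu_ring m" by (rule mult_in[OF u(1) v(1)])
    moreover have "(\<Prod>x\<in>#add_mset x B. y ^ CARD('p) - x) \<in> mu_ring m"
      using mult_in[OF _ v(3), of "y ^ CARD('p) - x"] unit[OF \<open>x \<in># A\<close>] by simp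
    ultimately show ?case by blast
  qed auto
  then have "\<not> pcong 1 (ac_eval minpoly (y ^ CARD('p))) 0"
    using unit_iff[of "ac_eval minpoly (y ^ CARD('p))"] unfolding eval by blast
  moreover have "pcong 1 (0 ^ CARD('p)) (ac_eval minpoly (y ^ CARD('p)))"
    using minpoly_frobenius_pcong[of y] y mu_in root by auto
  then have "pcong 1 (ac_eval minpoly (y ^ CARD('p))) 0"
    using prime_gt_0_nat[OF prime_card[where 'a = 'p]] pcong_sym by (simp add: power_0_left)
  ultimately show False by blast
qed

definition conj :: "nat \<Rightarrow> 'p padic_closure" where "conj i = \<zeta> ^ (CARD('p) ^ i)"

lemma conj_root: "ac_eval minpoly (conj i) = 0"
proof (induction i)
  case 0
  show ?case unfolding ac_eval_minpoly using rel by (simp add: conj_def)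
next
  case (Suc i)
  have "conj (Suc i) = conj i ^ CARD('p)"
    unfolding conj_def by (simp only: power_Suc2 power_mult)
  then show ?case
    using minpoly_root_frobenius[OF _ Suc] roots_of_unity_power[OF zeta_in_mu] by (simp add: conj_def)
qed

lemma conj_inj: "inj_on conj {..<m}"
proof (rule inj_onI)
  have main: "i = j" if "i \<le> j" "j < m" "conj i = conj j" for i j
  proof -
    have p1: "CARD('p) > 1" by (rule prime_gt_1_nat[OF prime_card])
    have le: "CARD('p) ^ i \<le> CARD('p) ^ j" using that(1) p1 by (intro power_increasing) auto
    have "CARD('p) ^ j < CARD('p) ^ m" using that(2) p1 by (intro power_strict_increasing)
    moreover have "CARD('p) ^ i \<ge> 1" using p1 by (intro one_le_power) simp
    moreover have "a - b < c - 1" if "a < c" "b \<ge> 1" "b \<le> a" for a b c :: nat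
      using that by arith
    ultimately have "CARD('p) ^ j - CARD('p) ^ i < CARD('p) ^ m - 1" using le by blast
    then have "CARD('p) ^ i = CARD('p) ^ j"
      using zeta_power_inj[OF le] that(3) unfolding conj_def by blast
    then show ?thesis using power_inject_exp[OF p1, of i j] by (simp only:)
  qed
  fix i j assume ij: "i \<in> {..<m}" "j \<in> {..<m}" "conj i = conj j"
  show "i = j"
  proof (cases "i \<le> j")
    case True
    then show ?thesis using main ij by simp
  next
    case False
    then have "j \<le> i" by simp
    then have "j = i" using main ij by simp
    then show ?thesis ..
  qed
qed

lemma deg_eq: "deg = m"
proof (rule antisym[OF deg_le])
  let ?G = "map_poly to_ac minpoly"
  have G0: "?G \<noteq> 0" using minpoly_nonzero by simp
  have "conj ` {..<m} \<subseteq> {x. poly ?G x = 0}"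
    using conj_root unfolding ac_eval_def by blast
  then have "card (conj ` {..<m}) \<le> card {x. poly ?G x = 0}"
    by (rule card_mono[OF poly_roots_finite[OF G0]])
  also have "\<dots> \<le> Polynomial.degree ?G"
    by (rule card_poly_roots_bound[OF G0])
  finally show "m \<le> deg" using conj_inj by (simp add: card_image degree_minpoly)
qed

text \<open>A relation over Q_p for \<open>\<zeta>\<close> is a multiple of the minimal polynomial
  and thus holds for every conjugate; this stands in for the Galois action.\<close>

lemma conj_eval:
  assumes "ac_eval F \<zeta> = 0"
  shows "ac_eval F (conj i) = 0"
proof -
  obtain h where "F = minpoly * h" using minpoly_dvd[OF assms] by (elim dvdE)
  then show ?thesis using conj_root[of i] by (simp add: ac_eval_mult)
qed

end

section \<open>The trace of a sum of roots of unity\<close>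

lemma poly_lessThan:
  fixes Q :: "'a :: comm_ring_1 poly"
  assumes "\<And>i. i \<ge> n \<Longrightarrow> poly.coeff Q i = 0"
  shows "poly Q y = (\<Sum>i<n. poly.coeff Q i * y ^ i)"
proof -
  have "Q = (\<Sum>i<n. Polynomial.monom (poly.coeff Q i) i)"
    by (rule poly_eqI) (use assms in \<open>auto simp: coeff_sum not_less\<close>)
  then have "poly Q y = poly (\<Sum>i<n. Polynomial.monom (poly.coeff Q i) i) y" by simp
  then show ?thesis by (simp only: poly_sum poly_monom)
qed

text \<open>\<open>l i a\<close> is the coefficient of \<open>X^a\<close> in the \<open>i\<close>-th
  Lagrange basis polynomial, so \<open>l\<close> inverts the Vandermonde matrix on both sides. The
  second identity says that interpolating \<open>X^c\<close> gives \<open>X^c\<close> back: the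
  difference has degree below \<open>m\<close> and \<open>m\<close> roots.\<close>

lemma Lagrange_coefficients:
  fixes z :: "nat \<Rightarrow> 'a :: field"
  assumes inj: "inj_on z {..<m}"
  obtains l :: "nat \<Rightarrow> nat \<Rightarrow> 'a"
  where "\<And>i k. i < m \<Longrightarrow> k < m \<Longrightarrow> (\<Sum>a<m. l i a * z k ^ a) = (if i = k then 1 else 0)"
    and "\<And>a c. c < m \<Longrightarrow> (\<Sum>i<m. z i ^ c * l i a) = (if a = c then 1 else 0)"
proof -
  define N where "N i = (\<Prod>k\<in>{..<m} - {i}. [:- z k, 1:])" for i
  define Q where "Q i = Polynomial.smult (inverse (poly (N i) (z i))) (N i)" for i
  have NN: "poly (N i) (z i) \<noteq> 0" if "i < m" for i
    unfolding N_def poly_prod using inj that by (auto simp: inj_on_def)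
  have QD: "poly (Q i) (z k) = (if i = k then 1 else 0)" if "i < m" "k < m" for i k
  proof (cases "i = k")
    case True
    then show ?thesis using NN[OF that(1)] by (simp add: Q_def)
  next
    case False
    then have "poly (N i) (z k) = 0"
      unfolding N_def poly_prod using that by (intro prod_zero) auto
    then show ?thesis using False by (simp add: Q_def)
  qed
  have Qc: "poly.coeff (Q i) a = 0" if "i < m" "a \<ge> m" for i a
  proof -
    have "Polynomial.degree (N i) \<le> (\<Sum>k\<in>{..<m} - {i}. Polynomial.degree [:- z k, 1:])"
      unfolding N_def using degree_prod_sum_le[of "{..<m} - {i}" "\<lambda>k. [:- z k, 1:]"] by (simp add: comp_def)
    also have "\<dots> = m - 1" using that(1) by simp
    finally have "Polynomial.degree (N i) < a" using that by linarith
    then show ?thesis by (simp add: Q_def coeff_eq_0)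
  qed
  show ?thesis
  proof (rule that[of "\<lambda>i a. poly.coeff (Q i) a"])
    fix i k assume "i < m" "k < m"
    then show "(\<Sum>a<m. poly.coeff (Q i) a * z k ^ a) = (if i = k then 1 else 0)"
      using poly_lessThan[of m "Q i" "z k"] Qc QD by simp
  next
    fix a c assume c: "c < m"
    define D where "D = (\<Sum>i<m. Polynomial.smult (z i ^ c) (Q i)) - Polynomial.monom 1 c"
    have Dz: "poly D (z k) = 0" if "k < m" for k
    proof -
      have "(\<Sum>i<m. z i ^ c * poly (Q i) (z k)) = (\<Sum>i<m. if i = k then z k ^ c else 0)"
        by (rule sum.cong) (use QD that in auto)
      then show ?thesis using that by (simp add: D_def poly_sum poly_monom)
    qed
    have Dc: "poly.coeff D b = (\<Sum>i<m. z i ^ c * poly.coeff (Q i) b) - (if c = b then 1 else 0)" for b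
      by (simp add: D_def coeff_sum)
    have "D = 0"
    proof (rule ccontr)
      assume D0: "D \<noteq> 0"
      have "m = card (z ` {..<m})" using inj by (simp add: card_image)
      also have "\<dots> \<le> card {x. poly D x = 0}"
        by (rule card_mono[OF poly_roots_finite[OF D0]]) (use Dz in auto)
      also have "\<dots> \<le> Polynomial.degree D" by (rule card_poly_roots_bound[OF D0])
      also have "\<dots> < m"
      proof -
        have "Polynomial.degree D \<le> m - 1"
          by (rule degree_le) (use Qc c in \<open>auto simp: Dc\<close>)
        then show ?thesis using c by simp
      qed
      finally show False by simp
    qed
    then show "(\<Sum>i<m. z i ^ c * poly.coeff (Q i) a) = (if a = c then 1 else 0)"
      using Dc[of a] by auto
  qed
qed

context mu_generator
begin

lemma mu_field_span_powers: "mu_field m = padic_vs.span zeta_powers"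
proof (rule Set.set_eqI)
  fix x
  show "x \<in> mu_field m \<longleftrightarrow> x \<in> padic_vs.span zeta_powers"
    unfolding mu_field_iff padic_span_iff mu_ring_span_powers ..
qed

lemma mu_field_poly:
  assumes "x \<in> mu_field m"
  obtains F where "\<And>i. i \<ge> m \<Longrightarrow> poly.coeff F i = 0" "ac_eval F \<zeta> = x"
proof -
  have "x \<in> padic_vs.span zeta_powers" using assms unfolding mu_field_span_powers .
  then have "\<exists>c. x = (\<Sum>i<deg. to_ac (c i) * \<zeta> ^ i)"
    by (rule padic_vs.span_image_sum[OF finite_lessThan])
  then obtain c where c: "x = (\<Sum>i<m. to_ac (c i) * \<zeta> ^ i)" unfolding deg_eq by blast
  let ?F = "\<Sum>i<m. Polynomial.monom (c i) i"
  have "ac_eval ?F \<zeta> = x" unfolding ac_eval_sum ac_eval_monom c ..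
  moreover have "poly.coeff ?F i = 0" if "i \<ge> m" for i using that by (simp add: coeff_sum)
  ultimately show ?thesis using that by blast
qed

lemma ac_eval_in_mu_field: "ac_eval F \<zeta> \<in> mu_field m"
proof -
  have "ac_eval F \<zeta> = (\<Sum>i<Suc (Polynomial.degree F). to_ac (poly.coeff F i) * \<zeta> ^ i)"
    by (rule ac_eval_lessThan) (simp add: coeff_eq_0)
  also have "\<dots> \<in> mu_field m"
    unfolding mu_field_def
    by (intro padic_vs.span_sum padic_vs.span_scale padic_vs.span_base roots_of_unity_power zeta_in_mu)
  finally show ?thesis .
qed

text \<open>Stated for every basis, as \<open>field_trace\<close> works with an unspecified one. Let
  \<open>E\<close> be the matrix of the conjugates of the basis elements. The matrix
  \<open>?M\<close> of multiplication satisfies \<open>?M E = E \<Delta>\<close>, where the diagonal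
  matrix \<open>\<Delta>\<close> holds the conjugates of the multiplier; the trace follows once
  \<open>E\<close> is inverted.\<close>

lemma trace_in_basis:
  assumes B: "padic_vs.independent B" "padic_vs.span B = mu_field m"
  shows "to_ac (\<Sum>b\<in>B. padic_vs.representation B (ac_eval F \<zeta> * b) b) = (\<Sum>i<m. ac_eval F (conj i))"
proof -
  have finB: "finite B"
    using padic_vs.independent_span_bound[OF finite_generators B(1)] padic_vs.span_superset[of B]
    unfolding B(2) mu_field_def by blast
  define rep where "rep = padic_vs.representation B"
  have BK: "B \<subseteq> mu_field m" using padic_vs.span_superset[of B] unfolding B(2) .
  have expand: "x = (\<Sum>b\<in>B. to_ac (rep x b) * b)" if "x \<in> mu_field m" for x
    using padic_vs.sum_representation_eq[OF B(1) _ finB order_refl, of x] that unfolding B(2) rep_def by simp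
  have "\<forall>b\<in>B. \<exists>G. (\<forall>i\<ge>m. poly.coeff G i = 0) \<and> ac_eval G \<zeta> = b"
    using mu_field_poly BK by (metis subsetD)
  then obtain G where G: "\<forall>b\<in>B. (\<forall>i\<ge>m. poly.coeff (G b) i = 0) \<and> ac_eval (G b) \<zeta> = b"
    by (rule bchoice[THEN exE])
  obtain l where l1: "\<And>i k. i < m \<Longrightarrow> k < m \<Longrightarrow> (\<Sum>a<m. l i a * conj k ^ a) = (if i = k then 1 else 0)"
    and l2: "\<And>a c. c < m \<Longrightarrow> (\<Sum>i<m. conj i ^ c * l i a) = (if a = c then 1 else 0)"
    using Lagrange_coefficients[OF conj_inj] by blast
  \<comment> \<open>\<open>W\<close> is the inverse of \<open>E\<close>: the inverse Vandermonde
    matrix followed by the change from powers of \<open>\<zeta>\<close> to \<open>B\<close>. The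
    identities \<open>left\<close> and \<open>right\<close> are each proved directly, without
    comparing the size of \<open>B\<close> with \<open>m\<close>.\<close>
  define W where "W i b = (\<Sum>a<m. l i a * to_ac (rep (\<zeta> ^ a) b))" for i b
  \<comment> \<open>The expansion in \<open>B\<close> is a linear relation over Q_p and survives
    replacing \<open>\<zeta>\<close> by a conjugate.\<close>
  have transfer: "ac_eval H (conj k) = (\<Sum>b\<in>B. to_ac (rep (ac_eval H \<zeta>) b) * ac_eval (G b) (conj k))" for H k
  proof -
    let ?D = "H - (\<Sum>b\<in>B. Polynomial.smult (rep (ac_eval H \<zeta>) b) (G b))"
    have "ac_eval ?D \<zeta> = ac_eval H \<zeta> - (\<Sum>b\<in>B. to_ac (rep (ac_eval H \<zeta>) b) * b)"
      unfolding ac_eval_diff ac_eval_sum ac_eval_smult using G by simp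
    also have "\<dots> = 0" using expand[OF ac_eval_in_mu_field[of H]] by simp
    finally have "ac_eval ?D (conj k) = 0" by (rule conj_eval)
    then show ?thesis unfolding ac_eval_diff ac_eval_sum ac_eval_smult by simp
  qed
  have left: "(\<Sum>b\<in>B. W i b * ac_eval (G b) (conj k)) = (if i = k then 1 else 0)" if "i < m" "k < m" for i k
  proof -
    have "(\<Sum>b\<in>B. W i b * ac_eval (G b) (conj k)) =
        (\<Sum>b\<in>B. \<Sum>a<m. l i a * (to_ac (rep (\<zeta> ^ a) b) * ac_eval (G b) (conj k)))"
      unfolding W_def sum_distrib_right by (simp only: mult.assoc)
    also have "\<dots> = (\<Sum>a<m. \<Sum>b\<in>B. l i a * (to_ac (rep (\<zeta> ^ a) b) * ac_eval (G b) (conj k)))"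
      by (rule sum.swap)
    also have "\<dots> = (\<Sum>a<m. l i a * conj k ^ a)"
    proof (rule sum.cong[OF refl])
      fix a
      show "(\<Sum>b\<in>B. l i a * (to_ac (rep (\<zeta> ^ a) b) * ac_eval (G b) (conj k))) = l i a * conj k ^ a"
        using transfer[of "Polynomial.monom 1 a" k] by (simp add: ac_eval_monom flip: sum_distrib_left)
    qed
    finally show ?thesis using l1[OF that] by (simp only:)
  qed
  have right: "(\<Sum>i<m. ac_eval (G b') (conj i) * W i b) = (if b = b' then 1 else 0)" if b': "b' \<in> B" for b b'
  proof -
    let ?c = "poly.coeff (G b')"
    have ev: "ac_eval (G b') y = (\<Sum>c<m. to_ac (?c c) * y ^ c)" for y
      by (rule ac_eval_lessThan) (use G b' in blast)
    have "(\<Sum>i<m. ac_eval (G b') (conj i) * W i b) =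
        (\<Sum>i<m. \<Sum>c<m. \<Sum>a<m. to_ac (?c c) * to_ac (rep (\<zeta> ^ a) b) * (conj i ^ c * l i a))"
      unfolding ev W_def sum_product by (intro sum.cong refl) (simp only: ac_simps)
    also have "\<dots> = (\<Sum>c<m. \<Sum>i<m. \<Sum>a<m. to_ac (?c c) * to_ac (rep (\<zeta> ^ a) b) * (conj i ^ c * l i a))"
      by (rule sum.swap)
    also have "\<dots> = (\<Sum>c<m. \<Sum>a<m. \<Sum>i<m. to_ac (?c c) * to_ac (rep (\<zeta> ^ a) b) * (conj i ^ c * l i a))"
      by (intro sum.cong refl sum.swap)
    also have "\<dots> = (\<Sum>c<m. \<Sum>a<m. to_ac (?c c) * to_ac (rep (\<zeta> ^ a) b) * (if a = c then 1 else 0))"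
      by (intro sum.cong refl) (simp add: l2 flip: sum_distrib_left)
    also have "\<dots> = (\<Sum>c<m. \<Sum>a<m. if a = c then to_ac (?c c) * to_ac (rep (\<zeta> ^ c) b) else 0)"
      by (intro sum.cong refl) auto
    also have "\<dots> = (\<Sum>c<m. to_ac (?c c) * to_ac (rep (\<zeta> ^ c) b))"
      by (intro sum.cong refl) simp
    also have "\<dots> = to_ac (\<Sum>c<m. ?c c * rep (\<zeta> ^ c) b)" by (simp add: to_ac_sum)
    also have "(\<Sum>c<m. ?c c * rep (\<zeta> ^ c) b) = rep (\<Sum>c<m. to_ac (?c c) * \<zeta> ^ c) b"
    proof -
      have zK: "\<zeta> ^ c \<in> padic_vs.span B" for c
        unfolding B(2) mu_field_def by (intro padic_vs.span_base roots_of_unity_power zeta_in_mu)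
      have "rep (\<Sum>c<m. to_ac (?c c) * \<zeta> ^ c) b = (\<Sum>c<m. rep (to_ac (?c c) * \<zeta> ^ c) b)"
        unfolding rep_def using padic_vs.representation_sum[OF B(1), of "{..<m}" "\<lambda>c. to_ac (?c c) * \<zeta> ^ c"]
          padic_vs.span_scale[OF zK] by (simp only:)
      moreover have "rep (to_ac (?c c) * \<zeta> ^ c) b = ?c c * rep (\<zeta> ^ c) b" for c
        unfolding rep_def using padic_vs.representation_scale[OF B(1) zK, of "?c c" c] by (simp only:)
      ultimately show ?thesis by (simp only:)
    qed
    also have "(\<Sum>c<m. to_ac (?c c) * \<zeta> ^ c) = b'" using ev[of \<zeta>] G b' by simp
    finally show ?thesis unfolding rep_def using padic_vs.representation_basis[OF B(1) b'] by simp
  qed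
  let ?M = "\<lambda>b b'. to_ac (rep (ac_eval F \<zeta> * b) b')"
  have mat: "(\<Sum>b'\<in>B. ?M b b' * ac_eval (G b') (conj i)) = ac_eval F (conj i) * ac_eval (G b) (conj i)"
    if "b \<in> B" for b i
    using transfer[of "F * G b" i] G that by (simp add: ac_eval_mult)
  have "to_ac (\<Sum>b\<in>B. rep (ac_eval F \<zeta> * b) b) = (\<Sum>b\<in>B. ?M b b)" by (rule to_ac_sum)
  also have "\<dots> = (\<Sum>b\<in>B. \<Sum>b'\<in>B. ?M b b' * (if b = b' then 1 else 0))"
    using finB by (intro sum.cong refl) (simp add: if_distrib[of "\<lambda>x. _ * x"] cong: if_cong)
  also have "\<dots> = (\<Sum>b\<in>B. \<Sum>b'\<in>B. ?M b b' * (\<Sum>i<m. ac_eval (G b') (conj i) * W i b))"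
    by (intro sum.cong refl) (simp only: right)
  also have "\<dots> = (\<Sum>b\<in>B. \<Sum>b'\<in>B. \<Sum>i<m. ?M b b' * ac_eval (G b') (conj i) * W i b)"
    by (simp only: sum_distrib_left mult.assoc)
  also have "\<dots> = (\<Sum>b\<in>B. \<Sum>i<m. \<Sum>b'\<in>B. ?M b b' * ac_eval (G b') (conj i) * W i b)"
    by (intro sum.cong refl sum.swap)
  also have "\<dots> = (\<Sum>b\<in>B. \<Sum>i<m. ac_eval F (conj i) * ac_eval (G b) (conj i) * W i b)"
    by (intro sum.cong refl) (simp only: sum_distrib_right[symmetric] mat)
  also have "\<dots> = (\<Sum>i<m. \<Sum>b\<in>B. ac_eval F (conj i) * ac_eval (G b) (conj i) * W i b)"
    by (rule sum.swap)
  also have "\<dots> = (\<Sum>i<m. ac_eval F (conj i) * (\<Sum>b\<in>B. W i b * ac_eval (G b) (conj i)))"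
    by (intro sum.cong refl) (simp only: sum_distrib_left ac_simps)
  also have "\<dots> = (\<Sum>i<m. ac_eval F (conj i))"
    by (intro sum.cong refl) (simp add: left)
  finally show ?thesis unfolding rep_def .
qed

lemma field_trace_eval:
  "to_ac (field_trace (mu_field m) (ac_eval F \<zeta>)) = (\<Sum>i<m. ac_eval F (conj i))"
proof -
  let ?Q = "\<lambda>B. padic_vs.independent B \<and> padic_vs.span B = (mu_field m :: 'p padic_closure set)"
  have "\<exists>B. ?Q B"
  proof (rule padic_vs.basis_exists[of "mu_field m :: 'p padic_closure set"])
    fix B :: "'p padic_closure set"
    assume B: "B \<subseteq> mu_field m" "padic_vs.independent B" "mu_field m \<subseteq> padic_vs.span B"
    have "padic_vs.span (mu_field m) = (mu_field m :: 'p padic_closure set)"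
      unfolding mu_field_def by (rule padic_vs.span_span)
    then have "padic_vs.span B \<subseteq> mu_field m" using padic_vs.span_mono[OF B(1)] by (simp only:)
    then have "padic_vs.span B = mu_field m" using B(3) by (rule subset_antisym)
    with B(2) show "\<exists>B. ?Q B" by (intro exI[of _ B] conjI)
  qed
  then have "?Q (SOME B. ?Q B)" by (rule someI_ex)
  from trace_in_basis[OF conjunct1[OF this] conjunct2[OF this]]
  show ?thesis unfolding field_trace_def Let_def .
qed

end

theorem field_trace_sum_roots_of_unity:
  fixes w :: "'u \<Rightarrow> 'p :: prime_card padic_closure"
  assumes m: "m > 0" and w: "\<And>u. u \<in> U \<Longrightarrow> w u \<in> roots_of_unity (CARD('p) ^ m - 1)"
  shows "to_ac (field_trace (Q_unram (CARD('p) ^ m)) (\<Sum>u\<in>U. w u)) = (\<Sum>i<m. \<Sum>u\<in>U. w u ^ (CARD('p) ^ i))"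
proof -
  obtain \<zeta> :: "'p padic_closure" where "\<forall>k. \<zeta> ^ k = 1 \<longleftrightarrow> (CARD('p) ^ m - 1) dvd k"
    using primitive_root_of_unity_exists[OF CARD_power_minus_1_pos[OF m, where 'p = 'p]] by blast
  then interpret mu_generator m \<zeta>
    by unfold_locales (simp_all add: m)
  have "\<forall>u\<in>U. \<exists>j. w u = \<zeta> ^ j" using mu_is_power w by metis
  then obtain j where j: "\<forall>u\<in>U. w u = \<zeta> ^ j u" by (rule bchoice[THEN exE])
  let ?F = "\<Sum>u\<in>U. Polynomial.monom 1 (j u)"
  have "(\<Sum>u\<in>U. w u) = ac_eval ?F \<zeta>"
    unfolding ac_eval_sum ac_eval_monom using j by simp
  then have "to_ac (field_trace (Q_unram (CARD('p) ^ m)) (\<Sum>u\<in>U. w u)) = (\<Sum>i<m. ac_eval ?F (conj i))"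
    using field_trace_eval[of ?F] unfolding Q_unram_eq[OF m] by simp
  also have "\<dots> = (\<Sum>i<m. \<Sum>u\<in>U. w u ^ (CARD('p) ^ i))"
    unfolding ac_eval_sum ac_eval_monom
    by (intro sum.cong refl) (simp add: conj_def j mult.commute flip: power_mult)
  finally show ?thesis .
qed

section \<open>The characteristic power series of a matrix\<close>

lemma fps_deriv_prod:
  fixes g :: "'i \<Rightarrow> 'b :: comm_ring_1 fps"
  assumes "finite I"
  shows "fps_deriv (\<Prod>i\<in>I. g i) = (\<Sum>i\<in>I. fps_deriv (g i) * (\<Prod>j\<in>I - {i}. g j))"
  using assms
proof (induction I rule: finite_induct)
  case (insert a I)
  have "(\<Sum>i\<in>I. fps_deriv (g i) * (\<Prod>j\<in>insert a I - {i}. g j)) =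
      (\<Sum>i\<in>I. fps_deriv (g i) * (g a * (\<Prod>j\<in>I - {i}. g j)))"
  proof (rule sum.cong[OF refl])
    fix i assume "i \<in> I"
    then have "insert a I - {i} = insert a (I - {i})" using insert.hyps by auto
    then show "fps_deriv (g i) * (\<Prod>j\<in>insert a I - {i}. g j) = fps_deriv (g i) * (g a * (\<Prod>j\<in>I - {i}. g j))"
      using insert.hyps by simp
  qed
  also have "\<dots> = g a * (\<Sum>i\<in>I. fps_deriv (g i) * (\<Prod>j\<in>I - {i}. g j))"
    by (simp add: sum_distrib_left mult.left_commute)
  finally show ?case using insert by (simp add: algebra_simps)
qed simp

text \<open>The matrix \<open>1 - X A\<close>. Its determinant \<open>char_fps\<close>, a reversed
  characteristic polynomial, is kept as a power series so that it can be compared with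
  \<open>C_f\<close>.\<close>

definition char_matrix_fps :: "nat \<Rightarrow> (nat \<Rightarrow> nat \<Rightarrow> 'b :: comm_ring_1) \<Rightarrow> 'b fps mat" where
  "char_matrix_fps n A = Matrix.mat n n (\<lambda>(i, j). fps_const (if i = j then 1 else 0) - fps_X * fps_const (A i j))"

definition char_fps :: "nat \<Rightarrow> (nat \<Rightarrow> nat \<Rightarrow> 'b :: comm_ring_1) \<Rightarrow> 'b fps" where
  "char_fps n A = Determinant.det (char_matrix_fps n A)"

lemma char_matrix_fps_carrier [simp]: "char_matrix_fps n A \<in> carrier_mat n n"
  by (simp add: char_matrix_fps_def)

lemma char_matrix_fps_index [simp]:
  "i < n \<Longrightarrow> j < n \<Longrightarrow> char_matrix_fps n A $$ (i, j) = fps_const (if i = j then 1 else 0) - fps_X * fps_const (A i j)"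
  by (simp add: char_matrix_fps_def)


text \<open>Jacobi's formula: differentiating the Leibniz expansion row by row gives determinants of
  the matrices \<open>R i\<close>, and expanding along the differentiated row leaves cofactors of
  the original matrix.\<close>

lemma fps_deriv_char_fps_cofactor:
  fixes A :: "nat \<Rightarrow> nat \<Rightarrow> 'b :: comm_ring_1"
  shows "fps_deriv (char_fps n A) =
    (\<Sum>i<n. \<Sum>j<n. - fps_const (A i j) * cofactor (char_matrix_fps n A) i j)"
proof -
  let ?B = "char_matrix_fps n A"
  let ?U = "{p. p permutes {0..<n}}"
  have perm_less: "p i < n" if "p \<in> ?U" "i < n" for p i
    using that permutes_in_image[of p "{0..<n}" i] by simp
  have B: "char_fps n A = (\<Sum>p\<in>?U. signof p * (\<Prod>i\<in>{0..<n}. ?B $$ (i, p i)))"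
    unfolding char_fps_def by (rule det_def'[OF char_matrix_fps_carrier])
  have signof: "fps_deriv (signof p :: 'b fps) = 0" for p
    by (simp add: sign_def)
  define R where "R i = Matrix.mat n n (\<lambda>(k, j). if k = i then - fps_const (A i j) else ?B $$ (k, j))" for i
  have R: "R i \<in> carrier_mat n n" for i by (simp add: R_def)
  have "fps_deriv (char_fps n A) =
      (\<Sum>p\<in>?U. signof p * (\<Sum>i\<in>{0..<n}. - fps_const (A i (p i)) * (\<Prod>j\<in>{0..<n} - {i}. ?B $$ (j, p j))))"
    unfolding B fps_deriv_sum fps_deriv_mult signof fps_deriv_prod[OF finite_atLeastLessThan]
    using perm_less by (intro sum.cong refl) simp
  also have "\<dots> = (\<Sum>p\<in>?U. \<Sum>i\<in>{0..<n}. signof p * (- fps_const (A i (p i)) * (\<Prod>j\<in>{0..<n} - {i}. ?B $$ (j, p j))))"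
    by (simp only: sum_distrib_left)
  also have "\<dots> = (\<Sum>i\<in>{0..<n}. \<Sum>p\<in>?U. signof p * (- fps_const (A i (p i)) * (\<Prod>j\<in>{0..<n} - {i}. ?B $$ (j, p j))))"
    by (rule sum.swap)
  also have "\<dots> = (\<Sum>i\<in>{0..<n}. Determinant.det (R i))"
  proof (rule sum.cong[OF refl])
    fix i assume i: "i \<in> {0..<n}"
    show "(\<Sum>p\<in>?U. signof p * (- fps_const (A i (p i)) * (\<Prod>j\<in>{0..<n} - {i}. ?B $$ (j, p j)))) = Determinant.det (R i)"
      unfolding det_def'[OF R]
    proof (intro sum.cong refl arg_cong2[where f = "(*)"])
      fix p assume p: "p \<in> ?U"
      have "(\<Prod>k = 0..<n. R i $$ (k, p k)) = R i $$ (i, p i) * (\<Prod>k\<in>{0..<n} - {i}. R i $$ (k, p k))"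
        using i by (subst prod.remove[of _ i]) auto
      also have "(\<Prod>k\<in>{0..<n} - {i}. R i $$ (k, p k)) = (\<Prod>k\<in>{0..<n} - {i}. ?B $$ (k, p k))"
        by (rule prod.cong) (use perm_less[OF p] in \<open>auto simp: R_def\<close>)
      also have "R i $$ (i, p i) = - fps_const (A i (p i))"
        using i perm_less[OF p] by (simp add: R_def)
      finally show "- fps_const (A i (p i)) * (\<Prod>j\<in>{0..<n} - {i}. ?B $$ (j, p j)) = (\<Prod>k = 0..<n. R i $$ (k, p k))" ..
    qed
  qed
  also have "\<dots> = (\<Sum>i\<in>{0..<n}. \<Sum>j<n. - fps_const (A i j) * cofactor ?B i j)"
  proof (rule sum.cong[OF refl])
    fix i assume i: "i \<in> {0..<n}"
    have "mat_delete (R i) i j = mat_delete ?B i j" if "j < n" for j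
      by (rule eq_matI) (use that i in \<open>auto simp: mat_delete_def R_def char_matrix_fps_def\<close>)
    then have "cofactor (R i) i j = cofactor ?B i j" if "j < n" for j
      using that by (simp add: cofactor_def)
    then show "Determinant.det (R i) = (\<Sum>j<n. - fps_const (A i j) * cofactor ?B i j)"
      using i by (subst laplace_expansion_row[OF R, of i]) (auto intro!: sum.cong simp: R_def)
  qed
  finally show ?thesis by (simp only: atLeast0LessThan)
qed

text \<open>The identity between the logarithmic derivative of a characteristic determinant and the
  traces of powers, written without logarithms. The powers enter as any family \<open>pw\<close>
  with the right recursion, so that coefficients of an iterated convolution can be inserted
  directly.\<close>

lemma char_fps_deriv:
  fixes A :: "nat \<Rightarrow> nat \<Rightarrow> 'b :: comm_ring_1"
  assumes pw0: "\<And>i j. i < n \<Longrightarrow> j < n \<Longrightarrow> pw 0 i j = (if i = j then 1 else 0)"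
    and pwS: "\<And>k i j. i < n \<Longrightarrow> j < n \<Longrightarrow> pw (Suc k) i j = (\<Sum>l<n. A i l * pw k l j)"
  shows "fps_deriv (char_fps n A) = - (char_fps n A * Abs_fps (\<lambda>k. \<Sum>i<n. pw (Suc k) i i))"
proof -
  let ?B = "char_matrix_fps n A"
  \<comment> \<open>The geometric series of \<open>X A\<close>, inverse to \<open>1 - X A\<close>;
    the adjugate is the determinant times \<open>Q\<close>.\<close>
  define Q where "Q = Matrix.mat n n (\<lambda>(i, j). Abs_fps (\<lambda>k. pw k i j))"
  have Q: "Q \<in> carrier_mat n n" by (simp add: Q_def)
  have BQ: "?B * Q = 1\<^sub>m n"
  proof (rule eq_matI)
    fix i j assume ij: "i < dim_row (1\<^sub>m n :: 'b fps mat)" "j < dim_col (1\<^sub>m n :: 'b fps mat)"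
    then have ij: "i < n" "j < n" by simp_all
    have "(?B * Q) $$ (i, j) = (\<Sum>l = 0..<n. ?B $$ (i, l) * Q $$ (l, j))"
      using ij Q carrier_matD[OF char_matrix_fps_carrier[of n A]] by (simp add: scalar_prod_def)
    also have "\<dots> = (\<Sum>l = 0..<n. fps_const (if i = l then 1 else 0) * Q $$ (l, j) - fps_X * (fps_const (A i l) * Q $$ (l, j)))"
      using ij by (intro sum.cong refl) (simp add: algebra_simps)
    also have "\<dots> = (\<Sum>l = 0..<n. if i = l then Q $$ (l, j) else 0) - fps_X * (\<Sum>l = 0..<n. fps_const (A i l) * Q $$ (l, j))"
      unfolding sum_subtractf sum_distrib_left
      by (intro arg_cong2[where f = "(-)"] sum.cong refl) simp
    also have "(\<Sum>l = 0..<n. if i = l then Q $$ (l, j) else 0) = Q $$ (i, j)" using ij by simp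
    also have "Q $$ (i, j) - fps_X * (\<Sum>l = 0..<n. fps_const (A i l) * Q $$ (l, j)) = fps_const (if i = j then 1 else 0)"
    proof (rule fps_ext)
      fix k
      show "fps_nth (Q $$ (i, j) - fps_X * (\<Sum>l = 0..<n. fps_const (A i l) * Q $$ (l, j))) k =
          fps_nth (fps_const (if i = j then 1 else 0)) k"
        using ij by (cases k) (auto simp: Q_def fps_sum_nth pw0 pwS atLeast0LessThan)
    qed
    finally show "(?B * Q) $$ (i, j) = 1\<^sub>m n $$ (i, j)" using ij by simp
  qed (use Q carrier_matD[OF char_matrix_fps_carrier[of n A]] in auto)
  have "adj_mat ?B = adj_mat ?B * (?B * Q)"
    unfolding BQ by (rule right_mult_one_mat[OF adj_mat(1)[OF char_matrix_fps_carrier], symmetric])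
  also have "\<dots> = (adj_mat ?B * ?B) * Q"
    using assoc_mult_mat[OF adj_mat(1)[OF char_matrix_fps_carrier] char_matrix_fps_carrier Q] by simp
  also have "\<dots> = char_fps n A \<cdot>\<^sub>m Q"
    unfolding adj_mat(3)[OF char_matrix_fps_carrier] char_fps_def
    by (simp only: mult_smult_assoc_mat[OF one_carrier_mat Q] left_mult_one_mat[OF Q])
  finally have adj: "adj_mat ?B = char_fps n A \<cdot>\<^sub>m Q" .
  have cof: "cofactor ?B i j = char_fps n A * Abs_fps (\<lambda>k. pw k j i)" if "i < n" "j < n" for i j
  proof -
    have "cofactor ?B i j = adj_mat ?B $$ (j, i)"
      unfolding adj_mat_def using that carrier_matD[OF char_matrix_fps_carrier[of n A]] by simp
    then show ?thesis unfolding adj using that Q by (simp add: Q_def)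
  qed
  have "fps_deriv (char_fps n A) = (\<Sum>i<n. \<Sum>j<n. - (char_fps n A * (fps_const (A i j) * Abs_fps (\<lambda>k. pw k j i))))"
    unfolding fps_deriv_char_fps_cofactor 
    by (intro sum.cong refl) (simp only: lessThan_iff cof mult_minus_left mult.left_commute[of "char_fps n A"])
  also have "\<dots> = - (char_fps n A * (\<Sum>i<n. \<Sum>j<n. fps_const (A i j) * Abs_fps (\<lambda>k. pw k j i)))"
    by (simp only: sum_negf sum_distrib_left)
  also have "(\<Sum>i<n. \<Sum>j<n. fps_const (A i j) * Abs_fps (\<lambda>k. pw k j i)) = Abs_fps (\<lambda>k. \<Sum>i<n. pw (Suc k) i i)"
    by (rule fps_ext) (simp add: fps_sum_nth pwS)
  finally show ?thesis .
qed

lemma fps_const_prod: "(\<Prod>i\<in>I. fps_const (g i)) = fps_const (\<Prod>i\<in>I. g i)"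
  by (induction I rule: infinite_finite_induct) simp_all

text \<open>\<open>S\<close> collects the rows from which the term \<open>- X A\<close> is taken;
  the other rows contribute the identity, so only permutations fixing the complement of
  \<open>S\<close> survive. Orders of vanishing can then be estimated term by term.\<close>

lemma char_fps_nth:
  fixes A :: "nat \<Rightarrow> nat \<Rightarrow> 'a :: comm_ring_1"
  shows "fps_nth (char_fps n A) k = (\<Sum>p | p permutes {0..<n}. signof p *
    (\<Sum>S | S \<subseteq> {0..<n} \<and> card S = k. (\<Prod>i\<in>S. - A i (p i)) * (\<Prod>i\<in>{0..<n} - S. if i = p i then 1 else 0)))"
proof -
  let ?U = "{p. p permutes {0..<n}}"
  let ?I = "{0..<n}"
  have perm_less: "p i < n" if "p \<in> ?U" "i < n" for p i
    using that permutes_in_image[of p "{0..<n}" i] by simp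
  have prod: "fps_nth (\<Prod>i\<in>?I. char_matrix_fps n A $$ (i, p i)) k =
      (\<Sum>S | S \<subseteq> ?I \<and> card S = k. (\<Prod>i\<in>S. - A i (p i)) * (\<Prod>i\<in>?I - S. if i = p i then 1 else 0))"
    if p: "p \<in> ?U" for p
  proof -
    have "(\<Prod>i\<in>?I. char_matrix_fps n A $$ (i, p i)) =
        (\<Prod>i\<in>?I. fps_X * fps_const (- A i (p i)) + fps_const (if i = p i then 1 else 0))"
      using perm_less[OF p] by (intro prod.cong refl) simp
    also have "\<dots> = (\<Sum>S\<in>Pow ?I. (\<Prod>i\<in>S. fps_X * fps_const (- A i (p i))) * (\<Prod>i\<in>?I - S. fps_const (if i = p i then 1 else 0)))"
      by (rule prod_add) simp
    also have "\<dots> = (\<Sum>S\<in>Pow ?I. fps_X ^ card S * fps_const ((\<Prod>i\<in>S. - A i (p i)) * (\<Prod>i\<in>?I - S. if i = p i then 1 else 0)))"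
      by (intro sum.cong refl) (simp only: prod.distrib prod_constant fps_const_prod fps_const_mult mult.assoc)
    finally have "fps_nth (\<Prod>i\<in>?I. char_matrix_fps n A $$ (i, p i)) k =
        (\<Sum>S\<in>Pow ?I. if card S = k then (\<Prod>i\<in>S. - A i (p i)) * (\<Prod>i\<in>?I - S. if i = p i then 1 else 0) else 0)"
      by (simp only: fps_sum_nth) (intro sum.cong refl, auto)
    also have "\<dots> = (\<Sum>S\<in>{S \<in> Pow ?I. card S = k}. (\<Prod>i\<in>S. - A i (p i)) * (\<Prod>i\<in>?I - S. if i = p i then 1 else 0))"
      by (rule sum.inter_filter[symmetric]) simp
    also have "{S \<in> Pow ?I. card S = k} = {S. S \<subseteq> ?I \<and> card S = k}" by auto
    finally show ?thesis .
  qed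
  have sgn: "(signof p :: 'a fps) = fps_const (signof p)" for p
    by (simp add: sign_def flip: fps_const_neg)
  have "fps_nth (char_fps n A) k = (\<Sum>p\<in>?U. fps_nth (signof p * (\<Prod>i\<in>?I. char_matrix_fps n A $$ (i, p i))) k)"
    unfolding char_fps_def det_def'[OF char_matrix_fps_carrier] by (simp only: fps_sum_nth)
  also have "\<dots> = (\<Sum>p\<in>?U. signof p * fps_nth (\<Prod>i\<in>?I. char_matrix_fps n A $$ (i, p i)) k)"
    unfolding sgn by (simp only: fps_mult_left_const_nth)
  finally show ?thesis using prod by simp
qed

lemma char_fps_nth_0:
  fixes A :: "nat \<Rightarrow> nat \<Rightarrow> 'a :: comm_ring_1"
  shows "fps_nth (char_fps n A) 0 = 1"
proof -
  have "{S. S \<subseteq> {0..<n} \<and> card S = 0} = {{}}"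
    using finite_subset[of _ "{0..<n}"] by auto
  then have "fps_nth (char_fps n A) 0 = (\<Sum>p | p permutes {0..<n}. signof p * (\<Prod>i\<in>{0..<n}. if i = p i then 1 else 0))"
    unfolding char_fps_nth by simp
  also have "\<dots> = (\<Sum>p | p permutes {0..<n}. if p = id then 1 else 0)"
  proof (rule sum.cong[OF refl])
    fix p assume p: "p \<in> {p. p permutes {0..<n}}"
    show "signof p * (\<Prod>i\<in>{0..<n}. if i = p i then 1 else 0) = (if p = id then 1 else (0 :: 'a))"
    proof (cases "p = id")
      case False
      then obtain i where i: "p i \<noteq> i" by (auto simp: fun_eq_iff)
      then have "i \<in> {0..<n}" using p unfolding permutes_def by blast
      then have "(\<Prod>i\<in>{0..<n}. if i = p i then 1 else (0 :: 'a)) = 0"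
        by (intro prod_zero bexI[of _ i]) (use i in auto)
      then show ?thesis using False by simp
    qed (simp add: sign_id)
  qed
  also have "\<dots> = 1" using permutes_id[of "{0..<n}"] finite_permutations[of "{0..<n}"] by simp
  finally show ?thesis .
qed

section \<open>Orders of vanishing\<close>

text \<open>\<open>ord_ge D h F\<close> says that the order of \<open>F\<close> is at least \<open>h / D\<close>.\<close>

definition ord_ge :: "nat \<Rightarrow> int \<Rightarrow> 'a :: zero fps \<Rightarrow> bool" where
  "ord_ge D h F \<longleftrightarrow> (\<forall>i. int D * int i < h \<longrightarrow> fps_nth F i = 0)"

lemma ord_ge_mono: "ord_ge D h F \<Longrightarrow> h' \<le> h \<Longrightarrow> ord_ge D h' F"
  by (auto simp: ord_ge_def)

lemma ord_ge_zero [simp]: "ord_ge D h 0"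
  by (simp add: ord_ge_def)

lemma ord_ge_trivial: "h \<le> 0 \<Longrightarrow> ord_ge D h F"
  unfolding ord_ge_def
proof (intro allI impI)
  fix i assume "h \<le> 0" "int D * int i < h"
  moreover have "0 \<le> int D * int i" by simp
  ultimately show "fps_nth F i = 0" by linarith
qed

lemma ord_ge_sum:
  fixes G :: "'i \<Rightarrow> 'a :: comm_monoid_add fps"
  shows "(\<And>i. i \<in> I \<Longrightarrow> ord_ge D h (G i)) \<Longrightarrow> ord_ge D h (sum G I)"
  unfolding ord_ge_def by (auto simp: fps_sum_nth)

lemma ord_ge_uminus: "ord_ge D h F \<Longrightarrow> ord_ge D h (- F :: 'a :: group_add fps)"
  by (simp add: ord_ge_def)

lemma ord_ge_mult:
  fixes F G :: "'a :: semiring_0 fps"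
  assumes "ord_ge D h F" "ord_ge D h' G"
  shows "ord_ge D (h + h') (F * G)"
  unfolding ord_ge_def
proof (intro allI impI)
  fix i assume i: "int D * int i < h + h'"
  have "fps_nth F j * fps_nth G (i - j) = 0" if "j \<in> {0..i}" for j
  proof -
    have "int D * int j + int D * int (i - j) = int D * int i"
      using that by (simp add: of_nat_diff algebra_simps)
    then have "int D * int j < h \<or> int D * int (i - j) < h'" using i by linarith
    then show ?thesis using assms unfolding ord_ge_def by auto
  qed
  then show "fps_nth (F * G) i = 0" unfolding fps_mult_nth by (intro sum.neutral) blast
qed

lemma ord_ge_prod:
  fixes G :: "'i \<Rightarrow> 'a :: comm_semiring_1 fps"
  assumes "finite I" "\<And>i. i \<in> I \<Longrightarrow> ord_ge D (h i) (G i)"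
  shows "ord_ge D (sum h I) (prod G I)"
  using assms
proof (induction I rule: finite_induct)
  case empty
  then show ?case by (simp add: ord_ge_trivial)
next
  case (insert j I)
  then show ?case using ord_ge_mult[of D "h j" "G j" "sum h I" "prod G I"] by simp
qed

section \<open>Truncation in the inner variable\<close>

definition fps_eq_upto :: "nat \<Rightarrow> 'a fps \<Rightarrow> 'a fps \<Rightarrow> bool" where
  "fps_eq_upto N F G \<longleftrightarrow> (\<forall>i\<le>N. fps_nth F i = fps_nth G i)"

lemma fps_eq_upto_refl [simp]: "fps_eq_upto N F F"
  by (simp_all add: fps_eq_upto_def)

lemma fps_eq_upto_mult:
  fixes F G :: "'a :: semiring_0 fps"
  shows "fps_eq_upto N F F' \<Longrightarrow> fps_eq_upto N G G' \<Longrightarrow> fps_eq_upto N (F * G) (F' * G')"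
  unfolding fps_eq_upto_def fps_mult_nth by (auto intro!: sum.cong)

lemma fps_eq_upto_uminus:
  "fps_eq_upto N F G \<Longrightarrow> fps_eq_upto N (- F :: 'a :: group_add fps) (- G)"
  by (simp add: fps_eq_upto_def)

lemma fps_eq_upto_sum:
  fixes G :: "'i \<Rightarrow> 'a :: comm_monoid_add fps"
  shows "(\<And>i. i \<in> I \<Longrightarrow> fps_eq_upto N (F i) (G i)) \<Longrightarrow> fps_eq_upto N (sum F I) (sum G I)"
  unfolding fps_eq_upto_def by (auto simp: fps_sum_nth intro: sum.cong)

lemma fps_eq_upto_prod:
  fixes G :: "'i \<Rightarrow> 'a :: comm_semiring_1 fps"
  shows "(\<And>i. i \<in> I \<Longrightarrow> fps_eq_upto N (F i) (G i)) \<Longrightarrow> fps_eq_upto N (prod F I) (prod G I)"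
  by (induction I rule: infinite_finite_induct) (auto intro: fps_eq_upto_mult)

section \<open>Laurent polynomials as functions on the torus\<close>

definition linf :: "int ^ 'n \<Rightarrow> int" where
  "linf v = Max (range (\<lambda>i. \<bar>v $ i\<bar>))"

lemma linf_le_iff: "linf v \<le> M \<longleftrightarrow> (\<forall>i. \<bar>v $ i\<bar> \<le> M)"
  unfolding linf_def by (subst Max_le_iff) auto

lemma linf_ge: "\<bar>v $ i\<bar> \<le> linf v"
  using linf_le_iff[of v "linf v"] by simp

lemma linf_nonneg: "0 \<le> linf v"
  using linf_ge[of v undefined] by linarith

lemma linf_attained: "\<exists>i. linf v = \<bar>v $ i\<bar>"
proof -
  have "linf v \<in> range (\<lambda>i. \<bar>v $ i\<bar>)" unfolding linf_def by (rule Max_in) auto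
  then show ?thesis by auto
qed

lemma linf_0 [simp]: "linf 0 = 0"
  using linf_attained[of 0] by auto

lemma linf_add: "linf (v + w) \<le> linf v + linf w"
  unfolding linf_le_iff
proof
  fix i
  show "\<bar>(v + w) $ i\<bar> \<le> linf v + linf w"
    using linf_ge[of v i] linf_ge[of w i] by simp
qed

lemma linf_scale: "linf (int c *s v) = int c * linf v"
proof (rule antisym)
  show "linf (int c *s v) \<le> int c * linf v"
    unfolding linf_le_iff using linf_ge[of v] by (auto simp: abs_mult intro!: mult_left_mono)
  obtain i where "linf v = \<bar>v $ i\<bar>" using linf_attained by blast
  then show "int c * linf v \<le> linf (int c *s v)"
    using linf_ge[of "int c *s v" i] by (simp add: abs_mult)
qed

lemma linf_scale_diff: "int c * linf v - linf w \<le> linf (int c *s v - w)"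
  using linf_add[of "int c *s v - w" w] by (simp add: linf_scale)

lemma finite_linf_le: "finite {v :: int ^ 'n. linf v \<le> M}"
proof -
  have "{v :: int ^ 'n. linf v \<le> M} \<subseteq> vec_lambda ` (PiE UNIV (\<lambda>_. {- M..M}))"
  proof
    fix v :: "int ^ 'n" assume v: "v \<in> {v. linf v \<le> M}"
    have "(\<lambda>i. v $ i) \<in> PiE UNIV (\<lambda>_. {- M..M})"
      using v unfolding mem_Collect_eq linf_le_iff by (auto simp: abs_le_iff minus_le_iff)
    then show "v \<in> vec_lambda ` (PiE UNIV (\<lambda>_. {- M..M}))"
      by (rule rev_image_eqI) (simp add: vec_eq_iff)
  qed
  then show ?thesis by (rule finite_subset) (intro finite_imageI finite_PiE, auto)
qed

definition lattice_box :: "int \<Rightarrow> (int ^ 'n) set" where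
  "lattice_box M = {v. linf v \<le> M}"

lemma finite_lattice_box [simp]: "finite (lattice_box M)"
  unfolding lattice_box_def by (rule finite_linf_le)

definition torus :: "('a :: field ^ 'n) set" where
  "torus = {x. \<forall>i. x $ i \<noteq> 0}"

definition vmonom :: "'a :: field ^ 'n \<Rightarrow> int ^ 'n \<Rightarrow> 'a" where
  "vmonom x v = (\<Prod>i\<in>UNIV. (x $ i) powi (v $ i))"

definition vpow :: "'a :: field ^ 'n \<Rightarrow> nat \<Rightarrow> 'a ^ 'n" where
  "vpow x c = (\<chi> i. x $ i ^ c)"

lemma vmonom_0 [simp]: "vmonom x 0 = 1"
  by (simp add: vmonom_def)

lemma vmonom_add: "x \<in> torus \<Longrightarrow> vmonom x (v + w) = vmonom x v * vmonom x w"
  by (simp add: vmonom_def torus_def power_int_add flip: prod.distrib)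

lemma vmonom_vpow: "vmonom (vpow x c) v = vmonom x (int c *s v)"
  unfolding vmonom_def vpow_def
  by (intro prod.cong refl) (simp add: power_int_mult)

lemma vmonom_power: "vmonom x v ^ c = vmonom x (int c *s v)"
  unfolding vmonom_def prod_power_distrib
  by (intro prod.cong refl)
     (simp only: vector_smult_component mult.commute[of "int c"] power_int_mult power_int_of_nat)

lemma vpow_torus: "x \<in> torus \<Longrightarrow> vpow x c \<in> torus"
  by (simp add: torus_def vpow_def)

lemma vpow_vpow: "vpow (vpow x a) b = vpow x (a * b)"
  by (simp add: vpow_def vec_eq_iff power_mult)


text \<open>Convolution of a Laurent polynomial in \<open>x\<close> with one in \<open>x^c\<close>,
  whose monomials are \<open>\<mu>'\<close>: the exponent \<open>u\<close> arises from
  \<open>v\<close> and \<open>w = u - c v\<close>. The case \<open>c = 1\<close> is the ordinary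
  product, \<open>c = q\<close> the step of the iteration in the trace formula.\<close>

lemma vmonom_sum_mult:
  fixes e e' :: "int ^ 'n \<Rightarrow> 'b :: comm_ring_1"
  assumes hom: "\<And>v w. \<mu> (int c *s v + w) = \<mu>' v * \<mu> w"
  shows "(\<Sum>w\<in>lattice_box M. e w * \<mu> w) * (\<Sum>v\<in>lattice_box M'. e' v * \<mu>' v) =
    (\<Sum>u\<in>lattice_box (M + int c * M'). (\<Sum>v\<in>lattice_box M'. e' v * (if linf (u - int c *s v) \<le> M then e (u - int c *s v) else 0)) * \<mu> u)"
proof -
  have "(\<Sum>u\<in>lattice_box (M + int c * M'). (\<Sum>v\<in>lattice_box M'. e' v * (if linf (u - int c *s v) \<le> M then e (u - int c *s v) else 0)) * \<mu> u) =
      (\<Sum>v\<in>lattice_box M'. \<Sum>u\<in>lattice_box (M + int c * M'). e' v * (if linf (u - int c *s v) \<le> M then e (u - int c *s v) * \<mu> u else 0))"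
    unfolding sum_distrib_right by (subst sum.swap) (intro sum.cong refl, simp add: mult.assoc)
  also have "\<dots> = (\<Sum>v\<in>lattice_box M'. \<Sum>w\<in>lattice_box M. e' v * (e w * (\<mu>' v * \<mu> w)))"
  proof (rule sum.cong[OF refl])
    fix v :: "int ^ 'n" assume v: "v \<in> lattice_box M'"
    have "(\<Sum>u\<in>lattice_box (M + int c * M'). e' v * (if linf (u - int c *s v) \<le> M then e (u - int c *s v) * \<mu> u else 0)) =
        (\<Sum>u\<in>{u \<in> lattice_box (M + int c * M'). linf (u - int c *s v) \<le> M}. e' v * (e (u - int c *s v) * \<mu> u))"
      by (subst sum.inter_filter[OF finite_lattice_box]) (intro sum.cong refl, simp)
    also have "\<dots> = (\<Sum>w\<in>lattice_box M. e' v * (e w * (\<mu>' v * \<mu> w)))"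
    proof (rule sum.reindex_bij_witness[of _ "\<lambda>w. int c *s v + w" "\<lambda>u. u - int c *s v"])
      fix w :: "int ^ 'n" assume w: "w \<in> lattice_box M"
      have "linf (int c *s v + w) \<le> int c * linf v + linf w"
        using linf_add[of "int c *s v" w] by (simp add: linf_scale)
      also have "\<dots> \<le> int c * M' + M"
        using v w unfolding lattice_box_def by (intro add_mono mult_left_mono) auto
      finally show "int c *s v + w \<in> {u \<in> lattice_box (M + int c * M'). linf (u - int c *s v) \<le> M}"
        using w by (simp add: lattice_box_def)
    next
      fix u :: "int ^ 'n" assume "u \<in> {u \<in> lattice_box (M + int c * M'). linf (u - int c *s v) \<le> M}"
      then show "u - int c *s v \<in> lattice_box M" by (simp add: lattice_box_def)
      show "e' v * (e (u - int c *s v) * (\<mu>' v * \<mu> (u - int c *s v))) = e' v * (e (u - int c *s v) * \<mu> u)"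
        using hom[of v "u - int c *s v"] by simp
    qed simp_all
    finally show "(\<Sum>u\<in>lattice_box (M + int c * M'). e' v * (if linf (u - int c *s v) \<le> M then e (u - int c *s v) * \<mu> u else 0)) =
        (\<Sum>w\<in>lattice_box M. e' v * (e w * (\<mu>' v * \<mu> w)))" .
  qed
  also have "\<dots> = (\<Sum>v\<in>lattice_box M'. \<Sum>w\<in>lattice_box M. (e w * \<mu> w) * (e' v * \<mu>' v))"
    by (intro sum.cong refl) (simp add: mult_ac)
  also have "\<dots> = (\<Sum>w\<in>lattice_box M. e w * \<mu> w) * (\<Sum>v\<in>lattice_box M'. e' v * \<mu>' v)"
    unfolding sum_product by (rule sum.swap)
  finally show ?thesis ..
qed

text \<open>Laurent polynomials with exponents in a box, seen as functions on the torus, so that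
  products and binomial coefficients can be formed pointwise.\<close>

definition laurent_fun :: "int \<Rightarrow> ('a :: field ^ 'n \<Rightarrow> 'a) \<Rightarrow> bool" where
  "laurent_fun M h \<longleftrightarrow> (\<exists>e. \<forall>x\<in>torus. h x = (\<Sum>v\<in>lattice_box M. e v * vmonom x v))"

lemma laurent_funI: "(\<And>x. x \<in> torus \<Longrightarrow> h x = (\<Sum>v\<in>lattice_box M. e v * vmonom x v)) \<Longrightarrow> laurent_fun M h"
  unfolding laurent_fun_def by blast

lemma laurent_fun_add:
  assumes "laurent_fun M h" "laurent_fun M h'"
  shows "laurent_fun M (\<lambda>x. h x + h' x)"
proof -
  obtain e e' where "\<forall>x\<in>torus. h x = (\<Sum>v\<in>lattice_box M. e v * vmonom x v)"
    "\<forall>x\<in>torus. h' x = (\<Sum>v\<in>lattice_box M. e' v * vmonom x v)"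
    using assms unfolding laurent_fun_def by blast
  then show ?thesis by (intro laurent_funI[where e = "\<lambda>v. e v + e' v"]) (simp add: distrib_right sum.distrib)
qed

lemma laurent_fun_scale:
  assumes "laurent_fun M h"
  shows "laurent_fun M (\<lambda>x. c * h x)"
proof -
  obtain e where "\<forall>x\<in>torus. h x = (\<Sum>v\<in>lattice_box M. e v * vmonom x v)"
    using assms unfolding laurent_fun_def by blast
  then show ?thesis by (intro laurent_funI[where e = "\<lambda>v. c * e v"]) (simp add: sum_distrib_left mult.assoc)
qed

lemma laurent_fun_mono:
  fixes h :: "'a :: field ^ 'n \<Rightarrow> 'a"
  assumes "laurent_fun M h" "M \<le> M'"
  shows "laurent_fun M' h"
proof -
  obtain e where e: "\<forall>x\<in>torus. h x = (\<Sum>v\<in>lattice_box M. e v * vmonom x v)"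
    using assms unfolding laurent_fun_def by blast
  show ?thesis
  proof (rule laurent_funI)
    fix x :: "'a ^ 'n" assume x: "x \<in> torus"
    have "(\<Sum>v\<in>lattice_box M'. (if v \<in> lattice_box M then e v else 0) * vmonom x v) = (\<Sum>v\<in>lattice_box M. (if v \<in> lattice_box M then e v else 0) * vmonom x v)"
      using assms(2) by (intro sum.mono_neutral_right) (auto simp: lattice_box_def intro: finite_linf_le)
    then show "h x = (\<Sum>v\<in>lattice_box M'. (if v \<in> lattice_box M then e v else 0) * vmonom x v)" using e x by simp
  qed
qed

lemma laurent_fun_vmonom:
  assumes "linf u \<le> M"
  shows "laurent_fun M (\<lambda>x :: 'a :: field ^ 'n. vmonom x u)"
proof (rule laurent_funI)
  fix x :: "'a ^ 'n"
  have "(\<Sum>v\<in>lattice_box M. (if v = u then 1 else 0) * vmonom x v) = (\<Sum>v\<in>lattice_box M. if v = u then vmonom x v else 0)"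
    by (intro sum.cong refl) simp
  moreover have "u \<in> lattice_box M" using assms by (simp add: lattice_box_def)
  ultimately show "vmonom x u = (\<Sum>v\<in>lattice_box M. (if v = u then 1 else 0) * vmonom x v)" by simp
qed

lemma laurent_fun_mult:
  fixes h h' :: "'a :: field ^ 'n \<Rightarrow> 'a"
  assumes "laurent_fun M h" "laurent_fun M' h'"
  shows "laurent_fun (M + M') (\<lambda>x. h x * h' x)"
proof -
  obtain e e' where e: "\<forall>x\<in>torus. h x = (\<Sum>v\<in>lattice_box M. e v * vmonom x v)"
    "\<forall>x\<in>torus. h' x = (\<Sum>v\<in>lattice_box M'. e' v * vmonom x v)"
    using assms unfolding laurent_fun_def by blast
  show ?thesis
  proof (rule laurent_funI)
    fix x :: "'a ^ 'n" assume x: "x \<in> torus"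
    show "h x * h' x = (\<Sum>u\<in>lattice_box (M + M'). (\<Sum>v\<in>lattice_box M'. e' v * (if linf (u - int 1 *s v) \<le> M then e (u - int 1 *s v) else 0)) * vmonom x u)"
      using vmonom_sum_mult[of "vmonom x" 1 "vmonom x" e M e' M'] vmonom_add[OF x] e x by simp
  qed
qed

lemma laurent_fun_0: "laurent_fun M (\<lambda>x. 0)"
  by (rule laurent_funI[where e = "\<lambda>_. 0"]) simp

lemma laurent_fun_sum:
  "(\<And>i. i \<in> I \<Longrightarrow> laurent_fun M (h i)) \<Longrightarrow> laurent_fun M (\<lambda>x. \<Sum>i\<in>I. h i x)"
  by (induction I rule: infinite_finite_induct) (auto intro: laurent_fun_0 laurent_fun_add)

text \<open>Each step of \<open>(k + 1) (h choose (k + 1)) = (h choose k) (h - k)\<close> brings one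
  more factor of width \<open>D\<close>. The growth \<open>D k\<close> of exponents against
  \<open>T^k\<close> is the source of the order estimates.\<close>

lemma laurent_fun_gchoose:
  fixes h :: "'a :: field_char_0 ^ 'n \<Rightarrow> 'a"
  assumes "laurent_fun (int D) h"
  shows "laurent_fun (int (D * k)) (\<lambda>x. h x gchoose k)"
proof (induction k)
  case 0
  then show ?case using laurent_fun_vmonom[of 0 0] by simp
next
  case (Suc k)
  have eq: "h x gchoose Suc k = inverse (of_nat (Suc k)) * ((h x gchoose k) * h x + (- of_nat k) * (h x gchoose k))" for x
  proof -
    have "of_nat (Suc k) * (h x gchoose Suc k) = (h x gchoose k) * h x + (- of_nat k) * (h x gchoose k)"
      using gbinomial_mult_1'[of "h x" k] by simp
    then show ?thesis by (metis left_inverse mult.assoc mult_1 of_nat_neq_0)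
  qed
  have "laurent_fun (int (D * k) + int D) (\<lambda>x. (h x gchoose k) * h x)"
    by (rule laurent_fun_mult[OF Suc assms])
  moreover have "laurent_fun (int (D * k) + int D) (\<lambda>x. (- of_nat k) * (h x gchoose k))"
    by (rule laurent_fun_scale, rule laurent_fun_mono[OF Suc]) simp
  ultimately have "laurent_fun (int (D * k) + int D)
      (\<lambda>x. inverse (of_nat (Suc k)) * ((h x gchoose k) * h x + (- of_nat k) * (h x gchoose k)))"
    by (intro laurent_fun_scale[where c = "inverse (of_nat (Suc k))"] laurent_fun_add)
  then have "laurent_fun (int (D * k) + int D) (\<lambda>x. h x gchoose Suc k)" unfolding eq .
  moreover have "int (D * k) + int D = int (D * Suc k)" by simp
  ultimately show ?case by (simp only:)
qed

section \<open>The trace formula\<close>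

lemma sum_vec_prod:
  fixes h :: "'n :: finite \<Rightarrow> 'a \<Rightarrow> 'b :: comm_semiring_1"
  assumes "finite A"
  shows "(\<Sum>x :: 'a ^ 'n | \<forall>i. x $ i \<in> A. \<Prod>i\<in>UNIV. h i (x $ i)) = (\<Prod>i\<in>UNIV. \<Sum>z\<in>A. h i z)"
proof -
  have "(\<Prod>i\<in>UNIV. \<Sum>z\<in>A. h i z) = (\<Sum>e\<in>PiE UNIV (\<lambda>_. A). \<Prod>i\<in>UNIV. h i (e i))"
    using assms by (intro prod_sum_PiE) auto
  also have "\<dots> = (\<Sum>x :: 'a ^ 'n | \<forall>i. x $ i \<in> A. \<Prod>i\<in>UNIV. h i (x $ i))"
    by (rule sum.reindex_bij_witness[of _ "\<lambda>x. vec_nth x" "\<lambda>e. vec_lambda e"]) auto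
  finally show ?thesis ..
qed

text \<open>Orthogonality of characters: multiplying the summation variable by
  \<open>\<omega>\<close> multiplies the sum by \<open>\<omega>^e\<close>, which differs from
  \<open>1\<close> unless \<open>r\<close> divides \<open>e\<close>.\<close>

lemma sum_roots_of_unity_powi:
  fixes \<omega> :: "'a :: field"
  assumes r: "r > 0" and prim: "\<And>k. \<omega> ^ k = 1 \<longleftrightarrow> r dvd k" and card: "card {z :: 'a. z ^ r = 1} = r"
  shows "(\<Sum>z | z ^ r = 1. z powi e) = (if int r dvd e then of_nat r else (0 :: 'a))"
proof (cases "int r dvd e")
  case True
  then obtain c where "e = int r * c" by (elim dvdE)
  then have "z powi e = 1" if "z ^ r = 1" for z :: 'a using that by (simp add: power_int_mult)
  then have "(\<Sum>z | z ^ r = 1. z powi e) = (\<Sum>z :: 'a | z ^ r = 1. 1 :: 'a)" by (intro sum.cong) auto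
  then show ?thesis using True card by simp
next
  case False
  have \<omega>1: "\<omega> ^ r = 1" by (simp add: prim)
  have \<omega>0: "\<omega> \<noteq> 0" using \<omega>1 r by (auto simp: power_0_left)
  have ne: "\<omega> powi e \<noteq> 1"
  proof
    assume eq: "\<omega> powi e = 1"
    have "\<omega> ^ nat (e mod int r) = \<omega> powi (e mod int r)" using r by (simp add: power_int_def)
    also have "\<dots> = \<omega> powi (e - int r * (e div int r))" by (simp add: minus_mult_div_eq_mod)
    also have "\<dots> = 1" using eq \<omega>1 \<omega>0 by (simp add: power_int_diff power_int_mult)
    finally have "r dvd nat (e mod int r)" by (simp add: prim)
    moreover have "nat (e mod int r) < r" using r by (simp add: nat_less_iff)
    ultimately have "nat (e mod int r) = 0" by (meson gr0I nat_dvd_not_less)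
    then have "e mod int r = 0" using r by (simp add: order_antisym)
    then show False using False by (simp add: mod_eq_0_iff_dvd)
  qed
  have "(\<Sum>z | z ^ r = 1. z powi e) = (\<Sum>z | z ^ r = 1. (\<omega> * z) powi e)"
    by (rule sum.reindex_bij_witness[of _ "\<lambda>z. \<omega> * z" "\<lambda>z. z / \<omega>"])
       (use \<omega>0 \<omega>1 in \<open>auto simp: power_mult_distrib power_divide\<close>)
  also have "\<dots> = \<omega> powi e * (\<Sum>z | z ^ r = 1. z powi e)"
    by (simp add: power_int_mult_distrib sum_distrib_left)
  finally have "(\<omega> powi e - 1) * (\<Sum>z | z ^ r = 1. z powi e) = 0" by (simp add: algebra_simps)
  then show ?thesis using ne False by simp
qed

text \<open>This isolates what the trace formula uses: enough roots of unity in the field and one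
  Laurent function \<open>g\<close>, whose twists \<open>g(x^(q^j))\<close> will be summed in place
  of the trace.\<close>

locale dwork =
  fixes g :: "'a :: field_char_0 ^ 'n \<Rightarrow> 'a" and D q :: nat
  assumes q: "q \<ge> 2" and g: "laurent_fun (int D) g"
    and card_roots: "k \<ge> 1 \<Longrightarrow> card {z :: 'a. z ^ (q ^ k - 1) = 1} = q ^ k - 1"
    and primitive_root: "k \<ge> 1 \<Longrightarrow> \<exists>\<omega> :: 'a. \<forall>j. \<omega> ^ j = 1 \<longleftrightarrow> (q ^ k - 1) dvd j"
begin

definition rational_points :: "nat \<Rightarrow> ('a ^ 'n) set" where
  "rational_points k = {x. \<forall>i. (x $ i) ^ (q ^ k - 1) = 1}"

lemma order_pos: "k \<ge> 1 \<Longrightarrow> q ^ k - 1 > 0"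
  using q one_less_power[of q k] by simp

lemma rational_points_torus:
  assumes "k \<ge> 1" "x \<in> rational_points k"
  shows "x \<in> torus"
  unfolding torus_def
proof safe
  fix i assume "x $ i = 0"
  moreover have "(x $ i) ^ (q ^ k - 1) = 1" using assms(2) unfolding rational_points_def by blast
  ultimately show False using order_pos[OF assms(1)] by (simp add: power_0_left)
qed

lemma sum_vmonom:
  assumes k: "k \<ge> 1"
  shows "(\<Sum>x\<in>rational_points k. vmonom x u) =
    (if \<forall>i. int (q ^ k - 1) dvd u $ i then of_nat (q ^ k - 1) ^ CARD('n) else 0)"
proof -
  let ?r = "q ^ k - 1"
  obtain \<omega> :: 'a where \<omega>: "\<And>j. \<omega> ^ j = 1 \<longleftrightarrow> ?r dvd j" using primitive_root[OF k] by blast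
  have fin: "finite {z :: 'a. z ^ ?r = 1}"
    using card_roots[OF k] order_pos[OF k] card_ge_0_finite by metis
  have "(\<Sum>x\<in>rational_points k. vmonom x u) =
      (\<Sum>x :: 'a ^ 'n | \<forall>i. x $ i \<in> {z. z ^ ?r = 1}. \<Prod>i\<in>UNIV. (x $ i) powi (u $ i))"
    unfolding rational_points_def vmonom_def by simp
  also have "\<dots> = (\<Prod>i\<in>UNIV. \<Sum>z | z ^ ?r = 1. z powi (u $ i))" by (rule sum_vec_prod[OF fin])
  also have "\<dots> = (\<Prod>i\<in>UNIV. if int ?r dvd u $ i then of_nat ?r else 0)"
    by (intro prod.cong refl sum_roots_of_unity_powi[OF order_pos[OF k] \<omega> card_roots[OF k]])
  also have "\<dots> = (if \<forall>i. int ?r dvd u $ i then of_nat ?r ^ CARD('n) else 0)"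
  proof (cases "\<forall>i. int ?r dvd u $ i")
    case False
    then obtain i where "\<not> int ?r dvd u $ i" by blast
    then have "(\<Prod>i\<in>UNIV. if int ?r dvd u $ i then of_nat ?r else (0 :: 'a)) = 0"
      by (intro prod_zero bexI[of _ i]) auto
    then show ?thesis using False by simp
  qed simp
  finally show ?thesis .
qed

definition coef :: "nat \<Rightarrow> int ^ 'n \<Rightarrow> 'a" where
  "coef k = (SOME e. \<forall>x\<in>torus. (g x gchoose k) = (\<Sum>v\<in>lattice_box (int (D * k)). e v * vmonom x v))"

lemma coef: "x \<in> torus \<Longrightarrow> (g x gchoose k) = (\<Sum>v\<in>lattice_box (int (D * k)). coef k v * vmonom x v)"
proof -
  have "\<exists>e. \<forall>x\<in>torus. (g x gchoose k) = (\<Sum>v\<in>lattice_box (int (D * k)). e v * vmonom x v)"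
    using laurent_fun_gchoose[OF g, of k] unfolding laurent_fun_def .
  from someI_ex[OF this] show "x \<in> torus \<Longrightarrow> (g x gchoose k) = (\<Sum>v\<in>lattice_box (int (D * k)). coef k v * vmonom x v)"
    unfolding coef_def by blast
qed

text \<open>The coefficient of \<open>x\<^sup>v\<close> in $(1 + T)^{g(x)}$.\<close>

definition split_coef :: "int ^ 'n \<Rightarrow> 'a fps" where
  "split_coef v = Abs_fps (\<lambda>k. if linf v \<le> int (D * k) then coef k v else 0)"

text \<open>The guard in \<open>split_coef\<close> enforces this: outside its box, the chosen
  \<open>coef k\<close> may take any value.\<close>

lemma ord_split_coef: "ord_ge D (linf v) (split_coef v)"
  by (simp add: ord_ge_def split_coef_def)

context
  fixes N :: nat
begin

abbreviation W :: "(int ^ 'n) set" where "W \<equiv> lattice_box (int (D * N))"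

definition trunc :: "'a ^ 'n \<Rightarrow> 'a fps" where
  "trunc x = (\<Sum>v\<in>W. split_coef v * fps_const (vmonom x v))"

lemma trunc: "x \<in> torus \<Longrightarrow> fps_eq_upto N (fps_binomial (g x)) (trunc x)"
  unfolding fps_eq_upto_def
proof (intro allI impI)
  fix k assume x: "x \<in> torus" and k: "k \<le> N"
  have "fps_nth (trunc x) k = (\<Sum>v\<in>W. (if linf v \<le> int (D * k) then coef k v else 0) * vmonom x v)"
    by (simp add: trunc_def fps_sum_nth split_coef_def)
  also have "\<dots> = (\<Sum>v\<in>lattice_box (int (D * k)). (if linf v \<le> int (D * k) then coef k v else 0) * vmonom x v)"
  proof (rule sum.mono_neutral_right[OF finite_lattice_box])
    have "int (D * k) \<le> int (D * N)" by (intro of_nat_mono mult_le_mono order_refl k)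
    then show "lattice_box (int (D * k)) \<subseteq> W" unfolding lattice_box_def by auto
  qed (auto simp: lattice_box_def)
  also have "\<dots> = (\<Sum>v\<in>lattice_box (int (D * k)). coef k v * vmonom x v)"
    by (intro sum.cong refl) (simp add: lattice_box_def)
  finally show "fps_nth (fps_binomial (g x)) k = fps_nth (trunc x) k"
    using coef[OF x, of k] by simp
qed

text \<open>In closed form \<open>D N (1 + q + ... + q^(k - 1))\<close>, a bound for the exponents
  in the product of the truncations at \<open>x^(q^j)\<close>, \<open>j < k\<close>.\<close>

primrec radius :: "nat \<Rightarrow> int" where
  "radius 0 = 0"
| "radius (Suc k) = int (D * N) + int q * radius k"

lemma radius_eq: "int (q - 1) * radius k = int (D * N) * int (q ^ k - 1)"
proof -
  have q1: "int (q - 1) = int q - 1" using q by simp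
  have "(int q - 1) * radius k = int (D * N) * (int q ^ k - 1)"
  proof (induction k)
    case (Suc k)
    have "(int q - 1) * radius (Suc k) = (int q - 1) * int (D * N) + int q * ((int q - 1) * radius k)"
      by (simp add: algebra_simps)
    also have "\<dots> = int (D * N) * (int q ^ Suc k - 1)" unfolding Suc by (simp add: algebra_simps)
    finally show ?case .
  qed simp
  moreover have "int (q ^ k - 1) = int q ^ k - 1"
    using q by (simp add: of_nat_diff)
  ultimately show ?thesis unfolding q1 by simp
qed

text \<open>The coefficient of \<open>x^u\<close> in that product. Splitting off the factor
  \<open>j = 0\<close> leaves the shorter product at \<open>x^q\<close>, hence the decomposition
  \<open>u = q v + w\<close>.\<close>

primrec iter_coef :: "nat \<Rightarrow> int ^ 'n \<Rightarrow> 'a fps" where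
  "iter_coef 0 = (\<lambda>u. if u = 0 then 1 else 0)"
| "iter_coef (Suc k) = (\<lambda>u. \<Sum>v\<in>lattice_box (radius k). iter_coef k v *
     (if linf (u - int q *s v) \<le> int (D * N) then split_coef (u - int q *s v) else 0))"

lemma iter_coef_zero:
  assumes u: "u \<notin> lattice_box (radius k)"
  shows "iter_coef k u = 0"
proof (cases k)
  case 0
  then show ?thesis using u by (auto simp: lattice_box_def)
next
  case (Suc j)
  have "\<not> linf (u - int q *s v) \<le> int (D * N)" if "v \<in> lattice_box (radius j)" for v
  proof
    assume a: "linf (u - int q *s v) \<le> int (D * N)"
    have "linf u \<le> linf (u - int q *s v) + int q * linf v"
      using linf_add[of "u - int q *s v" "int q *s v"] by (simp add: linf_scale)
    also have "\<dots> \<le> int (D * N) + int q * radius j"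
      using a that unfolding lattice_box_def by (intro add_mono mult_left_mono) auto
    finally show False using u Suc unfolding lattice_box_def by simp
  qed
  then show ?thesis using Suc by simp
qed

lemma prod_trunc:
  assumes "x \<in> torus"
  shows "(\<Prod>j<k. trunc (vpow x (q ^ j))) = (\<Sum>u\<in>lattice_box (radius k). iter_coef k u * fps_const (vmonom x u))"
  using assms
proof (induction k arbitrary: x)
  case 0
  have "(\<Sum>u\<in>lattice_box 0. (if u = 0 then 1 else 0) * fps_const (vmonom x u)) =
      (\<Sum>u :: int ^ 'n \<in> lattice_box 0. if u = 0 then 1 else 0)"
    by (intro sum.cong refl) auto
  also have "\<dots> = (1 :: 'a fps)" by (simp only: sum.delta[OF finite_lattice_box]) (simp add: lattice_box_def)
  finally show ?case by simp
next
  case (Suc k)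
  have hom: "fps_const (vmonom x (int q *s v + w)) = fps_const (vmonom x (int q *s v)) * fps_const (vmonom x w)" for v w
    using vmonom_add[OF Suc.prems] by simp
  have "(\<Prod>j<Suc k. trunc (vpow x (q ^ j))) = trunc (vpow x (q ^ 0)) * (\<Prod>j<k. trunc (vpow x (q ^ Suc j)))"
    by (rule prod.lessThan_Suc_shift)
  also have "vpow x (q ^ 0) = x" by (simp add: vpow_def)
  also have "(\<Prod>j<k. trunc (vpow x (q ^ Suc j))) = (\<Prod>j<k. trunc (vpow (vpow x q) (q ^ j)))"
    by (simp add: vpow_vpow)
  also have "\<dots> = (\<Sum>v\<in>lattice_box (radius k). iter_coef k v * fps_const (vmonom x (int q *s v)))"
    unfolding Suc.IH[OF vpow_torus[OF Suc.prems]] vmonom_vpow ..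
  also have "trunc x * \<dots> = (\<Sum>u\<in>lattice_box (radius (Suc k)). iter_coef (Suc k) u * fps_const (vmonom x u))"
    unfolding trunc_def
    using vmonom_sum_mult[of "\<lambda>u. fps_const (vmonom x u)" q, OF hom, of split_coef "int (D * N)" "iter_coef k" "radius k"]
    by simp
  finally show ?case .
qed

text \<open>Summation over the rational points keeps the exponents \<open>u = (q^k - 1) w\<close>.
  By the closed form of the radius, such a \<open>u\<close> in range has
  \<open>(q - 1) |w| \<le> D N\<close>, so \<open>w\<close> lies in \<open>W\<close>; the
  \<open>w\<close> in \<open>W\<close> with \<open>u\<close> out of range contribute zero.\<close>

lemma sum_prod_trunc:
  assumes k: "k \<ge> 1"
  shows "(\<Sum>x\<in>rational_points k. \<Prod>j<k. trunc (vpow x (q ^ j))) =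
    fps_const (of_nat (q ^ k - 1) ^ CARD('n)) * (\<Sum>w\<in>W. iter_coef k (int (q ^ k - 1) *s w))"
proof -
  let ?r = "q ^ k - 1"
  let ?c = "fps_const (of_nat ?r ^ CARD('n)) :: 'a fps"
  have r: "?r > 0" by (rule order_pos[OF k])
  have const_sum: "(\<Sum>x\<in>A. fps_const (h x)) = fps_const (\<Sum>x\<in>A. h x)" for A and h :: "'a ^ 'n \<Rightarrow> 'a"
    by (induction A rule: infinite_finite_induct) simp_all
  have "(\<Sum>x\<in>rational_points k. \<Prod>j<k. trunc (vpow x (q ^ j))) =
      (\<Sum>x\<in>rational_points k. \<Sum>u\<in>lattice_box (radius k). iter_coef k u * fps_const (vmonom x u))"
    by (intro sum.cong refl prod_trunc rational_points_torus[OF k])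
  also have "\<dots> = (\<Sum>u\<in>lattice_box (radius k). \<Sum>x\<in>rational_points k. iter_coef k u * fps_const (vmonom x u))"
    by (rule sum.swap)
  also have "\<dots> = (\<Sum>u\<in>lattice_box (radius k). iter_coef k u * fps_const (\<Sum>x\<in>rational_points k. vmonom x u))"
    by (simp only: sum_distrib_left[symmetric] const_sum)
  also have "\<dots> = (\<Sum>u\<in>lattice_box (radius k). if \<forall>i. int ?r dvd u $ i then ?c * iter_coef k u else 0)"
    unfolding sum_vmonom[OF k] by (intro sum.cong refl) (simp add: mult.commute)
  also have "\<dots> = (\<Sum>u\<in>{u \<in> lattice_box (radius k). \<forall>i. int ?r dvd u $ i}. ?c * iter_coef k u)"
    by (rule sum.inter_filter[symmetric]) simp
  also have "\<dots> = (\<Sum>w\<in>{w \<in> W. int ?r *s w \<in> lattice_box (radius k)}. ?c * iter_coef k (int ?r *s w))"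
  proof (rule sum.reindex_bij_witness[of _ "\<lambda>w. int ?r *s w" "\<lambda>u. \<chi> i. u $ i div int ?r"])
    fix u :: "int ^ 'n" assume "u \<in> {u \<in> lattice_box (radius k). \<forall>i. int ?r dvd u $ i}"
    then have u: "u \<in> lattice_box (radius k)" "\<And>i. int ?r dvd u $ i" by auto
    let ?w = "\<chi> i. u $ i div int ?r"
    have "(int ?r *s ?w) $ i = u $ i" for i
      unfolding vector_smult_component vec_lambda_beta by (rule dvd_mult_div_cancel[OF u(2)])
    then have eq: "int ?r *s ?w = u" unfolding Finite_Cartesian_Product.vec_eq_iff ..
    then show "int ?r *s ?w = u" .
    have "int ?r * linf ?w \<le> radius k"
      using u(1) linf_scale[of ?r ?w] unfolding eq lattice_box_def by simp
    then have "int (q - 1) * (int ?r * linf ?w) \<le> int (q - 1) * radius k"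
      by (rule mult_left_mono) simp
    also have "\<dots> = int ?r * int (D * N)" unfolding radius_eq by (rule mult.commute)
    finally have "int ?r * (int (q - 1) * linf ?w) \<le> int ?r * int (D * N)" by (simp only: mult.left_commute)
    then have "int (q - 1) * linf ?w \<le> int (D * N)" using r by (simp only: mult_le_cancel_left_pos of_nat_0_less_iff)
    moreover have "1 * linf ?w \<le> int (q - 1) * linf ?w"
      using q by (intro mult_right_mono linf_nonneg) simp
    ultimately have "?w \<in> W" unfolding lattice_box_def by simp
    then show "?w \<in> {w \<in> W. int ?r *s w \<in> lattice_box (radius k)}" using u(1) eq by simp
    show "?c * iter_coef k (int ?r *s ?w) = ?c * iter_coef k u" unfolding eq ..
  next
    fix w :: "int ^ 'n" assume "w \<in> {w \<in> W. int ?r *s w \<in> lattice_box (radius k)}"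
    then show "int ?r *s w \<in> {u \<in> lattice_box (radius k). \<forall>i. int ?r dvd u $ i}" by auto
    have "int ?r * w $ i div int ?r = w $ i" for i
      by (rule nonzero_mult_div_cancel_left) (unfold of_nat_eq_0_iff, rule gr_implies_not0[OF r])
    then show "(\<chi> i. (int ?r *s w) $ i div int ?r) = w"
      by (simp only: vector_smult_component vec_lambda_eta)
  qed
  also have "\<dots> = (\<Sum>w\<in>W. ?c * iter_coef k (int ?r *s w))"
  proof (rule sum.mono_neutral_left[OF finite_lattice_box])
    show "{w \<in> W. int ?r *s w \<in> lattice_box (radius k)} \<subseteq> W" by blast
    show "\<forall>w\<in>W - {w \<in> W. int ?r *s w \<in> lattice_box (radius k)}. ?c * iter_coef k (int ?r *s w) = 0"
    proof
      fix w assume "w \<in> W - {w \<in> W. int ?r *s w \<in> lattice_box (radius k)}"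
      then have "int ?r *s w \<notin> lattice_box (radius k)" by blast
      from iter_coef_zero[OF this]
      show "?c * iter_coef k (int ?r *s w) = 0" by (simp only: mult_zero_right)
    qed
  qed
  also have "\<dots> = ?c * (\<Sum>w\<in>W. iter_coef k (int ?r *s w))" by (simp only: sum_distrib_left)
  finally show ?thesis .
qed

text \<open>Read \<open>iter_coef k (q^k w_j - w_i)\<close> as the \<open>(i, j)\<close> entry of
  the \<open>k\<close>-th power of the truncated matrix \<open>split_coef (q w_j - w_i)\<close>. Its
  diagonal carries the exponents \<open>(q^k - 1) w_i\<close> of the trace formula. Substituting
  \<open>v = q^k w_j - w\<close> turns the recursion into a matrix product.\<close>

lemma iter_coef_matrix_step:
  assumes wi: "wi \<in> W"
  shows "iter_coef (Suc k) (int (q ^ Suc k) *s wj - wi) =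
    (\<Sum>w\<in>W. (if linf (int q *s w - wi) \<le> int (D * N) then split_coef (int q *s w - wi) else 0) *
       iter_coef k (int (q ^ k) *s wj - w))"
proof -
  let ?b = "\<lambda>w. int (q ^ k) *s wj - w"
  let ?s = "\<lambda>u. if linf u \<le> int (D * N) then split_coef u else 0"
  have sub: "int (q ^ Suc k) *s wj - wi - int q *s ?b w = int q *s w - wi" for w
    by (simp add: vec_eq_iff algebra_simps)
  have bb: "?b (?b w) = w" for w by simp
  have sub': "int (q ^ Suc k) *s wj - wi - int q *s v = int q *s ?b v - wi" for v
    using sub[of "?b v"] by (simp only: bb)
  have "iter_coef (Suc k) (int (q ^ Suc k) *s wj - wi) =
      (\<Sum>v\<in>lattice_box (radius k). iter_coef k v * ?s (int (q ^ Suc k) *s wj - wi - int q *s v))"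
    by (simp only: iter_coef.simps)
  \<comment> \<open>The index sets correspond only up to vanishing terms. If the partner
    \<open>w\<close> of \<open>v\<close> had \<open>|q w - w_i| \<le> D N\<close>, then
    \<open>q |w| \<le> 2 D N\<close>, and \<open>w\<close> would lie in \<open>W\<close> because
    \<open>q \<ge> 2\<close>; so for \<open>w\<close> outside \<open>W\<close> the guard gives zero.
    For \<open>v\<close> outside its box, \<open>iter_coef\<close> is zero.\<close>
  also have "\<dots> = (\<Sum>w\<in>W. ?s (int q *s w - wi) * iter_coef k (?b w))"
  proof (rule sum.reindex_bij_witness_not_neutral[of "{v \<in> lattice_box (radius k). ?b v \<notin> W}" "{w \<in> W. ?b w \<notin> lattice_box (radius k)}" _ ?b ?b])
    fix v assume v: "v \<in> {v \<in> lattice_box (radius k). ?b v \<notin> W}"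
    have "\<not> linf (int q *s ?b v - wi) \<le> int (D * N)"
    proof
      assume "linf (int q *s ?b v - wi) \<le> int (D * N)"
      then have "int q * linf (?b v) \<le> 2 * int (D * N)"
        using linf_scale_diff[of q "?b v" wi] wi unfolding lattice_box_def by simp
      moreover have "2 * linf (?b v) \<le> int q * linf (?b v)"
        using q by (intro mult_right_mono linf_nonneg) simp
      ultimately show False using v unfolding lattice_box_def by simp
    qed
    then show "iter_coef k v * ?s (int (q ^ Suc k) *s wj - wi - int q *s v) = 0"
      by (simp only: sub' if_False mult_zero_right)
  next
    fix v
    show "?s (int q *s ?b v - wi) * iter_coef k (?b (?b v)) =
        iter_coef k v * ?s (int (q ^ Suc k) *s wj - wi - int q *s v)"
      by (simp only: sub' bb mult.commute)
  qed (auto simp: iter_coef_zero)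
  finally show ?thesis .
qed

end

end

section \<open>Growth of the coefficients\<close>

lemma fps_binomial_sum:
  "finite J \<Longrightarrow> fps_binomial (\<Sum>j\<in>J. c j) = (\<Prod>j\<in>J. fps_binomial (c j))"
  by (induction J rule: finite_induct) (simp_all add: fps_binomial_add_mult)

text \<open>The logarithmic derivative determines the coefficients by a recursion with ring
  operations and division by an integer, so agreement of the data up to degree \<open>N\<close> in
  the inner variable is inherited by every coefficient.\<close>

lemma log_deriv_eq_upto:
  fixes C F :: "'a :: field_char_0 fps fps"
  assumes C: "fps_nth C 0 = 1" "fps_deriv C = - (C * Abs_fps s)"
    and F: "fps_nth F 0 = 1" "fps_deriv F = - (F * Abs_fps t)"
    and st: "\<And>k. fps_eq_upto N (s k) (t k)"
  shows "fps_eq_upto N (fps_nth C k) (fps_nth F k)"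
proof (induction k rule: less_induct)
  case (less k)
  show ?case
  proof (cases k)
    case 0
    then show ?thesis using C(1) F(1) by simp
  next
    case (Suc j)
    have rec: "of_nat (Suc j) * fps_nth H (Suc j) = - (\<Sum>i=0..j. fps_nth H i * h (j - i))"
      if "fps_deriv H = - (H * Abs_fps h)" for H :: "'a fps fps" and h
    proof -
      have "fps_nth (fps_deriv H) j = of_nat (Suc j) * fps_nth H (Suc j)" by simp
      moreover have "fps_nth (- (H * Abs_fps h)) j = - (\<Sum>i=0..j. fps_nth H i * h (j - i))"
        by (simp add: fps_mult_nth)
      ultimately show ?thesis using that by simp
    qed
    have "fps_eq_upto N (of_nat (Suc j) * fps_nth C (Suc j)) (of_nat (Suc j) * fps_nth F (Suc j))"
      unfolding rec[OF C(2)] rec[OF F(2)]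
      by (intro fps_eq_upto_uminus fps_eq_upto_sum fps_eq_upto_mult st less) (use Suc in auto)
    moreover have "fps_nth (of_nat (Suc j) * G) i = of_nat (Suc j) * fps_nth G i" for G :: "'a fps" and i
      using fps_mult_left_const_nth[of "of_nat (Suc j)" G i] by (simp only: fps_of_nat)
    moreover have "(of_nat (Suc j) :: 'a) \<noteq> 0" by (rule of_nat_neq_0)
    ultimately show ?thesis unfolding Suc fps_eq_upto_def by (simp only: mult_cancel_left) blast
  qed
qed

text \<open>No more indices than the box has points can have norm at most \<open>M\<close>; the
  others contribute at least \<open>M\<close> each. With \<open>M\<close> free, this is growth
  faster than linear in \<open>card S\<close>.\<close>

lemma sum_linf_ge:
  fixes v :: "nat \<Rightarrow> int ^ 'n"
  assumes S: "finite S" "inj_on v S"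
  shows "int M * (int (card S) - int (card (lattice_box (int M) :: (int ^ 'n) set))) \<le> (\<Sum>i\<in>S. linf (v i))"
proof -
  let ?S = "{i \<in> S. v i \<in> lattice_box (int M)}"
  have "card ?S = card (v ` ?S)" using S(2) by (intro card_image[symmetric]) (auto simp: inj_on_def)
  also have "\<dots> \<le> card (lattice_box (int M) :: (int ^ 'n) set)" by (intro card_mono finite_lattice_box) auto
  finally have c: "card ?S \<le> card (lattice_box (int M) :: (int ^ 'n) set)" .
  have "card (S - ?S) = card S - card ?S" using S(1) by (intro card_Diff_subset) auto
  moreover have "card ?S \<le> card S" using S(1) by (intro card_mono) auto
  ultimately have "int (card S) - int (card (lattice_box (int M) :: (int ^ 'n) set)) \<le> int (card (S - ?S))"
    using c by linarith
  then have "int M * (int (card S) - int (card (lattice_box (int M) :: (int ^ 'n) set))) \<le> int M * int (card (S - ?S))"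
    by (rule mult_left_mono) simp
  also have "\<dots> = (\<Sum>i\<in>S - ?S. int M)" by simp
  also have "\<dots> \<le> (\<Sum>i\<in>S - ?S. linf (v i))"
    by (rule sum_mono) (auto simp: lattice_box_def)
  also have "\<dots> \<le> (\<Sum>i\<in>S. linf (v i))"
    using S(1) by (intro sum_mono2 linf_nonneg) auto
  finally show ?thesis .
qed

text \<open>If \<open>p i\<close> lay outside \<open>S\<close> for some \<open>i\<close> in
  \<open>S\<close>, it would be fixed, and injectivity would force \<open>p i = i\<close>.\<close>

lemma permutes_fixed_complement:
  assumes p: "p permutes I" and S: "finite S" "S \<subseteq> I" and fixed: "\<And>i. i \<in> I - S \<Longrightarrow> p i = i"
  shows "bij_betw p S S"
proof -
  have inj: "inj p" by (rule permutes_inj[OF p])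
  have "p ` S \<subseteq> S"
  proof
    fix y assume "y \<in> p ` S"
    then obtain i where i: "i \<in> S" "y = p i" by blast
    have "p i \<in> I" using i(1) S(2) permutes_in_image[OF p] by blast
    show "y \<in> S"
    proof (rule ccontr)
      assume "y \<notin> S"
      then have "p (p i) = p i" using fixed \<open>p i \<in> I\<close> i(2) by blast
      then have "p i = i" using inj by (rule injD[rotated])
      then show False using \<open>y \<notin> S\<close> i by simp
    qed
  qed
  then show ?thesis
    using endo_inj_surj[OF S(1)] inj_on_subset[OF inj] by (simp add: bij_betw_def)
qed

text \<open>In a surviving term \<open>p\<close> permutes \<open>S\<close>, so the bounds
  \<open>q |v_(p i)| - |v_i|\<close> add up to \<open>q - 1\<close> times the sum of the norms over
  \<open>S\<close>. The estimate does not involve \<open>n\<close>, which lets the matrix grow with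
  the precision.\<close>

lemma char_fps_order:
  fixes v :: "nat \<Rightarrow> int ^ 'n" and A :: "nat \<Rightarrow> nat \<Rightarrow> 'a :: comm_ring_1 fps"
  assumes q: "q \<ge> 2" and inj: "inj_on v {0..<n}"
    and A: "\<And>i j. ord_ge D (linf (int q *s v j - v i)) (A i j)"
  shows "ord_ge D (int M * (int k - int (card (lattice_box (int M) :: (int ^ 'n) set)))) (fps_nth (char_fps n A) k)"
proof -
  let ?h = "int M * (int k - int (card (lattice_box (int M) :: (int ^ 'n) set)))"
  have termwise: "ord_ge D ?h ((\<Prod>i\<in>S. - A i (p i)) * (\<Prod>i\<in>{0..<n} - S. if i = p i then 1 else 0))"
    if p: "p permutes {0..<n}" and S: "S \<subseteq> {0..<n}" "card S = k" for p S
  proof (cases "\<forall>i\<in>{0..<n} - S. p i = i")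
    case False
    then obtain i where "i \<in> {0..<n} - S" "p i \<noteq> i" by blast
    then have "(\<Prod>i\<in>{0..<n} - S. if i = p i then 1 else (0 :: 'a fps)) = 0"
      by (intro prod_zero bexI[of _ i]) auto
    then show ?thesis by simp
  next
    case True
    have fin: "finite S" using S(1) by (rule finite_subset) simp
    have bij: "bij_betw p S S"
      by (rule permutes_fixed_complement[OF p fin S(1)]) (use True in blast)
    have sum: "(\<Sum>i\<in>S. linf (v (p i))) = (\<Sum>i\<in>S. linf (v i))"
      by (rule sum.reindex_bij_betw[OF bij])
    have "?h \<le> 1 * (\<Sum>i\<in>S. linf (v i))"
      using sum_linf_ge[OF fin inj_on_subset[OF inj S(1)], of M] S(2) by simp
    also have "\<dots> \<le> (int q - 1) * (\<Sum>i\<in>S. linf (v i))"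
      using q by (intro mult_right_mono sum_nonneg linf_nonneg) simp
    also have "\<dots> = (\<Sum>i\<in>S. int q * linf (v (p i)) - linf (v i))"
      by (simp add: sum_subtractf sum left_diff_distrib flip: sum_distrib_left)
    also have "\<dots> \<le> (\<Sum>i\<in>S. linf (int q *s v (p i) - v i))"
      by (intro sum_mono linf_scale_diff)
    finally have le: "?h \<le> (\<Sum>i\<in>S. linf (int q *s v (p i) - v i)) + 0" by simp
    have "ord_ge D (\<Sum>i\<in>S. linf (int q *s v (p i) - v i)) (\<Prod>i\<in>S. - A i (p i))"
      by (intro ord_ge_prod fin ord_ge_uminus A)
    then have "ord_ge D ((\<Sum>i\<in>S. linf (int q *s v (p i) - v i)) + 0)
        ((\<Prod>i\<in>S. - A i (p i)) * (\<Prod>i\<in>{0..<n} - S. if i = p i then 1 else 0))"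
      by (rule ord_ge_mult) (rule ord_ge_trivial[OF order_refl])
    then show ?thesis using le by (rule ord_ge_mono)
  qed
  show ?thesis
    unfolding char_fps_nth
  proof (rule ord_ge_sum)
    fix p assume "p \<in> {p. p permutes {0..<n}}"
    then have "ord_ge D ?h (\<Sum>S | S \<subseteq> {0..<n} \<and> card S = k.
        (\<Prod>i\<in>S. - A i (p i)) * (\<Prod>i\<in>{0..<n} - S. if i = p i then 1 else 0))" (is "ord_ge D ?h ?s")
      using termwise by (intro ord_ge_sum) blast
    then have "ord_ge D ?h ?s" "ord_ge D ?h (- ?s)" using ord_ge_uminus by blast+
    then show "ord_ge D ?h (signof p * ?s)" by (cases "sign p = 1") (auto simp: sign_def)
  qed
qed

context dwork
begin

definition normalized_sum :: "nat \<Rightarrow> 'a fps" where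
  "normalized_sum k = fps_const (inverse (of_nat (q ^ k - 1) ^ CARD('n))) *
     (\<Sum>x\<in>rational_points k. fps_binomial (\<Sum>j<k. g (vpow x (q ^ j))))"

lemma normalized_sum_eq_upto:
  assumes k: "k \<ge> 1"
  shows "fps_eq_upto N (normalized_sum k) (\<Sum>w\<in>lattice_box (int (D * N)). iter_coef N k (int (q ^ k - 1) *s w))"
proof -
  let ?c = "of_nat (q ^ k - 1) ^ CARD('n) :: 'a"
  have c: "?c \<noteq> 0" using order_pos[OF k] by (simp only: power_not_zero of_nat_eq_0_iff) simp
  let ?s = "\<Sum>w\<in>lattice_box (int (D * N)). iter_coef N k (int (q ^ k - 1) *s w)"
  have "fps_eq_upto N (\<Sum>x\<in>rational_points k. fps_binomial (\<Sum>j<k. g (vpow x (q ^ j))))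
      (\<Sum>x\<in>rational_points k. \<Prod>j<k. trunc N (vpow x (q ^ j)))"
    unfolding fps_binomial_sum[OF finite_lessThan]
    by (intro fps_eq_upto_sum fps_eq_upto_prod trunc vpow_torus rational_points_torus[OF k])
  then have "fps_eq_upto N (normalized_sum k)
      (fps_const (inverse ?c) * (\<Sum>x\<in>rational_points k. \<Prod>j<k. trunc N (vpow x (q ^ j))))"
    unfolding normalized_sum_def by (intro fps_eq_upto_mult fps_eq_upto_refl)
  also have "fps_const (inverse ?c) * (\<Sum>x\<in>rational_points k. \<Prod>j<k. trunc N (vpow x (q ^ j))) =
      fps_const (inverse ?c * ?c) * ?s"
    unfolding sum_prod_trunc[OF k] by (simp only: mult.assoc[symmetric] fps_const_mult)
  also have "\<dots> = ?s" by (simp only: field_class.field_inverse[OF c] fps_const_1_eq_1 mult_1_left)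
  finally show ?thesis .
qed

text \<open>One T-degree \<open>N\<close> is treated at a time, each with its own matrix on the box
  of radius \<open>D N\<close>. Through degree \<open>N\<close> its determinant has the logarithmic
  derivative of \<open>C\<close>, and the bound on its coefficients is the same for all
  \<open>N\<close>.\<close>

theorem coefficient_order:
  fixes C :: "'a fps fps"
  assumes C: "fps_nth C 0 = 1" "fps_deriv C = - (C * Abs_fps (\<lambda>k. normalized_sum (Suc k)))"
  shows "ord_ge D (int M * (int k - int (card (lattice_box (int M) :: (int ^ 'n) set)))) (fps_nth C k)"
proof -
  let ?h = "int M * (int k - int (card (lattice_box (int M) :: (int ^ 'n) set)))"
  have "fps_nth (fps_nth C k) N = 0" if N: "int D * int N < ?h" for N
  proof -
    let ?W = "lattice_box (int (D * N)) :: (int ^ 'n) set"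
    obtain v where v: "bij_betw v {0..<card ?W} ?W" using ex_bij_betw_nat_finite[OF finite_lattice_box] by blast
    let ?n = "card ?W"
    have v': "bij_betw v {..<?n} ?W" using v by (simp add: atLeast0LessThan)
    define A where "A i j = (if linf (int q *s v j - v i) \<le> int (D * N) then split_coef (int q *s v j - v i) else 0)" for i j
    define pw where "pw l i j = iter_coef N l (int (q ^ l) *s v j - v i)" for l i j
    have inj: "inj_on v {0..<?n}" using v by (rule bij_betw_imp_inj_on)
    have vW: "v i \<in> ?W" if "i < ?n" for i using bij_betwE[OF v] that by simp
    have pw0: "pw 0 i j = (if i = j then 1 else 0)" if "i < ?n" "j < ?n" for i j
    proof -
      have "v j - v i = 0 \<longleftrightarrow> i = j" using inj_onD[OF inj, of j i] that by auto
      then show ?thesis by (simp add: pw_def)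
    qed
    have pwS: "pw (Suc l) i j = (\<Sum>b<?n. A i b * pw l b j)" if "i < ?n" "j < ?n" for l i j
    proof -
      have "pw (Suc l) i j = (\<Sum>w\<in>?W. (if linf (int q *s w - v i) \<le> int (D * N) then split_coef (int q *s w - v i) else 0) *
          iter_coef N l (int (q ^ l) *s v j - w))"
        unfolding pw_def by (rule iter_coef_matrix_step[OF vW[OF that(1)]])
      also have "\<dots> = (\<Sum>b<?n. A i b * pw l b j)"
        unfolding A_def pw_def by (rule sum.reindex_bij_betw[OF v', symmetric])
      finally show ?thesis .
    qed
    \<comment> \<open>The diagonal exponents \<open>q^l w - w\<close> are the multiples
      \<open>(q^l - 1) w\<close> picked out by the sum over rational points.\<close>
    have tr: "(\<Sum>i<?n. pw l i i) = (\<Sum>w\<in>?W. iter_coef N l (int (q ^ l - 1) *s w))" for l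
    proof -
      have q1: "int (q ^ l) = int (q ^ l - 1) + 1" using q by (simp add: of_nat_diff)
      have "int (q ^ l) *s w - w = int (q ^ l - 1) *s w" for w :: "int ^ 'n"
        unfolding q1 by (simp add: Finite_Cartesian_Product.vec_eq_iff algebra_simps)
      then show ?thesis
        unfolding pw_def using sum.reindex_bij_betw[OF v', of "\<lambda>w. iter_coef N l (int (q ^ l - 1) *s w)"]
        by (simp only:)
    qed
    have "fps_eq_upto N (fps_nth C k) (fps_nth (char_fps ?n A) k)"
    proof (rule log_deriv_eq_upto[OF C char_fps_nth_0 char_fps_deriv[OF pw0 pwS]])
      fix l
      show "fps_eq_upto N (normalized_sum (Suc l)) (\<Sum>i<?n. pw (Suc l) i i)"
        unfolding tr by (rule normalized_sum_eq_upto) simp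
    qed
    then have "fps_nth (fps_nth C k) N = fps_nth (fps_nth (char_fps ?n A) k) N"
      unfolding fps_eq_upto_def by simp
    moreover have "ord_ge D (linf (int q *s v j - v i)) (A i j)" for i j
      unfolding A_def using ord_split_coef by simp
    then have "ord_ge D ?h (fps_nth (char_fps ?n A) k)"
      by (rule char_fps_order[OF q inj])
    then have "fps_nth (fps_nth (char_fps ?n A) k) N = 0" using N unfolding ord_ge_def by blast
    ultimately show ?thesis by simp
  qed
  then show ?thesis unfolding ord_ge_def by blast
qed

end

section \<open>Entire series\<close>

text \<open>Growth of every slope \<open>M\<close>, up to an offset \<open>B\<close> depending on
  \<open>M\<close>. Unlike a limit of quotients, this form passes to products directly, the offsets
  being added.\<close>

definition entire_growth :: "'a :: zero fps fps \<Rightarrow> bool" where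
  "entire_growth F \<longleftrightarrow> (\<forall>M. \<exists>B. \<forall>k. ord_ge 1 (int M * (int k - int B)) (fps_nth F k))"

lemma entire_growth_imp_T_adic_entire:
  assumes "entire_growth F"
  shows "T_adic_entire F"
  unfolding T_adic_entire_def tendsto_PInfty
proof
  fix r :: real
  \<comment> \<open>The factor \<open>2\<close> pays for the offset: \<open>k - B\<close> is at
    least \<open>k / 2\<close> once \<open>k\<close> is beyond \<open>2 B\<close>.\<close>
  define M where "M = nat \<lceil>2 * \<bar>r\<bar> + 1\<rceil>"
  have M: "2 * r < real M" unfolding M_def by linarith
  obtain B where B: "\<And>k. ord_ge 1 (int M * (int k - int B)) (fps_nth F k)"
    using assms unfolding entire_growth_def by blast
  show "\<forall>\<^sub>F k in sequentially. ereal r < ord_T (fps_nth F k) / ereal (real k)"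
    using eventually_ge_at_top[of "2 * B + 1"]
  proof eventually_elim
    case (elim k)
    then have k: "real k > 0" by simp
    show ?case
    proof (cases "fps_nth F k = 0")
      case True
      then show ?thesis using k by (simp add: ord_T_def)
    next
      case False
      let ?d = "subdegree (fps_nth F k)"
      have "fps_nth (fps_nth F k) ?d \<noteq> 0" using False by simp
      then have "\<not> int ?d < int M * (int k - int B)"
        using B[of k] unfolding ord_ge_def by auto
      then have "int M * (int k - int B) \<le> int ?d" by simp
      then have "real_of_int (int M * (int k - int B)) \<le> real_of_int (int ?d)" by (simp only: of_int_le_iff)
      then have d: "real M * (real k - real B) \<le> real ?d" by simp
      have "real k / 2 \<le> real k - real B" using elim by linarith
      then have "real M * (real k / 2) \<le> real M * (real k - real B)" by (intro mult_left_mono) auto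
      moreover have "r * real k < real M * (real k / 2)" using M k by simp
      ultimately have "r * real k < real ?d" using d by linarith
      then have "r < real ?d / real k" using k by (simp add: pos_less_divide_eq)
      then show ?thesis using False k by (simp add: ord_T_def)
    qed
  qed
qed

lemma entire_growth_1: "entire_growth 1"
  unfolding entire_growth_def
proof (intro allI exI[of _ 0])
  fix M k
  show "ord_ge 1 (int M * (int k - int 0)) (fps_nth (1 :: 'a fps fps) k)"
    by (cases k) (simp_all add: ord_ge_trivial)
qed

lemma entire_growth_mult:
  fixes F G :: "'a :: comm_ring_1 fps fps"
  assumes "entire_growth F" "entire_growth G"
  shows "entire_growth (F * G)"
  unfolding entire_growth_def
proof
  fix M
  obtain B where B: "\<And>k. ord_ge 1 (int M * (int k - int B)) (fps_nth F k)"
    using assms(1) unfolding entire_growth_def by blast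
  obtain B' where B': "\<And>k. ord_ge 1 (int M * (int k - int B')) (fps_nth G k)"
    using assms(2) unfolding entire_growth_def by blast
  have "ord_ge 1 (int M * (int k - int (B + B'))) (fps_nth (F * G) k)" for k
    unfolding fps_mult_nth
  proof (rule ord_ge_sum)
    fix i assume i: "i \<in> {0..k}"
    have "int M * (int k - int (B + B')) = int M * (int i - int B) + int M * (int (k - i) - int B')"
      using i by (simp add: of_nat_diff algebra_simps)
    then show "ord_ge 1 (int M * (int k - int (B + B'))) (fps_nth F i * fps_nth G (k - i))"
      using ord_ge_mult[OF B[of i] B'[of "k - i"]] by (simp only:)
  qed
  then show "\<exists>B. \<forall>k. ord_ge 1 (int M * (int k - int B)) (fps_nth (F * G) k)" by blast
qed

text \<open>The substitution \<open>F(c X)\<close>, which multiplies the \<open>k\<close>-th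
  logarithmic coefficient by \<open>c^k\<close>.\<close>

definition fps_rescale :: "'a :: comm_ring_1 \<Rightarrow> 'a fps fps \<Rightarrow> 'a fps fps" where
  "fps_rescale c F = Abs_fps (\<lambda>k. fps_const (c ^ k) * fps_nth F k)"

lemma ord_ge_const_mult:
  "ord_ge D h F \<Longrightarrow> ord_ge D h (fps_const c * F :: 'a :: semiring_0 fps)"
  by (simp add: ord_ge_def)

lemma entire_growth_rescale: "entire_growth F \<Longrightarrow> entire_growth (fps_rescale c F)"
  unfolding entire_growth_def fps_rescale_def fps_nth_Abs_fps using ord_ge_const_mult by blast

text \<open>\<open>has_log_coeffs F s\<close> says $F = \exp(\sum_{k \ge 1} s_k X^k / k)$.\<close>

definition has_log_coeffs :: "'a :: comm_ring_1 fps fps \<Rightarrow> (nat \<Rightarrow> 'a fps) \<Rightarrow> bool" where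
  "has_log_coeffs F s \<longleftrightarrow> fps_nth F 0 = 1 \<and> fps_deriv F = F * Abs_fps (\<lambda>k. s (Suc k))"

lemma has_log_coeffs_1: "has_log_coeffs 1 (\<lambda>_. 0)"
proof -
  have "Abs_fps (\<lambda>k. 0) = (0 :: 'a fps fps)" by (rule fps_ext) simp
  then show ?thesis by (simp add: has_log_coeffs_def)
qed

lemma has_log_coeffs_mult:
  assumes "has_log_coeffs F s" "has_log_coeffs G t"
  shows "has_log_coeffs (F * G) (\<lambda>k. s k + t k)"
proof -
  have "Abs_fps (\<lambda>k. s (Suc k) + t (Suc k)) = Abs_fps (\<lambda>k. s (Suc k)) + Abs_fps (\<lambda>k. t (Suc k))"
    by (rule fps_ext) simp
  then show ?thesis using assms by (simp add: has_log_coeffs_def algebra_simps)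
qed

lemma has_log_coeffs_rescale:
  assumes "has_log_coeffs F s"
  shows "has_log_coeffs (fps_rescale c F) (\<lambda>k. fps_const (c ^ k) * s k)"
  unfolding has_log_coeffs_def
proof
  show "fps_nth (fps_rescale c F) 0 = 1" using assms by (simp add: has_log_coeffs_def fps_rescale_def)
  show "fps_deriv (fps_rescale c F) = fps_rescale c F * Abs_fps (\<lambda>k. fps_const (c ^ Suc k) * s (Suc k))"
  proof (rule fps_ext)
    fix k
    have "fps_nth (fps_deriv F) k = fps_nth (F * Abs_fps (\<lambda>k. s (Suc k))) k"
      using assms by (simp add: has_log_coeffs_def)
    then have rec: "of_nat (Suc k) * fps_nth F (Suc k) = (\<Sum>i=0..k. fps_nth F i * s (Suc (k - i)))"
      by (simp add: fps_mult_nth)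
    have "fps_nth (fps_deriv (fps_rescale c F)) k = fps_const (c ^ Suc k) * (of_nat (Suc k) * fps_nth F (Suc k))"
      unfolding fps_deriv_nth fps_rescale_def fps_nth_Abs_fps Suc_eq_plus1[symmetric] by (rule mult.left_commute)
    also have "\<dots> = (\<Sum>i=0..k. fps_const (c ^ Suc k) * (fps_nth F i * s (Suc (k - i))))"
      unfolding rec by (rule sum_distrib_left)
    also have "\<dots> = (\<Sum>i=0..k. (fps_const (c ^ i) * fps_nth F i) * (fps_const (c ^ Suc (k - i)) * s (Suc (k - i))))"
    proof (rule sum.cong[OF refl])
      fix i assume "i \<in> {0..k}"
      then have "Suc k = i + Suc (k - i)" by simp
      then have "c ^ Suc k = c ^ i * c ^ Suc (k - i)" by (metis power_add)
      then have "fps_const (c ^ Suc k) = fps_const (c ^ i) * fps_const (c ^ Suc (k - i))"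
        by (simp only: fps_const_mult)
      then show "fps_const (c ^ Suc k) * (fps_nth F i * s (Suc (k - i))) =
          (fps_const (c ^ i) * fps_nth F i) * (fps_const (c ^ Suc (k - i)) * s (Suc (k - i)))"
        by (simp only: mult_ac)
    qed
    finally show "fps_nth (fps_deriv (fps_rescale c F)) k =
        fps_nth (fps_rescale c F * Abs_fps (\<lambda>k. fps_const (c ^ Suc k) * s (Suc k))) k"
      by (simp only: fps_mult_nth fps_rescale_def fps_nth_Abs_fps)
  qed
qed

lemma has_log_coeffs_unique:
  fixes F G :: "'a :: field_char_0 fps fps"
  assumes F: "has_log_coeffs F s" and G: "has_log_coeffs G t" and st: "\<And>k. s (Suc k) = t (Suc k)"
  shows "F = G"
proof -
  have neg: "fps_deriv H = - (H * Abs_fps (\<lambda>k. - h (Suc k)))" if "has_log_coeffs H h" for H :: "'a fps fps" and h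
  proof -
    have "Abs_fps (\<lambda>k. - h (Suc k)) = - Abs_fps (\<lambda>k. h (Suc k))" by (rule fps_ext) simp
    then show ?thesis using that by (simp add: has_log_coeffs_def)
  qed
  have "fps_eq_upto N (fps_nth F k) (fps_nth G k)" for N k
    by (rule log_deriv_eq_upto[OF _ neg[OF F] _ neg[OF G]])
       (use F G st in \<open>simp_all add: has_log_coeffs_def\<close>)
  then show ?thesis unfolding fps_eq_upto_def by (intro fps_ext) blast
qed

text \<open>Chain rule for the exponential series; the factor \<open>1 / k\<close> cancels on
  differentiation. It is through this property that \<open>L_f\<close> and \<open>C_f\<close> are
  handled.\<close>

lemma exp_series_has_log_coeffs:
  "has_log_coeffs (exp_series (Abs_fps (\<lambda>k. if k = 0 then 0 else fps_const (1 / of_nat k) * s k))) s"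
proof -
  let ?A = "Abs_fps (\<lambda>k. if k = 0 then 0 else fps_const (1 / of_nat k) * s k)"
  let ?E = "Abs_fps (\<lambda>i. fps_const (1 / fact i)) :: 'a fps fps"
  have dE: "fps_deriv ?E = ?E"
  proof (rule fps_ext)
    fix n
    have "of_nat (Suc n) * (1 / fact (Suc n)) = (1 / fact n :: 'a)"
      by (simp add: field_simps del: of_nat_Suc)
    then have "fps_const (of_nat (Suc n)) * fps_const (1 / fact (Suc n)) = fps_const (1 / fact n :: 'a)"
      by (simp only: fps_const_mult)
    then show "fps_nth (fps_deriv ?E) n = fps_nth ?E n"
      by (simp only: fps_deriv_nth fps_nth_Abs_fps Suc_eq_plus1[symmetric] fps_of_nat)
  qed
  have dA: "fps_deriv ?A = Abs_fps (\<lambda>k. s (Suc k))"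
  proof (rule fps_ext)
    fix k
    have "of_nat (Suc k) * (1 / of_nat (Suc k)) = (1 :: 'a)" by (simp del: of_nat_Suc)
    then have "fps_const (of_nat (Suc k)) * fps_const (1 / of_nat (Suc k)) = (1 :: 'a fps)"
      by (simp only: fps_const_mult fps_const_1_eq_1)
    then have one: "of_nat (Suc k) * fps_const (1 / of_nat (Suc k)) = (1 :: 'a fps)"
      by (simp only: fps_of_nat)
    have "fps_nth (fps_deriv ?A) k = of_nat (Suc k) * (fps_const (1 / of_nat (Suc k)) * s (Suc k))"
      by simp
    also have "\<dots> = (of_nat (Suc k) * fps_const (1 / of_nat (Suc k))) * s (Suc k)" by (simp only: mult.assoc)
    finally show "fps_nth (fps_deriv ?A) k = fps_nth (Abs_fps (\<lambda>k. s (Suc k))) k"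
      unfolding one by simp
  qed
  have "fps_deriv (exp_series ?A) = exp_series ?A * fps_deriv ?A"
    unfolding exp_series_def by (subst fps_compose_deriv) (simp_all only: dE, simp)
  moreover have "fps_nth (exp_series ?A) 0 = 1"
    by (simp add: exp_series_def fps_compose_nth)
  ultimately show ?thesis unfolding has_log_coeffs_def dA by simp
qed

text \<open>With \<open>s\<^sub>m(k) = (c\<^sup>k - 1)\<^sup>m t\<^sub>k\<close> one has \<open>s\<^sub>m\<^sub>+\<^sub>1(k) = c\<^sup>k s\<^sub>m(k) - s\<^sub>m(k)\<close>, so the series for \<open>m + 1\<close> is a
  quotient of the series for \<open>m\<close> at \<open>c X\<close> and at \<open>X\<close>.\<close>

lemma entire_quotient:
  fixes F :: "'a :: field_char_0 fps fps"
  assumes F: "entire_growth F" "has_log_coeffs F (\<lambda>k. - t k)"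
  shows "\<exists>G H \<alpha> \<beta>. entire_growth G \<and> entire_growth H \<and> has_log_coeffs G \<alpha> \<and> has_log_coeffs H \<beta> \<and>
    (\<forall>k. \<alpha> k - \<beta> k = fps_const ((c ^ k - 1) ^ m) * t k)"
proof (induction m)
  case 0
  \<comment> \<open>The induction starts from \<open>1 / F\<close>, because the logarithmic
    coefficients of \<open>F\<close> carry a minus sign.\<close>
  show ?case
    by (rule exI[of _ 1], rule exI[of _ F], rule exI[of _ "\<lambda>_. 0"], rule exI[of _ "\<lambda>k. - t k"])
       (use F entire_growth_1 has_log_coeffs_1 in simp)
next
  case (Suc m)
  then obtain G H \<alpha> \<beta> where GH: "entire_growth G" "entire_growth H" "has_log_coeffs G \<alpha>" "has_log_coeffs H \<beta>"
    and eq: "\<And>k. \<alpha> k - \<beta> k = fps_const ((c ^ k - 1) ^ m) * t k" by blast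
  have "(fps_const (c ^ k) * \<alpha> k + \<beta> k) - (fps_const (c ^ k) * \<beta> k + \<alpha> k) = fps_const ((c ^ k - 1) ^ Suc m) * t k" for k
  proof -
    have "(fps_const (c ^ k) * \<alpha> k + \<beta> k) - (fps_const (c ^ k) * \<beta> k + \<alpha> k) = (fps_const (c ^ k) - 1) * (\<alpha> k - \<beta> k)"
      by (simp add: algebra_simps)
    also have "fps_const (c ^ k) - 1 = fps_const (c ^ k - 1)" by (simp flip: fps_const_sub)
    also have "fps_const (c ^ k - 1) * (\<alpha> k - \<beta> k) = fps_const ((c ^ k - 1) ^ Suc m) * t k"
      unfolding eq by (simp only: mult.assoc[symmetric] fps_const_mult power_Suc)
    finally show ?thesis .
  qed
  then show ?case
    using entire_growth_mult[OF entire_growth_rescale[OF GH(1), of c] GH(2)]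
      entire_growth_mult[OF entire_growth_rescale[OF GH(2), of c] GH(1)]
      has_log_coeffs_mult[OF has_log_coeffs_rescale[OF GH(3), of c] GH(4)]
      has_log_coeffs_mult[OF has_log_coeffs_rescale[OF GH(4), of c] GH(3)]
    by blast
qed

section \<open>Exponential sums\<close>

text \<open>The sums have coefficients in Q_p, while the trace splits into conjugates only in the
  closure; vanishing of coefficients can be tested after this injective map.\<close>

definition fps_to_ac :: "'a :: field fps \<Rightarrow> 'a alg_closure fps" where
  "fps_to_ac F = Abs_fps (\<lambda>i. to_ac (fps_nth F i))"

lemma fps_to_ac_nth [simp]: "fps_nth (fps_to_ac F) i = to_ac (fps_nth F i)"
  by (simp add: fps_to_ac_def)

lemma fps_to_ac_0: "fps_to_ac 0 = 0"
  and fps_to_ac_1: "fps_to_ac 1 = 1"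
  and fps_to_ac_add: "fps_to_ac (F + G) = fps_to_ac F + fps_to_ac G"
  and fps_to_ac_uminus: "fps_to_ac (- F) = - fps_to_ac F"
  and fps_to_ac_mult: "fps_to_ac (F * G) = fps_to_ac F * fps_to_ac G"
  and fps_to_ac_const: "fps_to_ac (fps_const c) = fps_const (to_ac c)"
  by (rule fps_ext; simp add: fps_mult_nth to_ac_sum)+

lemma fps_to_ac_sum: "fps_to_ac (\<Sum>i\<in>I. F i) = (\<Sum>i\<in>I. fps_to_ac (F i))"
  by (induction I rule: infinite_finite_induct) (simp_all add: fps_to_ac_0 fps_to_ac_add)

lemma fps_to_ac_binomial: "fps_to_ac (fps_binomial c) = fps_binomial (to_ac (c :: 'a :: field_char_0))"
proof (rule fps_ext)
  fix k
  have "to_ac (of_nat (fact k) :: 'a) = of_nat (fact k)" by (rule to_ac_of_nat)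
  then have "to_ac (fact k :: 'a) = fact k" by (simp only: of_nat_fact)
  then show "fps_nth (fps_to_ac (fps_binomial c)) k = fps_nth (fps_binomial (to_ac c)) k"
    by (simp add: gbinomial_prod_rev to_ac_prod)
qed

lemma sum_lessThan_add: "(\<Sum>l<m + n. h l) = (\<Sum>l<m. h l) + (\<Sum>i<n. h (m + i :: nat) :: 'a :: comm_monoid_add)"
  by (induction n) (simp_all add: add.assoc)

text \<open>Writing \<open>l = a j + i\<close> groups \<open>a k\<close> Frobenius twists into
  \<open>k\<close> blocks, one for each power of the \<open>q\<close>-Frobenius.\<close>

lemma sum_lessThan_mult: "(\<Sum>l<a * k. h l) = (\<Sum>j<k. \<Sum>i<a. h (a * j + i :: nat) :: 'a :: comm_monoid_add)"
proof (induction k)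
  case (Suc k)
  have "(\<Sum>l<a * k + a. h l) = (\<Sum>l<a * k. h l) + (\<Sum>i<a. h (a * k + i))" by (rule sum_lessThan_add)
  then show ?case using Suc by (simp add: add.commute[of a])
qed simp

locale exponential_sum =
  fixes f :: "int ^ 'n \<Rightarrow>\<^sub>0 'p :: prime_card padic_closure" and a q :: nat
  assumes a: "a \<ge> 1" and q_eq: "q = CARD('p) ^ a"
    and coeffs: "Poly_Mapping.lookup f u \<noteq> 0 \<Longrightarrow> Poly_Mapping.lookup f u \<in> roots_of_unity (q - 1)"
begin

definition frob_sum :: "'p padic_closure ^ 'n \<Rightarrow> 'p padic_closure" where
  "frob_sum x = (\<Sum>i<a. \<Sum>u\<in>Poly_Mapping.keys f. (Poly_Mapping.lookup f u * vmonom x u) ^ (CARD('p) ^ i))"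

text \<open>A crude bound by the sum of all norms that occur. The summand \<open>1\<close> makes it
  positive, as needed when orders are converted from units of \<open>1 / width\<close> to
  integers.\<close>

definition width :: nat where
  "width = 1 + (\<Sum>i<a. \<Sum>u\<in>Poly_Mapping.keys f. CARD('p) ^ i * nat (linf u))"

lemma q_power: "q ^ k = CARD('p) ^ (a * k)"
  unfolding q_eq by (simp add: power_mult)

lemma q_ge_2: "q \<ge> 2"
  unfolding q_eq using one_less_power[OF prime_gt_1_nat[OF prime_card[where 'a = 'p]], of a] a by simp

lemma frob_sum_laurent: "laurent_fun (int width) frob_sum"
  unfolding frob_sum_def
proof (intro laurent_fun_sum)
  fix i u assume i: "i \<in> {..<a}" and u: "u \<in> Poly_Mapping.keys f"
  have "CARD('p) ^ i * nat (linf u) \<le> (\<Sum>u\<in>Poly_Mapping.keys f. CARD('p) ^ i * nat (linf u))"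
    by (rule member_le_sum[OF u]) auto
  also have "\<dots> \<le> (\<Sum>i<a. \<Sum>u\<in>Poly_Mapping.keys f. CARD('p) ^ i * nat (linf u))"
    by (rule member_le_sum[OF i]) auto
  finally have "int (CARD('p) ^ i * nat (linf u)) \<le> int width"
    unfolding width_def of_nat_le_iff by simp
  moreover have "int (CARD('p) ^ i * nat (linf u)) = linf (int (CARD('p) ^ i) *s u)"
    unfolding linf_scale using linf_nonneg[of u] by simp
  ultimately have "laurent_fun (int width) (\<lambda>x. Poly_Mapping.lookup f u ^ (CARD('p) ^ i) * vmonom x (int (CARD('p) ^ i) *s u))"
    by (intro laurent_fun_scale laurent_fun_vmonom) (simp only:)
  then show "laurent_fun (int width) (\<lambda>x. (Poly_Mapping.lookup f u * vmonom x u) ^ (CARD('p) ^ i))"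
    by (simp only: power_mult_distrib vmonom_power)
qed

sublocale dwork frob_sum width q
proof
  show "q \<ge> 2" by (rule q_ge_2)
  show "laurent_fun (int width) frob_sum" by (rule frob_sum_laurent)
next
  fix k :: nat assume k: "k \<ge> 1"
  then have ak: "a * k > 0" using a by simp
  have pos: "q ^ k - 1 > 0" unfolding q_power by (rule CARD_power_minus_1_pos[OF ak])
  show "card {z :: 'p padic_closure. z ^ (q ^ k - 1) = 1} = q ^ k - 1"
    using card_roots_of_unity(1)[OF pos, where 'p = 'p] unfolding roots_of_unity_def .
  show "\<exists>\<omega> :: 'p padic_closure. \<forall>j. \<omega> ^ j = 1 \<longleftrightarrow> (q ^ k - 1) dvd j"
    by (rule primitive_root_of_unity_exists[OF pos])
qed

lemma rational_points_eq: "rational_points k = {x. \<forall>i. x $ i \<in> roots_of_unity (q ^ k - 1)}"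
  unfolding rational_points_def roots_of_unity_def by simp

lemma roots_of_unity_q: "roots_of_unity (q - 1) \<subseteq> (roots_of_unity (q ^ k - 1) :: 'p padic_closure set)"
proof
  fix z :: "'p padic_closure" assume z: "z \<in> roots_of_unity (q - 1)"
  have "q - 1 dvd q ^ k - 1"
  proof -
    have "int q - 1 dvd int q ^ k - 1" by (rule dvdI[OF power_diff_1_eq])
    then have "int (q - 1) dvd int (q ^ k - 1)" using q_ge_2 by (simp add: of_nat_diff)
    then show ?thesis by (simp only: int_dvd_int_iff)
  qed
  then obtain c where c: "q ^ k - 1 = (q - 1) * c" by (elim dvdE)
  show "z \<in> roots_of_unity (q ^ k - 1)" using z unfolding roots_of_unity_iff c by (simp add: power_mult)
qed

text \<open>Zero and the \<open>(q - 1)\<close>-th roots of unity are fixed by the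
  \<open>q\<close>-th power. Hence raising the terms of \<open>f\<close> to the power
  \<open>q^j\<close> amounts to replacing \<open>x\<close> by \<open>x^(q^j)\<close>.\<close>

lemma coeff_frobenius: "Poly_Mapping.lookup f u ^ (q ^ j) = Poly_Mapping.lookup f u"
proof (cases "Poly_Mapping.lookup f u = 0")
  case False
  let ?c = "Poly_Mapping.lookup f u"
  have "?c ^ (q ^ j - 1) = 1" using coeffs[OF False] roots_of_unity_q[of j] unfolding roots_of_unity_iff[symmetric] by blast
  moreover have "?c ^ (q ^ j - 1) * ?c = ?c ^ (q ^ j)" by (rule power_minus_mult) (use q_ge_2 in simp)
  ultimately show ?thesis by simp
qed (use q_ge_2 in \<open>simp add: power_0_left\<close>)

lemma vmonom_root_of_unity:
  assumes "x \<in> rational_points k"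
  shows "vmonom x u \<in> roots_of_unity (q ^ k - 1)"
proof -
  have "(x $ i powi e) ^ (q ^ k - 1) = 1" for i e
  proof -
    have "(x $ i powi e) ^ (q ^ k - 1) = (x $ i ^ (q ^ k - 1)) powi e"
      by (simp only: power_int_of_nat[symmetric] power_int_mult[symmetric] mult.commute)
    then show ?thesis using assms unfolding rational_points_def by simp
  qed
  then show ?thesis unfolding roots_of_unity_iff vmonom_def prod_power_distrib by simp
qed

text \<open>The terms of \<open>f(x)\<close> are \<open>(q^k - 1)\<close>-th roots of unity, so the
  trace sums their \<open>p^l\<close>-th powers over \<open>l < a k\<close>. With
  \<open>l = a j + i\<close>, the power \<open>q^j\<close> is absorbed into the point and the powers
  \<open>p^i\<close> make up \<open>frob_sum\<close>.\<close>

lemma to_ac_trace: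
  assumes k: "k \<ge> 1" and x: "x \<in> rational_points k"
  shows "to_ac (field_trace (Q_unram (q ^ k)) (laurent_eval f x)) = (\<Sum>j<k. frob_sum (vpow x (q ^ j)))"
proof -
  let ?w = "\<lambda>u. Poly_Mapping.lookup f u * vmonom x u"
  let ?U = "Poly_Mapping.keys f"
  have ak: "a * k > 0" using a k by simp
  have "?w u \<in> roots_of_unity (CARD('p) ^ (a * k) - 1)" if "u \<in> ?U" for u
    unfolding q_power[symmetric]
    using coeffs[of u] that roots_of_unity_q[of k] vmonom_root_of_unity[OF x, of u]
    by (intro roots_of_unity_mult) (auto simp: in_keys_iff)
  then have "to_ac (field_trace (Q_unram (q ^ k)) (\<Sum>u\<in>?U. ?w u)) = (\<Sum>l<a * k. \<Sum>u\<in>?U. ?w u ^ (CARD('p) ^ l))"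
    unfolding q_power by (rule field_trace_sum_roots_of_unity[OF ak])
  also have "(\<Sum>u\<in>?U. ?w u) = laurent_eval f x" unfolding laurent_eval_def vmonom_def ..
  also have "(\<Sum>l<a * k. \<Sum>u\<in>?U. ?w u ^ (CARD('p) ^ l)) = (\<Sum>j<k. \<Sum>i<a. \<Sum>u\<in>?U. ?w u ^ (CARD('p) ^ (a * j + i)))"
    by (rule sum_lessThan_mult)
  also have "\<dots> = (\<Sum>j<k. frob_sum (vpow x (q ^ j)))"
    unfolding frob_sum_def
  proof (intro sum.cong refl)
    fix j i u
    have "?w u ^ (CARD('p) ^ (a * j + i)) = (?w u ^ (q ^ j)) ^ (CARD('p) ^ i)"
      unfolding q_power power_mult[symmetric] power_add ..
    also have "?w u ^ (q ^ j) = Poly_Mapping.lookup f u * vmonom (vpow x (q ^ j)) u"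
      unfolding power_mult_distrib coeff_frobenius vmonom_vpow vmonom_power ..
    finally show "?w u ^ (CARD('p) ^ (a * j + i)) = (Poly_Mapping.lookup f u * vmonom (vpow x (q ^ j)) u) ^ (CARD('p) ^ i)" .
  qed
  finally show ?thesis .
qed

definition trace_coeff :: "nat \<Rightarrow> 'p padic fps" where
  "trace_coeff k = fps_const (1 / (of_nat q ^ k - 1) ^ CARD('n)) * S_sum q f k"

lemma fps_to_ac_trace_coeff:
  assumes k: "k \<ge> 1"
  shows "fps_to_ac (trace_coeff k) = normalized_sum k"
proof -
  have "fps_to_ac (S_sum q f k) = (\<Sum>x\<in>rational_points k. fps_binomial (to_ac (field_trace (Q_unram (q ^ k)) (laurent_eval f x))))"
    unfolding S_sum_def fps_to_ac_sum fps_to_ac_binomial rational_points_eq ..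
  also have "\<dots> = (\<Sum>x\<in>rational_points k. fps_binomial (\<Sum>j<k. frob_sum (vpow x (q ^ j))))"
    by (intro sum.cong refl arg_cong[where f = fps_binomial] to_ac_trace[OF k])
  finally have S: "fps_to_ac (S_sum q f k) = \<dots>" .
  have "(of_nat (q ^ k - 1) :: 'p padic_closure) = of_nat q ^ k - 1"
    using q_ge_2 by (simp add: of_nat_diff)
  then show ?thesis
    unfolding trace_coeff_def normalized_sum_def fps_to_ac_mult fps_to_ac_const S
    by (simp add: divide_inverse)
qed

lemma C_function_log: "has_log_coeffs (C_function q f) (\<lambda>k. - trace_coeff k)"
proof -
  have "(if k = 0 then 0 else fps_const (- 1 / (of_nat q ^ k - 1) ^ CARD('n) / of_nat k) * S_sum q f k) =
      (if k = 0 then 0 else fps_const (1 / of_nat k) * - trace_coeff k)" for k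
  proof -
    have "- 1 / (of_nat q ^ k - 1) ^ CARD('n) / of_nat k = 1 / of_nat k * - (1 / (of_nat q ^ k - 1 :: 'p padic) ^ CARD('n))"
      by simp
    then have "fps_const (- 1 / (of_nat q ^ k - 1) ^ CARD('n) / of_nat k) =
        fps_const (1 / of_nat k) * - fps_const (1 / (of_nat q ^ k - 1 :: 'p padic) ^ CARD('n))"
      by (simp only: fps_const_mult fps_const_neg)
    then show ?thesis unfolding trace_coeff_def by (simp only: mult.assoc mult_minus_left)
  qed
  then show ?thesis
    unfolding C_function_def using exp_series_has_log_coeffs[of "\<lambda>k. - trace_coeff k"] by (simp only:)
qed

lemma C_function_growth: "entire_growth (C_function q f)"
  unfolding entire_growth_def
proof
  fix M
  let ?C = "C_function q f"
  define C' where "C' = Abs_fps (\<lambda>k. fps_to_ac (fps_nth ?C k))"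
  have C0: "fps_nth C' 0 = 1"
    using C_function_log by (simp add: C'_def has_log_coeffs_def fps_to_ac_1)
  have "fps_deriv C' = - (C' * Abs_fps (\<lambda>k. normalized_sum (Suc k)))"
  proof (rule fps_ext)
    fix k
    have "fps_nth (fps_deriv ?C) k = fps_nth (?C * Abs_fps (\<lambda>k. - trace_coeff (Suc k))) k"
      using C_function_log by (simp add: has_log_coeffs_def)
    then have rec: "of_nat (Suc k) * fps_nth ?C (Suc k) = (\<Sum>i=0..k. fps_nth ?C i * - trace_coeff (Suc (k - i)))"
      by (simp add: fps_mult_nth)
    have "fps_nth (fps_deriv C') k = of_nat (Suc k) * fps_to_ac (fps_nth ?C (Suc k))" by (simp add: C'_def)
    also have "\<dots> = fps_to_ac (of_nat (Suc k) * fps_nth ?C (Suc k))"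
      unfolding fps_to_ac_mult fps_of_nat[symmetric] fps_to_ac_const to_ac_of_nat ..
    also have "\<dots> = (\<Sum>i=0..k. fps_nth C' i * - normalized_sum (Suc (k - i)))"
      unfolding rec fps_to_ac_sum fps_to_ac_mult fps_to_ac_uminus
      by (intro sum.cong refl) (simp add: C'_def fps_to_ac_trace_coeff)
    also have "\<dots> = fps_nth (- (C' * Abs_fps (\<lambda>k. normalized_sum (Suc k)))) k"
      by (simp add: fps_mult_nth sum_negf)
    finally show "fps_nth (fps_deriv C') k = fps_nth (- (C' * Abs_fps (\<lambda>k. normalized_sum (Suc k)))) k" .
  qed
  \<comment> \<open>The slope is multiplied by \<open>width\<close> because orders are measured
    there in units of \<open>1 / width\<close>.\<close>
  note order = coefficient_order[OF C0 this, of "M * width"]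
  let ?B = "card (lattice_box (int (M * width)) :: (int ^ 'n) set)"
  have "ord_ge 1 (int M * (int k - int ?B)) (fps_nth ?C k)" for k
    unfolding ord_ge_def
  proof (intro allI impI)
    fix i assume i: "int 1 * int i < int M * (int k - int ?B)"
    have "width > 0" unfolding width_def by simp
    then have "int width > 0" by (simp only: of_nat_0_less_iff)
    then have "int width * int i < int width * (int M * (int k - int ?B))" using i by simp
    also have "\<dots> = int (M * width) * (int k - int ?B)" by simp
    finally have "fps_nth (fps_nth C' k) i = 0" using order[of k] unfolding ord_ge_def by blast
    then show "fps_nth (fps_nth ?C k) i = 0" by (simp add: C'_def)
  qed
  then show "\<exists>B. \<forall>k. ord_ge 1 (int M * (int k - int B)) (fps_nth ?C k)" by blast
qed

text \<open>For \<open>c = q\<close> and exponent \<open>n\<close>, the factor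
  \<open>(q^k - 1)^n\<close> cancels the normalisation in the logarithmic coefficients of
  \<open>C_f\<close>, so those of \<open>G\<close> and \<open>H\<close> differ by the sums that
  define \<open>L_f\<close>.\<close>

lemma L_function_meromorphic: "T_adic_meromorphic (L_function q f)"
proof -
  let ?c = "of_nat q :: 'p padic"
  obtain G H \<alpha> \<beta> where GH: "entire_growth G" "entire_growth H" "has_log_coeffs G \<alpha>" "has_log_coeffs H \<beta>"
    and eq: "\<And>k. \<alpha> k - \<beta> k = fps_const ((?c ^ k - 1) ^ CARD('n)) * trace_coeff k"
    using entire_quotient[OF C_function_growth C_function_log, of ?c "CARD('n)"] by blast
  have S: "S_sum q f k = \<alpha> k - \<beta> k" if "k \<ge> 1" for k
  proof -
    have "of_nat (q ^ k - 1) \<noteq> (0 :: 'p padic)" using order_pos[OF that] by (simp only: of_nat_eq_0_iff)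
    moreover have "(of_nat (q ^ k - 1) :: 'p padic) = ?c ^ k - 1"
      using q_ge_2 by (simp add: of_nat_diff)
    ultimately have "?c ^ k - 1 \<noteq> 0" by metis
    then have "(?c ^ k - 1) ^ CARD('n) * (1 / (?c ^ k - 1) ^ CARD('n)) = 1" by simp
    then show ?thesis
      unfolding eq trace_coeff_def by (simp only: mult.assoc[symmetric] fps_const_mult fps_const_1_eq_1 mult_1_left)
  qed
  have "has_log_coeffs (L_function q f) (S_sum q f)"
    unfolding L_function_def by (rule exp_series_has_log_coeffs)
  then have "has_log_coeffs (L_function q f * H) (\<lambda>k. S_sum q f k + \<beta> k)"
    using GH(4) by (rule has_log_coeffs_mult)
  then have "L_function q f * H = G"
    using GH(3) by (rule has_log_coeffs_unique) (simp add: S)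
  moreover have "H \<noteq> 0" using GH(4) by (auto simp: has_log_coeffs_def)
  ultimately show ?thesis
    unfolding T_adic_meromorphic_def using GH(1,2) entire_growth_imp_T_adic_entire by blast
qed

end

theorem theorem1p4:
  fixes f :: "int ^ 'n \<Rightarrow>\<^sub>0 'p :: prime_card padic_closure"
    and a q :: nat
  assumes "a \<ge> 1" and "q = CARD('p) ^ a"
    and "\<And>u. Poly_Mapping.lookup f u \<in> Z_unram q"
    and "\<And>u. Poly_Mapping.lookup f u \<noteq> 0 \<Longrightarrow> Poly_Mapping.lookup f u \<in> roots_of_unity (q - 1)"
  shows "T_adic_entire (C_function q f) \<and> T_adic_meromorphic (L_function q f)"
proof -
  interpret exponential_sum f a q using assms by unfold_locales
  show ?thesis using entire_growth_imp_T_adic_entire[OF C_function_growth] L_function_meromorphic by blast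
qed

end
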